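(* It is NP-hard to determine $cs(T,w)$ for a given star $T$ of order $n$ and a given weight function $w:V(T)\to \mathbb{N}$ for which there is one vertex $u^*$ of $T$ such that $\frac{1}{n}w(T)\leq 4\min\{ w(u):u\in V(T)\setminus \{ u^*\}\}$.
   Context: For a graph $G$, a weight function $w:V(G)\to\mathbb{Z}_{\geq 0}$, a set $U\subseteq V(G)$ and a subgraph $H$ of $G$, let $w(U)=\sum_{u\in U}w(u)$ and $w(H)=w(V(H))$. Two disjoint subgraphs $C,D$ of $G$ are adjacent if some vertex of $C$ is adjacent to some vertex of $D$. A set $S\subseteq V(G)$ is $w$-safe if $w(C)\geq w(D)$ for every component $C$ of the induced subgraph $G[S]$ and every component $D$ of $G-S$ such that $D$ is adjacent to $C$. A set $S$ is connected if $G[S]$ is connected. The connected safe number $cs(G,w)$ is the minimum of $w(S)$ over all connected $w$-safe sets $S$ in $G$. Here $\mathbb{N}$ denotes the positive integers. *)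

theory Defs
  imports
    "HOL-Computational_Algebra.Polynomial"
    "Graph_Theory.Graph_Theory"
begin

section \<open>Multi-tape Turing machines\<close>

text \<open>
  Deterministic machines with any fixed number of two-way infinite tapes and any finite tape
  alphabet. Symbols are the numbers below \<^term>\<open>symbols M\<close>, where 0 is the blank and 1, 2 stand
  for the bits \<^term>\<open>False\<close>, \<^term>\<open>True\<close>. The working states are the numbers below
  \<^term>\<open>states M\<close>; the initial state is 0, and \<^term>\<open>states M\<close> itself is the halting state.
\<close>

datatype dir = Left | Stay | Right

record tm =
  tapes :: nat
  symbols :: nat
  states :: nat
  delta :: "nat \<Rightarrow> nat list \<Rightarrow> nat \<times> (nat \<times> dir) list"

definition wf_tm :: "tm \<Rightarrow> bool" where
  "wf_tm M \<longleftrightarrow> tapes M \<ge> 1 \<and> symbols M \<ge> 3 \<and>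
    (\<forall>q < states M. \<forall>ss. length ss = tapes M \<and> set ss \<subseteq> {..<symbols M} \<longrightarrow>
      (case delta M q ss of (q', acts) \<Rightarrow>
        q' \<le> states M \<and> length acts = tapes M \<and> fst ` set acts \<subseteq> {..<symbols M}))"

text \<open>A tape is its contents together with the head position.\<close>

type_synonym tape = "(int \<Rightarrow> nat) \<times> int"
type_synonym config = "nat \<times> tape list"

fun shift :: "dir \<Rightarrow> int" where
  "shift Left = -1"
| "shift Stay = 0"
| "shift Right = 1"

fun act :: "nat \<times> dir \<Rightarrow> tape \<Rightarrow> tape" where
  "act (s, d) (t, p) = (t(p := s), p + shift d)"

fun step :: "tm \<Rightarrow> config \<Rightarrow> config" where
  "step M (q, tps) =
    (if q < states M
     then (case delta M q (map (\<lambda>(t, p). t p) tps) of (q', acts) \<Rightarrow> (q', map2 act acts tps))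
     else (q, tps))"

definition sym_of_bit :: "bool \<Rightarrow> nat" where
  "sym_of_bit b = (if b then 2 else 1)"

definition blank_tape :: tape where
  "blank_tape = (\<lambda>_. 0, 0)"

definition input_tape :: "bool list \<Rightarrow> tape" where
  "input_tape x = (\<lambda>i. if 0 \<le> i \<and> i < int (length x) then sym_of_bit (x ! nat i) else 0, 0)"

definition init_config :: "tm \<Rightarrow> bool list \<Rightarrow> config" where
  "init_config M x = (0, input_tape x # replicate (tapes M - 1) blank_tape)"

text \<open>The output is the string from cell 0 of the last tape up to the first blank.\<close>

definition has_output :: "config \<Rightarrow> bool list \<Rightarrow> bool" where
  "has_output c y \<longleftrightarrow>
    (\<forall>i < length y. fst (last (snd c)) (int i) = sym_of_bit (y ! i)) \<and>
    fst (last (snd c)) (int (length y)) = 0"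

definition computes_in_time :: "tm \<Rightarrow> (bool list \<Rightarrow> bool list) \<Rightarrow> (nat \<Rightarrow> nat) \<Rightarrow> bool" where
  "computes_in_time M f T \<longleftrightarrow>
    (\<forall>x. \<exists>t \<le> T (length x).
      fst ((step M ^^ t) (init_config M x)) = states M \<and>
      has_output ((step M ^^ t) (init_config M x)) (f x))"

definition polytime_computable :: "(bool list \<Rightarrow> bool list) \<Rightarrow> bool" where
  "polytime_computable f \<longleftrightarrow>
    (\<exists>M (p :: nat poly). wf_tm M \<and> computes_in_time M f (poly p))"


section \<open>NP and NP-hardness\<close>

text \<open>Pairing of bit strings: the first component with every bit doubled, the separator 01, and
  the second component.\<close>

definition pair_str :: "bool list \<Rightarrow> bool list \<Rightarrow> bool list" where
  "pair_str x y = concat (map (\<lambda>b. [b, b]) x) @ [False, True] @ y"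

definition P_class :: "bool list set set" where
  "P_class = {L. polytime_computable (\<lambda>x. [x \<in> L])}"

definition NP_class :: "bool list set set" where
  "NP_class = {L. \<exists>R \<in> P_class. \<exists>p :: nat poly.
    \<forall>x. x \<in> L \<longleftrightarrow> (\<exists>y. length y \<le> poly p (length x) \<and> pair_str x y \<in> R)}"

text \<open>
  NP-hardness of the promise problem with yes-instances \<open>Y\<close> and no-instances \<open>N\<close>, under
  polynomial-time many-one reductions. An ordinary language \<open>A\<close> is the case \<open>Y = A\<close>, \<open>N = - A\<close>.
\<close>

definition NP_hard_promise :: "bool list set \<Rightarrow> bool list set \<Rightarrow> bool" where
  "NP_hard_promise Y N \<longleftrightarrow>
    (\<forall>L \<in> NP_class. \<exists>f. polytime_computable f \<and>
      (\<forall>x. (x \<in> L \<longrightarrow> f x \<in> Y) \<and> (x \<notin> L \<longrightarrow> f x \<in> N)))"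

text \<open>Binary representation, least significant bit first, without leading zeros.\<close>

fun bits :: "nat \<Rightarrow> bool list" where
  "bits m = (if m = 0 then [] else odd m # bits (m div 2))"

declare bits.simps [simp del]

text \<open>
  NP-hardness of determining the minimum \<open>val i\<close> for a given instance \<open>i \<in> I\<close> means, as usual for
  minimization problems, NP-hardness of deciding for given \<open>i \<in> I\<close> and \<open>k\<close>, in binary, whether
  \<open>val i \<le> k\<close>. Only members of \<open>I\<close> are given as instances, whence the promise.
\<close>

definition NP_hard_to_determine :: "('i \<Rightarrow> bool list) \<Rightarrow> 'i set \<Rightarrow> ('i \<Rightarrow> nat) \<Rightarrow> bool" where
  "NP_hard_to_determine enc I val \<longleftrightarrow>
    NP_hard_promise
      {pair_str (enc i) (bits k) | i k. i \<in> I \<and> val i \<le> k}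
      {pair_str (enc i) (bits k) | i k. i \<in> I \<and> \<not> val i \<le> k}"


section \<open>Connected safe sets\<close>

text \<open>
  Undirected simple graphs are the symmetric digraphs satisfying \<^const>\<open>graph\<close>. In these the
  components are the strongly connected components. Both \<^const>\<open>connected\<close> and
  \<^const>\<open>pre_digraph.sccs\<close> refer to nonempty graphs only.
\<close>

definition weight :: "('a \<Rightarrow> nat) \<Rightarrow> ('a, 'b) pre_digraph \<Rightarrow> nat" where
  "weight w H = sum w (verts H)"

definition adjacent_subgraphs ::
    "('a, 'b) pre_digraph \<Rightarrow> ('a, 'b) pre_digraph \<Rightarrow> ('a, 'b) pre_digraph \<Rightarrow> bool" where
  "adjacent_subgraphs G C D \<longleftrightarrow> (\<exists>u \<in> verts C. \<exists>v \<in> verts D. u \<rightarrow>\<^bsub>G\<^esub> v)"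

definition safe :: "('a, 'b) pre_digraph \<Rightarrow> ('a \<Rightarrow> nat) \<Rightarrow> 'a set \<Rightarrow> bool" where
  "safe G w S \<longleftrightarrow> S \<subseteq> verts G \<and>
    (\<forall>C \<in> pre_digraph.sccs (G \<restriction> S). \<forall>D \<in> pre_digraph.sccs (G \<restriction> (verts G - S)).
      adjacent_subgraphs G C D \<longrightarrow> weight w C \<ge> weight w D)"

definition cs :: "('a, 'b) pre_digraph \<Rightarrow> ('a \<Rightarrow> nat) \<Rightarrow> nat" where
  "cs G w = Min {sum w S | S. safe G w S \<and> connected (G \<restriction> S)}"

text \<open>The stars are the graphs \<open>K\<^sub>1\<^sub>,\<^sub>q\<close> with \<open>q \<ge> 1\<close>.\<close>

definition star :: "('a, 'b) pre_digraph \<Rightarrow> bool" where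
  "star G \<longleftrightarrow> graph G \<and> card (verts G) \<ge> 2 \<and>
    (\<exists>c \<in> verts G. \<forall>u \<in> verts G. \<forall>v \<in> verts G. u \<rightarrow>\<^bsub>G\<^esub> v \<longleftrightarrow> u \<noteq> v \<and> (u = c \<or> v = c))"


section \<open>Encoding of weighted graphs\<close>

text \<open>Self-delimiting binary: a \<^term>\<open>True\<close> announces each bit, and \<^term>\<open>False\<close> ends the number.\<close>

definition enc_nat :: "nat \<Rightarrow> bool list" where
  "enc_nat m = concat (map (\<lambda>b. [True, b]) (bits m)) @ [False]"

text \<open>
  A weighted graph with vertex set \<open>{..<n}\<close> is encoded as \<open>n\<close> in unary, the weights in binary and
  the adjacency matrix row by row.
\<close>

definition enc_weighted_graph :: "nat pair_pre_digraph \<times> (nat \<Rightarrow> nat) \<Rightarrow> bool list" where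
  "enc_weighted_graph = (\<lambda>(G, w). let n = card (pverts G) in
    replicate n True @ [False] @
    concat (map (\<lambda>i. enc_nat (w i)) [0..<n]) @
    concat (map (\<lambda>i. map (\<lambda>j. (i, j) \<in> parcs G) [0..<n]) [0..<n]))"

end

theory Submission
  imports Defs
begin

text \<open>
  A connected set of a star either contains the center or is a single leaf. If one leaf is heavier
  than all other vertices but not than the rest together, then a connected safe set of weight at
  most that of the heavy leaf is the center plus a set of light leaves that together weigh exactly
  as much. Numbers in a base without carries turn exact cover into this subset sum problem, and a
  common leading digit 1 makes all light weights agree up to a factor 2; dummy leaves make up for
  the unknown size of the cover.

  A run of a verifier is an exact cover: every cell content, head position and state is a wire
  from the moment that produces it to the moment that consumes it, and a wire is either used
  exactly once at both ends or covered by its idle item. The certificate is guessed cell by cell,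
  each bit paying with one of exactly \<open>p (length x)\<close> tokens.

  The reduction is a list comprehension over loop variables below \<open>length x + 2\<close> with tests for
  equality, successor and input symbols, apart from one count that is needed in binary. Such
  printing tasks are closed under nesting and run in polynomial time on a multi-tape machine, where
  loop variables are head positions.
\<close>

section \<open>A structured language for Turing machines\<close>

text \<open>Hardness is proved against every language of NP, so the reduction starts from an
  arbitrary verifier. What shapes it is that the reduction itself must be a Turing machine: each
  condition describing the exact cover instance has to be reduced to tests that a few heads on tapes
  of linear length can perform. Hence times and positions are written with a fixed number of digits
  in base \<open>length x + 2\<close>, the acceptance time is a pure power of this base, and the
  bound on the certificate length is never computed: it is the number of digit strings of an easily
  recognised form. Positions are split as \<open>2 * P + h\<close> because \<open>pair_str\<close>
  doubles every bit of its first component. The two copies of an input bit then share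
  \<open>P\<close>, whose last digit points at that bit, while \<open>h\<close> is a constant of the
  printing program. Only the binary representation of the number of items has no such local
  description; it is counted on a scratch tape.\<close>

datatype com =
    Do nat "nat \<Rightarrow> nat \<times> dir"
  | Seq com com
  | Cond nat "nat \<Rightarrow> bool" com com
  | Loop nat "nat \<Rightarrow> bool" com

definition scan :: "tape \<Rightarrow> nat" where
  "scan T = fst T (snd T)"

text \<open>The time index is the exact number of steps of the compiled code, so every evaluation of
  a test costs one step. Tapes form a function, which keeps the semantics independent of their
  number.\<close>

inductive exec :: "com \<Rightarrow> (nat \<Rightarrow> tape) \<Rightarrow> nat \<Rightarrow> (nat \<Rightarrow> tape) \<Rightarrow> bool" where
  exec_Do: "exec (Do i h) \<tau> 1 (\<tau>(i := act (h (scan (\<tau> i))) (\<tau> i)))"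
| exec_Seq: "exec c1 \<tau> t1 \<tau>1 \<Longrightarrow> exec c2 \<tau>1 t2 \<tau>2 \<Longrightarrow> exec (Seq c1 c2) \<tau> (t1 + t2) \<tau>2"
| exec_Cond_True: "P (scan (\<tau> i)) \<Longrightarrow> exec c1 \<tau> t \<tau>' \<Longrightarrow> exec (Cond i P c1 c2) \<tau> (Suc t) \<tau>'"
| exec_Cond_False: "\<not> P (scan (\<tau> i)) \<Longrightarrow> exec c2 \<tau> t \<tau>' \<Longrightarrow> exec (Cond i P c1 c2) \<tau> (Suc t) \<tau>'"
| exec_Loop_False: "\<not> P (scan (\<tau> i)) \<Longrightarrow> exec (Loop i P c) \<tau> 1 \<tau>"
| exec_Loop_True: "P (scan (\<tau> i)) \<Longrightarrow> exec c \<tau> t1 \<tau>1 \<Longrightarrow> exec (Loop i P c) \<tau>1 t2 \<tau>2 \<Longrightarrow>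
    exec (Loop i P c) \<tau> (Suc (t1 + t2)) \<tau>2"

primrec wf_com :: "nat \<Rightarrow> nat \<Rightarrow> com \<Rightarrow> bool" where
  "wf_com k S (Do i h) \<longleftrightarrow> i < k \<and> (\<forall>s<S. fst (h s) < S)"
| "wf_com k S (Seq c1 c2) \<longleftrightarrow> wf_com k S c1 \<and> wf_com k S c2"
| "wf_com k S (Cond i P c1 c2) \<longleftrightarrow> i < k \<and> wf_com k S c1 \<and> wf_com k S c2"
| "wf_com k S (Loop i P c) \<longleftrightarrow> i < k \<and> wf_com k S c"

lemma wf_com_mono: "wf_com k S c \<Longrightarrow> k \<le> k' \<Longrightarrow> wf_com k' S c"
  by (induction c) auto

primrec csize :: "com \<Rightarrow> nat" where
  "csize (Do i h) = 1"
| "csize (Seq c1 c2) = csize c1 + csize c2"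
| "csize (Cond i P c1 c2) = Suc (csize c1 + csize c2)"
| "csize (Loop i P c) = Suc (csize c)"

definition idle_acts :: "nat list \<Rightarrow> (nat \<times> dir) list" where
  "idle_acts ss = map (\<lambda>s. (s, Stay)) ss"

text \<open>The states of the code of \<open>c\<close> are the numbers below \<open>csize c\<close>; its exit is \<open>csize c\<close>.
  The function \<open>reloc\<close> places such a code at address \<open>a\<close> with exit \<open>ex\<close>.\<close>

definition reloc :: "nat \<Rightarrow> nat \<Rightarrow> nat \<Rightarrow> nat \<times> 'a \<Rightarrow> nat \<times> 'a" where
  "reloc n a ex r = (if fst r = n then ex else a + fst r, snd r)"

primrec code :: "com \<Rightarrow> nat \<Rightarrow> nat list \<Rightarrow> nat \<times> (nat \<times> dir) list" where
  "code (Do i h) q ss = (1, map (\<lambda>j. if j = i then h (ss ! j) else (ss ! j, Stay)) [0..<length ss])"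
| "code (Seq c1 c2) q ss =
    (if q < csize c1 then code c1 q ss
     else reloc (csize c2) (csize c1) (csize c1 + csize c2) (code c2 (q - csize c1) ss))"
| "code (Cond i P c1 c2) q ss =
    (if q = 0 then (if P (ss ! i) then 1 else Suc (csize c1), idle_acts ss)
     else if q < Suc (csize c1) then reloc (csize c1) 1 (Suc (csize c1 + csize c2)) (code c1 (q - 1) ss)
     else reloc (csize c2) (Suc (csize c1)) (Suc (csize c1 + csize c2)) (code c2 (q - Suc (csize c1)) ss))"
| "code (Loop i P c) q ss =
    (if q = 0 then (if P (ss ! i) then 1 else Suc (csize c), idle_acts ss)
     else reloc (csize c) 1 0 (code c (q - 1) ss))"

lemma csize_pos: "csize c > 0"
  by (induction c) auto

lemma code_wf:
  assumes "wf_com k S c" "q < csize c" "length ss = k" "set ss \<subseteq> {..<S}"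
  shows "fst (code c q ss) \<le> csize c \<and> length (snd (code c q ss)) = k \<and>
    fst ` set (snd (code c q ss)) \<subseteq> {..<S}"
  using assms
proof (induction c arbitrary: q)
  case (Do i h)
  then show ?case by (auto simp: subset_iff)
next
  case (Seq c1 c2)
  show ?case
  proof (cases "q < csize c1")
    case True
    with Seq.IH(1)[of q] Seq.prems show ?thesis by auto
  next
    case False
    with Seq.IH(2)[of "q - csize c1"] Seq.prems show ?thesis by (auto simp: reloc_def)
  qed
next
  case (Cond i P c1 c2)
  consider "q = 0" | "q \<noteq> 0" "q < Suc (csize c1)" | "q \<ge> Suc (csize c1)" by linarith
  then show ?case
  proof cases
    case 1
    with Cond.prems show ?thesis by (auto simp: idle_acts_def)
  next
    case 2
    with Cond.IH(1)[of "q - 1"] Cond.prems show ?thesis by (auto simp: reloc_def intro: trans_le_add1)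
  next
    case 3
    with Cond.IH(2)[of "q - Suc (csize c1)"] Cond.prems show ?thesis by (auto simp: reloc_def)
  qed
next
  case (Loop i P c)
  show ?case
  proof (cases "q = 0")
    case True
    with Loop.prems show ?thesis by (auto simp: idle_acts_def)
  next
    case False
    with Loop.IH[of "q - 1"] Loop.prems show ?thesis by (auto simp: reloc_def)
  qed
qed

text \<open>Subprograms occupy blocks of one transition table. With the machine fixed and only
  address and exit varying, the run lemma can be proved by induction on \<open>exec\<close>.\<close>

definition located :: "tm \<Rightarrow> com \<Rightarrow> nat \<Rightarrow> nat \<Rightarrow> bool" where
  "located M c a ex \<longleftrightarrow> a + csize c \<le> states M \<and>
    (\<forall>q<csize c. \<forall>ss. delta M (a + q) ss = reloc (csize c) a ex (code c q ss))"

lemma code_le: "q < csize c \<Longrightarrow> fst (code c q ss) \<le> csize c"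
proof (induction c arbitrary: q)
  case (Seq c1 c2)
  then show ?case
    using Seq.IH(1)[of q] Seq.IH(2)[of "q - csize c1"] by (auto simp: reloc_def intro: trans_le_add1)
next
  case (Cond i P c1 c2)
  then show ?case
    using Cond.IH(1)[of "q - 1"] Cond.IH(2)[of "q - Suc (csize c1)"] by (auto simp: reloc_def intro: trans_le_add1)
next
  case (Loop i P c)
  then show ?case using Loop.IH[of "q - 1"] by (auto simp: reloc_def)
qed auto

lemma located_Seq:
  assumes "located M (Seq c1 c2) a ex"
  shows "located M c1 a (a + csize c1)" "located M c2 (a + csize c1) ex"
proof -
  have d: "delta M (a + q) ss = reloc (csize c1 + csize c2) a ex (code (Seq c1 c2) q ss)"
    if "q < csize c1 + csize c2" for q ss
    using assms that by (auto simp: located_def)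
  show "located M c1 a (a + csize c1)"
    using assms d csize_pos[of c2] code_le[of _ c1]
    by (auto simp: located_def reloc_def) (metis add_cancel_right_right le_antisym le_add1 not_gr_zero)+
  have "delta M (a + csize c1 + q) ss = reloc (csize c2) (a + csize c1) ex (code c2 q ss)"
    if "q < csize c2" for q ss
    using d[of "csize c1 + q" ss] that csize_pos[of c2] by (auto simp: reloc_def add.assoc)
  then show "located M c2 (a + csize c1) ex"
    using assms by (auto simp: located_def)
qed

lemma located_Cond:
  assumes "located M (Cond i P c1 c2) a ex"
  shows "located M c1 (Suc a) ex" "located M c2 (Suc (a + csize c1)) ex"
    "delta M a ss = (if P (ss ! i) then Suc a else Suc (a + csize c1), idle_acts ss)"
proof -
  have d: "delta M (a + q) ss = reloc (Suc (csize c1 + csize c2)) a ex (code (Cond i P c1 c2) q ss)"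
    if "q < Suc (csize c1 + csize c2)" for q ss
    using assms that by (auto simp: located_def)
  have 1: "delta M (Suc a + q) ss = reloc (csize c1) (Suc a) ex (code c1 q ss)" if "q < csize c1" for q ss
    using d[of "Suc q" ss] that code_le[of q c1 ss] by (auto simp: reloc_def)
  have 2: "delta M (Suc (a + csize c1) + q) ss = reloc (csize c2) (Suc (a + csize c1)) ex (code c2 q ss)"
    if "q < csize c2" for q ss
    using d[of "Suc (csize c1) + q" ss] that code_le[of q c2 ss] by (auto simp: reloc_def add.assoc)
  show "located M c1 (Suc a) ex" "located M c2 (Suc (a + csize c1)) ex"
    using assms 1 2 by (auto simp: located_def)
  show "delta M a ss = (if P (ss ! i) then Suc a else Suc (a + csize c1), idle_acts ss)"
    using d[of 0 ss] csize_pos[of c1] csize_pos[of c2] by (auto simp: reloc_def)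
qed

lemma located_Loop:
  assumes "located M (Loop i P c) a ex"
  shows "located M c (Suc a) a"
    "delta M a ss = (if P (ss ! i) then Suc a else ex, idle_acts ss)"
proof -
  have d: "delta M (a + q) ss = reloc (Suc (csize c)) a ex (code (Loop i P c) q ss)"
    if "q < Suc (csize c)" for q ss
    using assms that by (auto simp: located_def)
  have 1: "delta M (Suc a + q) ss = reloc (csize c) (Suc a) a (code c q ss)" if "q < csize c" for q ss
    using d[of "Suc q" ss] that code_le[of q c ss] by (auto simp: reloc_def)
  then show "located M c (Suc a) a"
    using assms by (auto simp: located_def)
  show "delta M a ss = (if P (ss ! i) then Suc a else ex, idle_acts ss)"
    using d[of 0 ss] csize_pos[of c] by (auto simp: reloc_def)
qed

lemma act_stay: "act (scan T, Stay) T = T"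
  by (cases T) (auto simp: scan_def)

lemma scans_map: "map (\<lambda>(t, p). t p) (map \<tau> [0..<k]) = map (\<lambda>j. scan (\<tau> j)) [0..<k]"
  by (auto simp: scan_def case_prod_beta)

lemma map2_idle: "map2 act (idle_acts (map (\<lambda>j. scan (\<tau> j)) [0..<k])) (map \<tau> [0..<k]) = map \<tau> [0..<k]"
  by (rule nth_equalityI) (auto simp: idle_acts_def act_stay)

lemma located_states: "located M c a ex \<Longrightarrow> a < states M"
  using csize_pos[of c] by (auto simp: located_def)

text \<open>Each subderivation is a run through its own block. The body of a loop has the address of
  the test as its exit, so the induction hypothesis for the remaining rounds applies at the same
  address.\<close>

lemma exec_run:
  assumes "exec c \<tau> t \<tau>'" "wf_com k S c" "located M c a ex"
  shows "(step M ^^ t) (a, map \<tau> [0..<k]) = (ex, map \<tau>' [0..<k])"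
  using assms
proof (induction arbitrary: a ex rule: exec.induct)
  case (exec_Do i h \<tau>)
  let ?ss = "map (\<lambda>j. scan (\<tau> j)) [0..<k]"
  have d: "delta M a ?ss = (ex, map (\<lambda>j. if j = i then h (?ss ! j) else (?ss ! j, Stay)) [0..<k])"
    using exec_Do.prems(2) by (force simp: located_def reloc_def)
  have "map2 act (map (\<lambda>j. if j = i then h (?ss ! j) else (?ss ! j, Stay)) [0..<k]) (map \<tau> [0..<k])
    = map (\<tau>(i := act (h (scan (\<tau> i))) (\<tau> i))) [0..<k]"
    by (rule nth_equalityI) (auto simp: act_stay)
  then show ?case
    using located_states[OF exec_Do.prems(2)]
    by (simp only: One_nat_def funpow.simps o_apply id_apply step.simps scans_map d) simp
next
  case (exec_Seq c1 \<tau> t1 \<tau>1 c2 t2 \<tau>2)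
  have "(step M ^^ (t2 + t1)) (a, map \<tau> [0..<k]) = (ex, map \<tau>2 [0..<k])"
    using exec_Seq.IH(1)[OF _ located_Seq(1)[OF exec_Seq.prems(2)]]
      exec_Seq.IH(2)[OF _ located_Seq(2)[OF exec_Seq.prems(2)]] exec_Seq.prems(1)
    by (auto simp: funpow_add)
  then show ?case by (simp add: add.commute)
next
  case (exec_Cond_True P \<tau> i c1 t \<tau>' c2)
  have "step M (a, map \<tau> [0..<k]) = (Suc a, map \<tau> [0..<k])"
    using located_states[OF exec_Cond_True.prems(2)] exec_Cond_True
    by (simp only: step.simps scans_map located_Cond(3)[OF exec_Cond_True.prems(2)]) (simp add: map2_idle)
  with exec_Cond_True.IH[OF _ located_Cond(1)[OF exec_Cond_True.prems(2)]] exec_Cond_True.prems show ?case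
    by (simp add: funpow_Suc_right del: funpow.simps)
next
  case (exec_Cond_False P \<tau> i c2 t \<tau>' c1)
  have "step M (a, map \<tau> [0..<k]) = (Suc (a + csize c1), map \<tau> [0..<k])"
    using located_states[OF exec_Cond_False.prems(2)] exec_Cond_False
    by (simp only: step.simps scans_map located_Cond(3)[OF exec_Cond_False.prems(2)]) (simp add: map2_idle)
  with exec_Cond_False.IH[OF _ located_Cond(2)[OF exec_Cond_False.prems(2)]] exec_Cond_False.prems show ?case
    by (simp add: funpow_Suc_right del: funpow.simps)
next
  case (exec_Loop_False P \<tau> i c)
  then show ?case
    using located_states[OF exec_Loop_False.prems(2)]
    by (simp only: One_nat_def funpow.simps o_apply id_apply step.simps scans_map located_Loop(2)[OF exec_Loop_False.prems(2)])
      (simp add: map2_idle)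
next
  case (exec_Loop_True P \<tau> i c t1 \<tau>1 t2 \<tau>2)
  have "step M (a, map \<tau> [0..<k]) = (Suc a, map \<tau> [0..<k])"
    using located_states[OF exec_Loop_True.prems(2)] exec_Loop_True
    by (simp only: step.simps scans_map located_Loop(2)[OF exec_Loop_True.prems(2)]) (simp add: map2_idle)
  moreover have "(step M ^^ t1) (Suc a, map \<tau> [0..<k]) = (a, map \<tau>1 [0..<k])"
    using exec_Loop_True.IH(1)[OF _ located_Loop(1)[OF exec_Loop_True.prems(2)]] exec_Loop_True.prems by simp
  moreover have "(step M ^^ t2) (a, map \<tau>1 [0..<k]) = (ex, map \<tau>2 [0..<k])"
    using exec_Loop_True.IH(2)[OF exec_Loop_True.prems] .
  ultimately have "(step M ^^ (t2 + t1 + 1)) (a, map \<tau> [0..<k]) = (ex, map \<tau>2 [0..<k])"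
    by (simp only: funpow_add o_apply) simp
  then show ?case by (simp add: add.commute)
qed

definition init_tapes :: "bool list \<Rightarrow> nat \<Rightarrow> tape" where
  "init_tapes x i = (if i = 0 then input_tape x else blank_tape)"

text \<open>The output tape, the last one, must agree everywhere with an input tape carrying the
  result; this supplies the blank that ends the output. Its head may stand anywhere, since
  \<open>has_output\<close> reads fixed cells.\<close>

lemma polytime_computable_exec:
  fixes p :: "nat poly"
  assumes wf: "wf_com (Suc k) S c" and S: "S \<ge> 3"
    and run: "\<And>x. \<exists>t \<tau>. t \<le> poly p (length x) \<and> exec c (init_tapes x) t \<tau> \<and>
      (\<exists>pos. \<tau> k = (fst (input_tape (f x)), pos))"
  shows "polytime_computable f"
proof -
  define M where "M = \<lparr>tapes = Suc k, symbols = S, states = csize c, delta = code c\<rparr>"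
  have "located M c 0 (csize c)"
    using code_le[of _ c] by (auto simp: located_def M_def reloc_def prod_eq_iff)
  note R = exec_run[OF _ wf this]
  have "wf_tm M"
    using S code_wf[OF wf] by (auto simp: wf_tm_def M_def case_prod_beta)
  moreover have "computes_in_time M f (poly p)"
    unfolding computes_in_time_def
  proof
    fix x
    obtain t \<tau> pos where t: "t \<le> poly p (length x)" "exec c (init_tapes x) t \<tau>"
      "\<tau> k = (fst (input_tape (f x)), pos)"
      using run[of x] by blast
    have "init_config M x = (0, map (init_tapes x) [0..<Suc k])"
      by (rule prod_eqI)
        (auto simp: init_config_def M_def init_tapes_def nth_Cons' simp del: upt_Suc intro!: nth_equalityI)
    with R[OF t(2)] have r: "(step M ^^ t) (init_config M x) = (csize c, map \<tau> [0..<Suc k])"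
      by simp
    then have "has_output ((step M ^^ t) (init_config M x)) (f x)"
      using t(3) by (auto simp: has_output_def input_tape_def)
    with r t(1) show "\<exists>t\<le>poly p (length x). fst ((step M ^^ t) (init_config M x)) = states M \<and>
        has_output ((step M ^^ t) (init_config M x)) (f x)"
      by (intro exI[of _ t]) (auto simp: M_def)
  qed
  ultimately show ?thesis
    by (auto simp: polytime_computable_def)
qed

section \<open>Printing list comprehensions in polynomial time\<close>

definition runs :: "com \<Rightarrow> (nat \<Rightarrow> tape) \<Rightarrow> nat \<Rightarrow> (nat \<Rightarrow> tape) \<Rightarrow> bool" where
  "runs c \<tau> B \<tau>' \<longleftrightarrow> (\<exists>t\<le>B. exec c \<tau> t \<tau>')"

lemma runs_mono: "runs c \<tau> B \<tau>' \<Longrightarrow> B \<le> B' \<Longrightarrow> runs c \<tau> B' \<tau>'"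
  by (auto simp: runs_def intro: order_trans)

lemma runs_Do: "\<tau>' = \<tau>(i := act (h (scan (\<tau> i))) (\<tau> i)) \<Longrightarrow> runs (Do i h) \<tau> 1 \<tau>'"
  using exec_Do by (auto simp: runs_def)

lemma runs_Seq: "runs c1 \<tau> B1 \<tau>1 \<Longrightarrow> runs c2 \<tau>1 B2 \<tau>2 \<Longrightarrow> runs (Seq c1 c2) \<tau> (B1 + B2) \<tau>2"
  unfolding runs_def by (meson add_mono exec_Seq)

lemma runs_Cond:
  assumes "runs (if P (scan (\<tau> i)) then c1 else c2) \<tau> B \<tau>'"
  shows "runs (Cond i P c1 c2) \<tau> (Suc B) \<tau>'"
  using assms unfolding runs_def
  by (cases "P (scan (\<tau> i))") (auto intro: exec_Cond_True exec_Cond_False)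

text \<open>Instead of an invariant, the whole trajectory is given: \<open>\<sigma> j\<close> are
  the tapes after \<open>j\<close> rounds. This determines the number of rounds and hence the
  time.\<close>

lemma runs_Loop:
  assumes "\<And>j. j < n \<Longrightarrow> P (scan (\<sigma> j i))" "\<And>j. j < n \<Longrightarrow> runs c (\<sigma> j) B (\<sigma> (Suc j))"
    "\<not> P (scan (\<sigma> n i))"
  shows "runs (Loop i P c) (\<sigma> 0) (Suc (n * Suc B)) (\<sigma> n)"
  using assms
proof (induction n arbitrary: \<sigma>)
  case 0
  then show ?case using exec_Loop_False[of P "\<sigma> 0" i c] by (auto simp: runs_def)
next
  case (Suc n)
  have "runs (Loop i P c) (\<sigma> 1) (Suc (n * Suc B)) (\<sigma> (Suc n))"
    using Suc.IH[of "\<lambda>j. \<sigma> (Suc j)"] Suc.prems by auto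
  moreover have "runs c (\<sigma> 0) B (\<sigma> 1)" using Suc.prems(2)[of 0] by simp
  ultimately obtain t1 t2 where "t1 \<le> B" "exec c (\<sigma> 0) t1 (\<sigma> 1)" "t2 \<le> Suc (n * Suc B)"
    "exec (Loop i P c) (\<sigma> 1) t2 (\<sigma> (Suc n))"
    by (auto simp: runs_def)
  with exec_Loop_True[of P "\<sigma> 0" i c t1 "\<sigma> 1" t2] Suc.prems(1)[of 0] show ?case
    by (auto simp: runs_def intro!: exI[of _ "Suc (t1 + t2)"])
qed

section \<open>Moving heads and appending strings to a tape\<close>

definition mv :: "nat \<Rightarrow> dir \<Rightarrow> com" where
  "mv i d = Do i (\<lambda>s. (s, d))"

lemma wf_mv [simp]: "wf_com k S (mv i d) \<longleftrightarrow> i < k"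
  by (auto simp: mv_def)

lemma runs_mv: "\<tau>' = \<tau>(i := (fst (\<tau> i), snd (\<tau> i) + shift d)) \<Longrightarrow> runs (mv i d) \<tau> 1 \<tau>'"
  unfolding mv_def by (rule runs_Do) (cases "\<tau> i", auto simp: scan_def)

definition rewind :: "nat \<Rightarrow> (nat \<Rightarrow> bool) \<Rightarrow> com" where
  "rewind i P = Loop i P (mv i Left)"

lemma wf_rewind [simp]: "wf_com k S (rewind i P) \<longleftrightarrow> i < k"
  by (auto simp: rewind_def)

lemma runs_rewind:
  assumes "\<tau> i = (f, z + int k)" "\<not> P (f z)" "\<And>j. 1 \<le> j \<Longrightarrow> j \<le> k \<Longrightarrow> P (f (z + int j))"
  shows "runs (rewind i P) \<tau> (2 * k + 1) (\<tau>(i := (f, z)))"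
proof -
  define \<sigma> where "\<sigma> j = \<tau>(i := (f, z + int (k - j)))" for j
  have "runs (Loop i P (mv i Left)) (\<sigma> 0) (Suc (k * Suc 1)) (\<sigma> k)"
  proof (rule runs_Loop)
    show "runs (mv i Left) (\<sigma> j) 1 (\<sigma> (Suc j))" if "j < k" for j
      using that by (intro runs_mv) (auto simp: \<sigma>_def of_nat_diff)
  next
    fix j assume "j < k"
    then show "P (scan (\<sigma> j i))" using assms(3)[of "k - j"] by (simp add: \<sigma>_def scan_def del: of_nat_diff)
  qed (use assms in \<open>auto simp: \<sigma>_def scan_def\<close>)
  moreover have "\<sigma> 0 = \<tau>" using assms(1) by (auto simp: \<sigma>_def)
  ultimately show ?thesis by (simp add: rewind_def \<sigma>_def mult_2)
qed

definition strf :: "bool list \<Rightarrow> int \<Rightarrow> nat" where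
  "strf s = fst (input_tape s)"

lemma input_tape_eq: "input_tape s = (strf s, 0)"
  by (simp add: strf_def input_tape_def)

lemma sym_of_bit_simps [simp]: "sym_of_bit b \<noteq> 0" "sym_of_bit b < 5" "sym_of_bit b = 2 \<longleftrightarrow> b"
    "sym_of_bit b \<noteq> 3" "sym_of_bit b \<noteq> 4" "sym_of_bit b = 1 \<longleftrightarrow> \<not> b"
  by (auto simp: sym_of_bit_def)

lemma strf_nth: "i < length s \<Longrightarrow> strf s (int i) = sym_of_bit (s ! i)"
  by (simp add: strf_def input_tape_def)

lemma strf_eq_0: "strf s z = 0 \<longleftrightarrow> z < 0 \<or> z \<ge> int (length s)"
  by (auto simp: strf_def input_tape_def)

lemma strf_upd: "(strf (xs @ b # ys))(int (length xs) := sym_of_bit b') = strf (xs @ b' # ys)"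
proof
  fix z
  consider "z < 0" | "z = int (length xs)" | n where "z = int n" "n < length xs" |
    n where "z = int n" "n > length xs"
    by (cases z rule: int_cases2) (auto, metis linorder_neqE_nat)
  then show "((strf (xs @ b # ys))(int (length xs) := sym_of_bit b')) z = strf (xs @ b' # ys) z"
    by cases (auto simp: strf_def input_tape_def nth_append nth_Cons')
qed

lemma strf_snoc: "(strf xs)(int (length xs) := sym_of_bit b) = strf (xs @ [b])"
proof
  fix z
  consider "z < 0" | "z = int (length xs)" | n where "z = int n" "n < length xs" |
    n where "z = int n" "n > length xs"
    by (cases z rule: int_cases2) (auto, metis linorder_neqE_nat)
  then show "((strf xs)(int (length xs) := sym_of_bit b)) z = strf (xs @ [b]) z"
    by cases (auto simp: strf_def input_tape_def nth_append)
qed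

text \<open>The head rests on the first blank after the string, so printing is writing and moving
  right, and a blank tape already has this form.\<close>

definition otape :: "bool list \<Rightarrow> tape" where
  "otape s = (strf s, int (length s))"

lemma blank_otape: "blank_tape = otape []"
  by (auto simp: otape_def strf_def input_tape_def blank_tape_def)

primrec emits :: "nat \<Rightarrow> bool list \<Rightarrow> com" where
  "emits w [] = mv w Stay"
| "emits w (b # bs) = Seq (Do w (\<lambda>_. (sym_of_bit b, Right))) (emits w bs)"

lemma wf_emits [simp]: "w < k \<Longrightarrow> wf_com k 5 (emits w bs)"
  by (induction bs) auto

lemma runs_emits:
  assumes "\<tau> w = otape s" "\<tau>' = \<tau>(w := otape (s @ bs))"
  shows "runs (emits w bs) \<tau> (Suc (length bs)) \<tau>'"
  using assms
proof (induction bs arbitrary: \<tau> s)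
  case Nil
  have "runs (mv w Stay) \<tau> 1 \<tau>'"
    by (rule runs_mv) (use Nil in \<open>simp add: otape_def fun_upd_def\<close>)
  then show ?case by simp
next
  case (Cons b bs)
  have 1: "runs (Do w (\<lambda>_. (sym_of_bit b, Right))) \<tau> 1 (\<tau>(w := otape (s @ [b])))"
    using Cons.prems by (intro runs_Do) (auto simp: otape_def strf_snoc)
  have 2: "runs (emits w bs) (\<tau>(w := otape (s @ [b]))) (Suc (length bs)) \<tau>'"
    using Cons.IH[of "\<tau>(w := otape (s @ [b]))" "s @ [b]"] Cons.prems by (simp add: fun_upd_def cong: if_cong)
  show ?case using runs_Seq[OF 1 2] by simp
qed

text \<open>Loop variables are head positions on a ruler that also carries the input, so that the
  input symbol at a loop variable is scanned directly.\<close>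

definition ruler :: "bool list \<Rightarrow> int \<Rightarrow> nat" where
  "ruler x z = (if z = 0 then 3 else if 1 \<le> z \<and> z \<le> int (length x) then sym_of_bit (x ! nat (z - 1))
    else if z = int (length x) + 1 then 4 else 0)"

definition mark0 :: "int \<Rightarrow> nat" where
  "mark0 z = (if z = 0 then 3 else 0)"

lemma ruler_eq_3 [simp]: "ruler x z = 3 \<longleftrightarrow> z = 0"
  by (auto simp: ruler_def)

lemma ruler_eq_0: "ruler x z = 0 \<longleftrightarrow> z < 0 \<or> z \<ge> int (length x) + 2"
  by (auto simp: ruler_def)

lemma ruler_eq_4: "ruler x z = 4 \<longleftrightarrow> z = int (length x) + 1"
  by (auto simp: ruler_def)

text \<open>Tape 0 is the input, tapes 1 to \<open>R\<close> are rulers, one per loop variable, and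
  tape \<open>Suc R\<close> is a unary scratch counter. Rulers beyond the current variables are
  parked at cell 0, ready for an inner loop.\<close>

definition regs :: "nat \<Rightarrow> bool list \<Rightarrow> nat list \<Rightarrow> (nat \<Rightarrow> tape) \<Rightarrow> bool" where
  "regs R x e \<tau> \<longleftrightarrow> (\<forall>r<R. \<tau> (Suc r) = (ruler x, int (if r < length e then e ! r else 0))) \<and>
    \<tau> (Suc R) = (mark0, 0)"

lemma regs_upd [simp]: "w > Suc R \<Longrightarrow> regs R x e (\<tau>(w := T)) = regs R x e \<tau>"
  by (auto simp: regs_def)

definition env :: "nat \<Rightarrow> bool list \<Rightarrow> nat list \<Rightarrow> bool" where
  "env d x e \<longleftrightarrow> length e = d \<and> (\<forall>v\<in>set e. v < length x + 2)"

text \<open>All tapes except \<open>w\<close> return to their previous state, which is what allows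
  programs to be sequenced and nested. One polynomial bounds both the time and the length of the
  output.\<close>

definition implements :: "nat \<Rightarrow> nat \<Rightarrow> nat \<Rightarrow> (bool list \<Rightarrow> nat list \<Rightarrow> bool list) \<Rightarrow> com \<Rightarrow> nat poly \<Rightarrow> bool" where
  "implements R w d F c p \<longleftrightarrow> wf_com (Suc w) 5 c \<and>
    (\<forall>x e. env d x e \<longrightarrow> length (F x e) \<le> poly p (length x) \<and>
      (\<forall>\<tau> s. regs R x e \<tau> \<longrightarrow> \<tau> w = otape s \<longrightarrow>
        runs c \<tau> (poly p (length x)) (\<tau>(w := otape (s @ F x e)))))"

text \<open>\<open>lp d F\<close>: the string \<open>F x e\<close> is printed in polynomial time from the input \<open>x\<close> and the values
  \<open>e\<close> of \<open>d\<close> loop variables.\<close>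

definition lp :: "nat \<Rightarrow> (bool list \<Rightarrow> nat list \<Rightarrow> bool list) \<Rightarrow> bool" where
  "lp d F \<longleftrightarrow> (\<exists>R0\<ge>d. \<forall>R\<ge>R0. \<forall>w>Suc R. \<exists>c p. implements R w d F c p)"

lemma implements_cong:
  assumes "implements R w d F c p" "\<And>x e. env d x e \<Longrightarrow> F x e = G x e"
  shows "implements R w d G c p"
  using assms unfolding implements_def by simp

lemma lp_cong:
  assumes "lp d F" "\<And>x e. env d x e \<Longrightarrow> F x e = G x e"
  shows "lp d G"
proof -
  obtain R0 where R0: "R0 \<ge> d" "\<And>R w. R \<ge> R0 \<Longrightarrow> w > Suc R \<Longrightarrow> \<exists>c p. implements R w d F c p"
    using assms(1) by (auto simp: lp_def)
  have "\<exists>c p. implements R w d G c p" if "R \<ge> R0" "w > Suc R" for R w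
    using R0(2)[OF that] implements_cong[of R w d F _ _ G, OF _ assms(2)] by blast
  then show ?thesis using R0(1) by (auto simp: lp_def)
qed

lemma lp_const: "lp d (\<lambda>x e. bs)"
proof -
  have "implements R w d (\<lambda>x e. bs) (emits w bs) [:Suc (length bs):]" for R w
    using runs_emits by (auto simp: implements_def)
  then show ?thesis by (auto simp: lp_def intro!: exI[of _ d])
qed

text \<open>Both programs have to use the same layout of tapes. Since \<open>lp\<close> provides a
  program for every sufficiently large number of rulers, \<open>max R1 R2\<close> rulers serve
  both.\<close>

lemma lp_append:
  assumes "lp d F" "lp d G"
  shows "lp d (\<lambda>x e. F x e @ G x e)"
proof -
  obtain R1 where R1: "R1 \<ge> d" "\<And>R w. R \<ge> R1 \<Longrightarrow> w > Suc R \<Longrightarrow> \<exists>c p. implements R w d F c p"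
    using assms(1) by (auto simp: lp_def)
  obtain R2 where R2: "R2 \<ge> d" "\<And>R w. R \<ge> R2 \<Longrightarrow> w > Suc R \<Longrightarrow> \<exists>c p. implements R w d G c p"
    using assms(2) by (auto simp: lp_def)
  have "\<exists>c p. implements R w d (\<lambda>x e. F x e @ G x e) c p" if R: "R \<ge> max R1 R2" "w > Suc R" for R w
  proof -
    obtain c1 p1 where 1: "implements R w d F c1 p1"
      using R1(2)[of R w] R by auto
    obtain c2 p2 where 2: "implements R w d G c2 p2"
      using R2(2)[of R w] R by auto
    have "implements R w d (\<lambda>x e. F x e @ G x e) (Seq c1 c2) (p1 + p2)"
      unfolding implements_def
    proof (intro conjI allI impI)
      show "wf_com (Suc w) 5 (Seq c1 c2)" using 1 2 by (simp add: implements_def)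
      fix x e assume e: "env d x e"
      then show "length (F x e @ G x e) \<le> poly (p1 + p2) (length x)"
        using 1 2 by (auto simp: implements_def add_mono)
      fix \<tau> s assume r: "regs R x e \<tau>" and s: "\<tau> w = otape s"
      have a: "runs c1 \<tau> (poly p1 (length x)) (\<tau>(w := otape (s @ F x e)))"
        using 1 e r s by (simp add: implements_def)
      have b: "runs c2 (\<tau>(w := otape (s @ F x e))) (poly p2 (length x)) (\<tau>(w := otape (s @ F x e @ G x e)))"
        using 2[unfolded implements_def, THEN conjunct2, rule_format, OF e, THEN conjunct2, rule_format,
            of "\<tau>(w := otape (s @ F x e))" "s @ F x e"] r R by simp
      show "runs (Seq c1 c2) \<tau> (poly (p1 + p2) (length x)) (\<tau>(w := otape (s @ F x e @ G x e)))"
        using runs_Seq[OF a b] by simp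
    qed
    then show ?thesis by blast
  qed
  then show ?thesis using R1(1) unfolding lp_def by (intro exI[of _ "max R1 R2"]) auto
qed

text \<open>A test is defined by what it is good for: branching between printing tasks. Boolean
  closure then follows by rearranging conditionals, without looking at programs; a conjunction
  simply duplicates the else branch.\<close>

definition cond :: "nat \<Rightarrow> (bool list \<Rightarrow> nat list \<Rightarrow> bool) \<Rightarrow> bool" where
  "cond d B \<longleftrightarrow> (\<forall>F G. lp d F \<longrightarrow> lp d G \<longrightarrow> lp d (\<lambda>x e. if B x e then F x e else G x e))"

lemma lp_if: "cond d B \<Longrightarrow> lp d F \<Longrightarrow> lp d G \<Longrightarrow> lp d (\<lambda>x e. if B x e then F x e else G x e)"
  by (auto simp: cond_def)

lemma cond_cong:
  assumes "cond d B" "\<And>x e. env d x e \<Longrightarrow> B x e \<longleftrightarrow> B' x e"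
  shows "cond d B'"
  unfolding cond_def
proof (intro allI impI)
  fix F G assume "lp d F" "lp d G"
  then have "lp d (\<lambda>x e. if B x e then F x e else G x e)" using assms(1) by (simp add: cond_def)
  then show "lp d (\<lambda>x e. if B' x e then F x e else G x e)" by (rule lp_cong) (use assms(2) in auto)
qed

lemma cond_const [intro!]: "cond d (\<lambda>x e. b)"
  by (cases b) (auto simp: cond_def)

lemma cond_not [intro!]:
  assumes "cond d B" shows "cond d (\<lambda>x e. \<not> B x e)"
  unfolding cond_def
proof (intro allI impI)
  fix F G assume "lp d F" "lp d G"
  then have "lp d (\<lambda>x e. if B x e then G x e else F x e)" using assms by (simp add: cond_def)
  then show "lp d (\<lambda>x e. if \<not> B x e then F x e else G x e)" by (rule lp_cong) auto
qed

lemma cond_conj [intro!]: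
  assumes "cond d B1" "cond d B2" shows "cond d (\<lambda>x e. B1 x e \<and> B2 x e)"
  unfolding cond_def
proof (intro allI impI)
  fix F G assume "lp d F" "lp d G"
  then have "lp d (\<lambda>x e. if B1 x e then (if B2 x e then F x e else G x e) else G x e)"
    using assms by (auto simp: cond_def)
  then show "lp d (\<lambda>x e. if B1 x e \<and> B2 x e then F x e else G x e)" by (rule lp_cong) auto
qed

lemma cond_disj [intro!]:
  assumes "cond d B1" "cond d B2" shows "cond d (\<lambda>x e. B1 x e \<or> B2 x e)"
  by (rule cond_cong[OF cond_not[OF cond_conj[OF cond_not[OF assms(1)] cond_not[OF assms(2)]]]]) auto

lemma cond_imp [intro!]:
  assumes "cond d B1" "cond d B2" shows "cond d (\<lambda>x e. B1 x e \<longrightarrow> B2 x e)"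
  by (rule cond_cong[OF cond_disj[OF cond_not[OF assms(1)] assms(2)]]) auto

lemma cond_if [intro!]:
  assumes "cond d B1" "cond d B2" "cond d B3" shows "cond d (\<lambda>x e. if B1 x e then B2 x e else B3 x e)"
  by (rule cond_cong[OF cond_conj[OF cond_imp[OF assms(1,2)] cond_imp[OF cond_not[OF assms(1)] assms(3)]]]) auto

text \<open>Every test below moves some heads, branches on a scanned symbol and then undoes the
  moves in both branches.\<close>

lemma condI_test:
  assumes "\<And>R w c1 c2 p1 p2 F G. R \<ge> d \<Longrightarrow> w > Suc R \<Longrightarrow>
      implements R w d F c1 p1 \<Longrightarrow> implements R w d G c2 p2 \<Longrightarrow>
      wf_com (Suc w) 5 (tst R c1 c2) \<and>
      (\<forall>x e \<tau> B \<tau>'. env d x e \<longrightarrow> regs R x e \<tau> \<longrightarrow>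
        runs (if b x e then c1 else c2) \<tau> B \<tau>' \<longrightarrow> runs (tst R c1 c2) \<tau> (B + poly q (length x)) \<tau>')"
  shows "cond d b"
  unfolding cond_def
proof (intro allI impI)
  fix F G assume "lp d F" "lp d G"
  then obtain R1 R2 where R1: "R1 \<ge> d" "\<And>R w. R \<ge> R1 \<Longrightarrow> w > Suc R \<Longrightarrow> \<exists>c p. implements R w d F c p"
    and R2: "R2 \<ge> d" "\<And>R w. R \<ge> R2 \<Longrightarrow> w > Suc R \<Longrightarrow> \<exists>c p. implements R w d G c p"
    by (auto simp: lp_def)
  have "\<exists>c p. implements R w d (\<lambda>x e. if b x e then F x e else G x e) c p"
    if R: "R \<ge> max R1 R2" "w > Suc R" for R w
  proof -
    obtain c1 p1 where 1: "implements R w d F c1 p1"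
      using R1(2)[of R w] R by auto
    obtain c2 p2 where 2: "implements R w d G c2 p2"
      using R2(2)[of R w] R by auto
    have "R \<ge> d" using R R1 by simp
    note T = assms[OF this R(2) 1 2]
    have "implements R w d (\<lambda>x e. if b x e then F x e else G x e) (tst R c1 c2) (p1 + p2 + q)"
      unfolding implements_def
    proof (intro conjI allI impI)
      show "wf_com (Suc w) 5 (tst R c1 c2)" using T by simp
      fix x e assume e: "env d x e"
      then show "length (if b x e then F x e else G x e) \<le> poly (p1 + p2 + q) (length x)"
        using 1 2 by (auto simp: implements_def trans_le_add1 trans_le_add2)
      fix \<tau> s assume r: "regs R x e \<tau>" and s: "\<tau> w = otape s"
      have "runs (if b x e then c1 else c2) \<tau> (poly p1 (length x) + poly p2 (length x))
          (\<tau>(w := otape (s @ (if b x e then F x e else G x e))))"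
        using 1 2 e r s runs_mono[of c1 \<tau> "poly p1 (length x)" "\<tau>(w := otape (s @ F x e))"]
          runs_mono[of c2 \<tau> "poly p2 (length x)" "\<tau>(w := otape (s @ G x e))"]
        by (auto simp: implements_def)
      then show "runs (tst R c1 c2) \<tau> (poly (p1 + p2 + q) (length x))
          (\<tau>(w := otape (s @ (if b x e then F x e else G x e))))"
        using T e r by simp
    qed
    then show ?thesis by blast
  qed
  then show "lp d (\<lambda>x e. if b x e then F x e else G x e)"
    using R1(1) unfolding lp_def by (intro exI[of _ "max R1 R2"]) auto
qed

text \<open>With \<open>\<delta>\<close> the cell to the left of the variable is scanned. Meeting
  the mark of cell 0 there recognises the value 1, just as meeting it without
  \<open>\<delta>\<close> recognises 0; at value 0 the scanned cell is blank.\<close>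

lemma cond_ruler:
  assumes "r < d"
  shows "cond d (\<lambda>x e. P (ruler x (int (e ! r) - of_bool \<delta>)))"
proof -
  define ld rd where "ld = (if \<delta> then Left else Stay)" and "rd = (if \<delta> then Right else Stay)"
  define tst where "tst R c1 c2 = Seq (mv (Suc r) ld)
    (Cond (Suc r) P (Seq (mv (Suc r) rd) c1) (Seq (mv (Suc r) rd) c2))" for R :: nat and c1 c2
  show ?thesis
  proof (rule condI_test[where tst = tst and q = "[:5:]"], intro conjI allI impI)
    fix R w c1 c2 p1 p2 F G
    assume R: "R \<ge> d" "w > Suc R" and I: "implements R w d F c1 p1" "implements R w d G c2 p2"
    then show "wf_com (Suc w) 5 (tst R c1 c2)"
      using assms by (auto simp: tst_def implements_def)
    fix x e \<tau> B \<tau>'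
    assume e: "env d x e" and r: "regs R x e \<tau>"
      and b: "runs (if P (ruler x (int (e ! r) - of_bool \<delta>)) then c1 else c2) \<tau> B \<tau>'"
    have tr: "\<tau> (Suc r) = (ruler x, int (e ! r))" using r e R assms by (auto simp: regs_def env_def)
    let ?\<tau> = "\<tau>(Suc r := (ruler x, int (e ! r) - of_bool \<delta>))"
    have 1: "runs (mv (Suc r) ld) \<tau> 1 ?\<tau>" by (rule runs_mv) (auto simp: tr ld_def)
    have 2: "runs (mv (Suc r) rd) ?\<tau> 1 \<tau>" by (rule runs_mv) (auto simp: tr rd_def fun_eq_iff)
    have "runs (if P (scan (?\<tau> (Suc r))) then Seq (mv (Suc r) rd) c1 else Seq (mv (Suc r) rd) c2) ?\<tau> (1 + B) \<tau>'"
      using runs_Seq[OF 2] b by (auto simp: scan_def)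
    from runs_Seq[OF 1 runs_Cond[where P = P and i = "Suc r", OF this]]
    show "runs (tst R c1 c2) \<tau> (B + poly [:5:] (length x)) \<tau>'"
      unfolding tst_def by (rule runs_mono) simp
  qed
qed

text \<open>Two heads are moved left together until the first one reaches cell 0; the second one then
  scans the mark in cell 0 iff they started in the same cell.\<close>

lemma cond_digit_eq:
  assumes "r1 < d" "r2 < d" "r1 \<noteq> r2"
  shows "cond d (\<lambda>x e. e ! r1 + of_bool \<delta> = e ! r2)"
proof -
  define ld rd where "ld = (if \<delta> then Left else Stay)" and "rd = (if \<delta> then Right else Stay)"
  define fwd where "fwd R = Loop (Suc r1) (\<lambda>s. s \<noteq> 3)
    (Seq (mv (Suc r1) Left) (Seq (mv (Suc r2) Left) (mv (Suc R) Right)))" for R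
  define bwd where "bwd R = Seq (Loop (Suc R) (\<lambda>s. s \<noteq> 3)
    (Seq (mv (Suc r1) Right) (Seq (mv (Suc r2) Right) (mv (Suc R) Left)))) (mv (Suc r2) rd)" for R
  define tst where "tst R c1 c2 = Seq (mv (Suc r2) ld) (Seq (fwd R)
    (Cond (Suc r2) (\<lambda>s. s = 3) (Seq (bwd R) c1) (Seq (bwd R) c2)))" for R :: nat and c1 c2
  show ?thesis
  proof (rule condI_test[where tst = tst and q = "[:50, 20:]"], intro conjI allI impI)
    fix R w c1 c2 p1 p2 F G
    assume R: "R \<ge> d" "w > Suc R" and I: "implements R w d F c1 p1" "implements R w d G c2 p2"
    then show "wf_com (Suc w) 5 (tst R c1 c2)"
      using assms by (auto simp: tst_def fwd_def bwd_def implements_def)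
    fix x e \<tau> B \<tau>'
    assume e: "env d x e" and r: "regs R x e \<tau>"
      and b: "runs (if e ! r1 + of_bool \<delta> = e ! r2 then c1 else c2) \<tau> B \<tau>'"
    have t1: "\<tau> (Suc r1) = (ruler x, int (e ! r1))" and t2: "\<tau> (Suc r2) = (ruler x, int (e ! r2))"
      and t3: "\<tau> (Suc R) = (mark0, 0)"
      using r e R assms by (auto simp: regs_def env_def)
    have ne: "r1 \<noteq> R" "r2 \<noteq> R" using R assms by auto
    define n where "n = e ! r1"
    have n: "n < length x + 2" using e assms(1) by (auto simp: env_def n_def)
    \<comment> \<open>The scratch head is at cell \<open>j\<close> after \<open>j\<close> joint
      moves to the left. Walking it back to its mark undoes exactly these moves, in either
      branch.\<close>
    define \<phi> where "\<phi> j = \<tau>(Suc r1 := (ruler x, int n - int j),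
      Suc r2 := (ruler x, int (e ! r2) - of_bool \<delta> - int j), Suc R := (mark0, int j))" for j :: nat
    have \<phi>0: "\<phi> 0 = \<tau>(Suc r2 := (ruler x, int (e ! r2) - of_bool \<delta>))"
      using t1 t3 ne assms(3) by (auto simp: \<phi>_def n_def fun_eq_iff)
    have 1: "runs (mv (Suc r2) ld) \<tau> 1 (\<phi> 0)"
      unfolding \<phi>0 by (rule runs_mv) (auto simp: t2 ld_def)
    have 2: "runs (fwd R) (\<phi> 0) (Suc (n * Suc (1 + (1 + 1)))) (\<phi> n)"
      unfolding fwd_def
    proof (rule runs_Loop)
      fix j assume "j < n"
      then show "scan (\<phi> j (Suc r1)) \<noteq> 3" using ne assms(3) by (auto simp: \<phi>_def scan_def)
      show "runs (Seq (mv (Suc r1) Left) (Seq (mv (Suc r2) Left) (mv (Suc R) Right))) (\<phi> j) (1 + (1 + 1)) (\<phi> (Suc j))"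
        by (rule runs_Seq[OF runs_mv[OF refl] runs_Seq[OF runs_mv[OF refl] runs_mv]], rule ext)
          (use ne assms(3) in \<open>auto simp: \<phi>_def\<close>)
    qed (use ne assms(3) in \<open>auto simp: \<phi>_def scan_def\<close>)
    have 3: "runs (Loop (Suc R) (\<lambda>s. s \<noteq> 3) (Seq (mv (Suc r1) Right) (Seq (mv (Suc r2) Right) (mv (Suc R) Left))))
       (\<phi> (n - 0)) (Suc (n * Suc (1 + (1 + 1)))) (\<phi> (n - n))"
    proof (rule runs_Loop[where \<sigma> = "\<lambda>j. \<phi> (n - j)"])
      fix j assume j: "j < n"
      then show "scan (\<phi> (n - j) (Suc R)) \<noteq> 3" using ne by (auto simp: \<phi>_def scan_def mark0_def)
      show "runs (Seq (mv (Suc r1) Right) (Seq (mv (Suc r2) Right) (mv (Suc R) Left))) (\<phi> (n - j)) (1 + (1 + 1)) (\<phi> (n - Suc j))"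
        by (rule runs_Seq[OF runs_mv[OF refl] runs_Seq[OF runs_mv[OF refl] runs_mv]], rule ext)
          (use ne assms(3) j in \<open>auto simp: \<phi>_def of_nat_diff\<close>)
    qed (use ne in \<open>auto simp: \<phi>_def scan_def mark0_def\<close>)
    have 4: "runs (mv (Suc r2) rd) (\<phi> (n - n)) 1 \<tau>"
      by (rule runs_mv) (auto simp: \<phi>0 t2 rd_def fun_eq_iff)
    have 5: "runs (bwd R) (\<phi> n) (Suc (n * Suc (1 + (1 + 1))) + 1) \<tau>"
      using runs_Seq[OF 3 4] by (simp add: bwd_def)
    have t: "scan (\<phi> n (Suc r2)) = 3 \<longleftrightarrow> e ! r1 + of_bool \<delta> = e ! r2"
      using ne by (auto simp: \<phi>_def scan_def n_def)
    have "runs (if scan (\<phi> n (Suc r2)) = 3 then Seq (bwd R) c1 else Seq (bwd R) c2) (\<phi> n)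
        (Suc (n * Suc (1 + (1 + 1))) + 1 + B) \<tau>'"
      using runs_Seq[OF 5] b unfolding t by auto
    from runs_Seq[OF 1 runs_Seq[OF 2 runs_Cond[where P = "\<lambda>s. s = 3" and i = "Suc r2", OF this]]]
    show "runs (tst R c1 c2) \<tau> (B + poly [:50, 20:] (length x)) \<tau>'"
      unfolding tst_def by (rule runs_mono) (use n in simp)
  qed
qed

text \<open>The parked ruler on tape \<open>Suc d\<close> becomes the new variable. The nonblank
  cells of a ruler are exactly those from 0 to \<open>length x + 1\<close>, so the first blank ends
  the loop; the head is then rewound to the mark.\<close>

lemma lp_for:
  assumes "lp (Suc d) F"
  shows "lp d (\<lambda>x e. concat (map (\<lambda>i. F x (e @ [i])) [0..<length x + 2]))"
proof -
  obtain R0 where R0: "R0 \<ge> Suc d" "\<And>R w. R \<ge> R0 \<Longrightarrow> w > Suc R \<Longrightarrow> \<exists>c p. implements R w (Suc d) F c p"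
    using assms by (auto simp: lp_def)
  have "\<exists>c p. implements R w d (\<lambda>x e. concat (map (\<lambda>i. F x (e @ [i])) [0..<length x + 2])) c p"
    if R: "R \<ge> R0" "w > Suc R" for R w
  proof -
    obtain c p where I: "implements R w (Suc d) F c p"
      using R0(2)[OF R] by auto
    let ?C = "Seq (Loop (Suc d) (\<lambda>s. s \<noteq> 0) (Seq c (mv (Suc d) Right)))
      (Seq (mv (Suc d) Left) (rewind (Suc d) (\<lambda>s. s \<noteq> 3)))"
    have "implements R w d (\<lambda>x e. concat (map (\<lambda>i. F x (e @ [i])) [0..<length x + 2])) ?C ([:2, 1:] * (p + [:2:]) + [:10, 2:])"
      unfolding implements_def
    proof (intro conjI allI impI)
      show "wf_com (Suc w) 5 ?C" using I R R0 by (auto simp: implements_def)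
      fix x e assume e: "env d x e"
      let ?n = "length x + 2"
      let ?G = "\<lambda>j. concat (map (\<lambda>i. F x (e @ [i])) [0..<j])"
      have env': "env (Suc d) x (e @ [i])" if "i < ?n" for i using e that by (auto simp: env_def)
      then have "length (F x (e @ [i])) \<le> poly p (length x)" if "i < ?n" for i
        using I that by (auto simp: implements_def)
      then have "length (?G j) \<le> j * poly p (length x)" if "j \<le> ?n" for j
        using that by (induction j) (auto simp: add.commute add_mono)
      from this[of ?n] show "length (?G ?n) \<le> poly ([:2, 1:] * (p + [:2:]) + [:10, 2:]) (length x)"
        by (simp add: algebra_simps)
      fix \<tau> s assume r: "regs R x e \<tau>" and s: "\<tau> w = otape s"
      define \<sigma> where "\<sigma> j = \<tau>(Suc d := (ruler x, int j), w := otape (s @ ?G j))" for j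
      have wd: "w \<noteq> Suc d" "Suc d \<noteq> w" "d < R" using R R0 by auto
      have td: "\<tau> (Suc d) = (ruler x, 0)" using r wd e by (auto simp: regs_def env_def)
      have \<sigma>0: "\<sigma> 0 = \<tau>" using s td wd by (auto simp: \<sigma>_def fun_eq_iff)
      have 1: "runs (Loop (Suc d) (\<lambda>s. s \<noteq> 0) (Seq c (mv (Suc d) Right))) (\<sigma> 0) (Suc (?n * Suc (poly p (length x) + 1))) (\<sigma> ?n)"
      proof (rule runs_Loop)
        fix j assume j: "j < ?n"
        then show "scan (\<sigma> j (Suc d)) \<noteq> 0" using wd by (auto simp: \<sigma>_def scan_def ruler_eq_0)
        have rj: "regs R x (e @ [j]) (\<sigma> j)"
          using r e R wd by (auto simp: regs_def \<sigma>_def env_def nth_append less_Suc_eq)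
        have "runs c (\<sigma> j) (poly p (length x)) ((\<sigma> j)(w := otape ((s @ ?G j) @ F x (e @ [j]))))"
          using I[unfolded implements_def, THEN conjunct2, rule_format, OF env'[OF j], THEN conjunct2, rule_format, OF rj, of "s @ ?G j"]
          by (simp add: \<sigma>_def)
        moreover have "runs (mv (Suc d) Right) ((\<sigma> j)(w := otape ((s @ ?G j) @ F x (e @ [j])))) 1 (\<sigma> (Suc j))"
          by (rule runs_mv) (use wd in \<open>auto simp: \<sigma>_def fun_eq_iff add.commute\<close>)
        ultimately show "runs (Seq c (mv (Suc d) Right)) (\<sigma> j) (poly p (length x) + 1) (\<sigma> (Suc j))"
          by (rule runs_Seq)
      qed (use wd in \<open>auto simp: \<sigma>_def scan_def ruler_eq_0\<close>)
      have 2: "runs (mv (Suc d) Left) (\<sigma> ?n) 1 ((\<sigma> ?n)(Suc d := (ruler x, 0 + int (length x + 1))))"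
        by (rule runs_mv) (use wd in \<open>auto simp: \<sigma>_def\<close>)
      have 3: "runs (rewind (Suc d) (\<lambda>s. s \<noteq> 3)) ((\<sigma> ?n)(Suc d := (ruler x, 0 + int (length x + 1)))) (2 * (length x + 1) + 1)
        (((\<sigma> ?n)(Suc d := (ruler x, 0 + int (length x + 1))))(Suc d := (ruler x, 0)))"
        by (rule runs_rewind) auto
      have "((\<sigma> ?n)(Suc d := (ruler x, 0 + int (length x + 1))))(Suc d := (ruler x, 0)) = \<tau>(w := otape (s @ ?G ?n))"
        using td wd by (auto simp: \<sigma>_def fun_eq_iff)
      with runs_Seq[OF 1 runs_Seq[OF 2 3]] have "runs ?C \<tau> (Suc (?n * Suc (poly p (length x) + 1)) + (1 + (2 * (length x + 1) + 1)))
          (\<tau>(w := otape (s @ ?G ?n)))"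
        by (simp add: \<sigma>0)
      then show "runs ?C \<tau> (poly ([:2, 1:] * (p + [:2:]) + [:10, 2:]) (length x)) (\<tau>(w := otape (s @ ?G ?n)))"
        by (rule runs_mono) (simp add: algebra_simps)
    qed
    then show ?thesis by blast
  qed
  then show ?thesis using R0(1) unfolding lp_def by (intro exI[of _ R0]) auto
qed

subsection \<open>Printing a count in binary\<close>

definition copy_ruler :: "nat \<Rightarrow> com" where
  "copy_ruler i = Seq (Do i (\<lambda>_. (3, Right)))
    (Seq (Loop 0 (\<lambda>s. s \<noteq> 0)
      (Seq (Cond 0 (\<lambda>s. s = 2) (Do i (\<lambda>_. (2, Right))) (Do i (\<lambda>_. (1, Right)))) (mv 0 Right)))
    (Seq (Do i (\<lambda>_. (4, Stay))) (Seq (rewind i (\<lambda>s. s \<noteq> 3))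
    (Seq (mv 0 Left) (Seq (rewind 0 (\<lambda>s. s \<noteq> 0)) (mv 0 Right))))))"

lemma runs_copy_ruler:
  assumes "\<tau> 0 = input_tape x" "\<tau> i = blank_tape" "i \<noteq> 0"
  shows "runs (copy_ruler i) \<tau> (10 * length x + 20) (\<tau>(i := (ruler x, 0)))"
proof -
  define g where "g j z = (if z = 0 then 3 else if 1 \<le> z \<and> z \<le> int j then strf x (z - 1) else 0)" for j :: nat and z
  let ?n = "length x"
  define \<sigma> where "\<sigma> j = \<tau>(i := (g j, int j + 1), 0 := (strf x, int j))" for j
  have 1: "runs (Do i (\<lambda>_. (3, Right))) \<tau> 1 (\<sigma> 0)"
  proof (rule runs_Do, rule ext)
    have "(\<lambda>a. if a = 0 then 3 else 0) = g 0" by (auto simp: g_def)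
    then show "\<sigma> 0 a = (\<tau>(i := act (3, Right) (\<tau> i))) a" for a
      using assms by (auto simp: \<sigma>_def blank_tape_def input_tape_eq fun_upd_def)
  qed
  have gS: "(g j)(int j + 1 := strf x (int j)) = g (Suc j)" for j
    by (auto simp: g_def fun_eq_iff)
  have 2: "runs (Loop 0 (\<lambda>s. s \<noteq> 0)
      (Seq (Cond 0 (\<lambda>s. s = 2) (Do i (\<lambda>_. (2, Right))) (Do i (\<lambda>_. (1, Right)))) (mv 0 Right)))
      (\<sigma> 0) (Suc (?n * Suc (Suc 1 + 1))) (\<sigma> ?n)"
  proof (rule runs_Loop)
    fix j assume j: "j < ?n"
    then show "scan (\<sigma> j 0) \<noteq> 0" by (auto simp: \<sigma>_def scan_def strf_eq_0)
    have sc: "scan (\<sigma> j 0) = sym_of_bit (x ! j)" using j by (simp add: \<sigma>_def scan_def strf_nth)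
    let ?m = "(\<sigma> j)(i := (g (Suc j), int j + 2))"
    have d: "runs (Do i (\<lambda>_. (sym_of_bit (x ! j), Right))) (\<sigma> j) 1 ?m"
      by (rule runs_Do) (use assms(3) j in \<open>auto simp: \<sigma>_def gS[symmetric] strf_nth\<close>)
    have "runs (if scan (\<sigma> j 0) = 2 then Do i (\<lambda>_. (2, Right)) else Do i (\<lambda>_. (1, Right))) (\<sigma> j) 1 ?m"
      using d unfolding sc by (auto simp: sym_of_bit_def split: if_splits)
    note c = runs_Cond[where P = "\<lambda>s. s = 2" and i = 0, OF this]
    have "runs (mv 0 Right) ?m 1 (\<sigma> (Suc j))"
      by (rule runs_mv, rule ext) (use assms(3) in \<open>auto simp: \<sigma>_def\<close>)
    from runs_Seq[OF c this] show "runs (Seq (Cond 0 (\<lambda>s. s = 2) (Do i (\<lambda>_. (2, Right))) (Do i (\<lambda>_. (1, Right)))) (mv 0 Right))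
      (\<sigma> j) (Suc 1 + 1) (\<sigma> (Suc j))" .
  qed (auto simp: \<sigma>_def scan_def strf_eq_0)
  have gr: "(g ?n)(int ?n + 1 := 4) = ruler x"
    by (auto simp: g_def fun_eq_iff ruler_def strf_def input_tape_def)
  let ?a = "(\<sigma> ?n)(i := (ruler x, 0 + int (?n + 1)))"
  have 3: "runs (Do i (\<lambda>_. (4, Stay))) (\<sigma> ?n) 1 ?a"
    by (rule runs_Do) (use assms(3) in \<open>auto simp: \<sigma>_def gr[symmetric]\<close>)
  have 4: "runs (rewind i (\<lambda>s. s \<noteq> 3)) ?a (2 * (?n + 1) + 1) (?a(i := (ruler x, 0)))"
    by (rule runs_rewind) auto
  let ?b = "?a(i := (ruler x, 0))"
  have 5: "runs (mv 0 Left) ?b 1 (?b(0 := (strf x, -1 + int ?n)))"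
    by (rule runs_mv) (use assms(3) in \<open>auto simp: \<sigma>_def\<close>)
  let ?c = "?b(0 := (strf x, -1 + int ?n))"
  have 6: "runs (rewind 0 (\<lambda>s. s \<noteq> 0)) ?c (2 * ?n + 1) (?c(0 := (strf x, -1)))"
    by (rule runs_rewind) (auto simp: strf_eq_0)
  have 7: "runs (mv 0 Right) (?c(0 := (strf x, -1))) 1 (\<tau>(i := (ruler x, 0)))"
    by (rule runs_mv, rule ext) (use assms in \<open>auto simp: \<sigma>_def input_tape_eq\<close>)
  show ?thesis unfolding copy_ruler_def
    by (rule runs_mono[OF runs_Seq[OF 1 runs_Seq[OF 2 runs_Seq[OF 3 runs_Seq[OF 4 runs_Seq[OF 5 runs_Seq[OF 6 7]]]]]]]) simp
qed

primrec copy_rulers :: "nat \<Rightarrow> com" where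
  "copy_rulers 0 = mv 0 Stay"
| "copy_rulers (Suc R) = Seq (copy_rulers R) (copy_ruler (Suc R))"

lemma wf_copy_rulers: "R < k \<Longrightarrow> wf_com k 5 (copy_rulers R)"
  by (induction R) (auto simp: copy_ruler_def)

lemma runs_copy_rulers:
  "runs (copy_rulers R) (init_tapes x) (R * (10 * length x + 20) + 1)
    (\<lambda>i. if 1 \<le> i \<and> i \<le> R then (ruler x, 0) else init_tapes x i)"
proof (induction R)
  case 0
  have "runs (mv 0 Stay) (init_tapes x) 1 (\<lambda>i. if 1 \<le> i \<and> i \<le> 0 then (ruler x, 0) else init_tapes x i)"
    by (rule runs_mv, rule ext) auto
  then show ?case by simp
next
  case (Suc R)
  let ?\<tau> = "\<lambda>R i. if 1 \<le> i \<and> i \<le> R then (ruler x, 0) else init_tapes x i"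
  have "runs (copy_ruler (Suc R)) (?\<tau> R) (10 * length x + 20) ((?\<tau> R)(Suc R := (ruler x, 0)))"
    by (rule runs_copy_ruler) (auto simp: init_tapes_def)
  moreover have "(?\<tau> R)(Suc R := (ruler x, 0)) = ?\<tau> (Suc R)" by (auto simp: fun_eq_iff)
  ultimately have "runs (copy_ruler (Suc R)) (?\<tau> R) (10 * length x + 20) (?\<tau> (Suc R))" by simp
  from runs_Seq[OF Suc this] show ?case by (simp add: algebra_simps)
qed

section \<open>A binary counter\<close>

fun incr :: "bool list \<Rightarrow> bool list" where
  "incr [] = [True]"
| "incr (False # r) = True # r"
| "incr (True # r) = False # incr r"

lemma bits_Suc: "bits (Suc m) = incr (bits m)"
proof (induction m rule: less_induct)
  case (less m)
  show ?case
  proof (cases "even m")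
    case True
    then show ?thesis by (cases "m = 0") (simp_all add: bits.simps[of "Suc m"] bits.simps[of m] bits.simps[of 0] bits.simps[of "Suc 0"])
  next
    case False
    then have "m div 2 < m" "Suc m div 2 = Suc (m div 2)" by (auto elim: oddE)
    with less[of "m div 2"] False show ?thesis
      by (simp add: bits.simps[of "Suc m"] bits.simps[of m]) (cases "m = 0", auto)
  qed
qed

text \<open>Linear instead of logarithmic, but enough for a polynomial time bound on
  counting.\<close>

lemma length_bits: "length (bits m) \<le> m"
proof (induction m)
  case 0
  then show ?case by (simp add: bits.simps)
next
  case (Suc m)
  have "length (incr s) \<le> Suc (length s)" for s by (induction s rule: incr.induct) auto
  with Suc show ?case by (metis Suc_le_mono bits_Suc le_trans)
qed

text \<open>The carry passes through the initial run of ones and stops at the first zero or at the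
  blank after the number. One write handles both stops, hence \<open>tl r\<close> with
  \<open>r\<close> possibly empty.\<close>

lemma incr_decomp:
  obtains j r where "s = replicate j True @ r" "r = [] \<or> (\<exists>r'. r = False # r')"
    "incr s = replicate j False @ True # tl r"
proof -
  have "\<exists>j r. s = replicate j True @ r \<and> (r = [] \<or> (\<exists>r'. r = False # r')) \<and>
    incr s = replicate j False @ True # tl r"
  proof (induction s rule: incr.induct)
    case 1
    show ?case by (intro exI[of _ 0] exI[of _ "[]"]) auto
  next
    case (2 r)
    show ?case by (intro exI[of _ 0] exI[of _ "False # r"]) auto
  next
    case (3 r)
    then obtain j r' where "r = replicate j True @ r'" "r' = [] \<or> (\<exists>r''. r' = False # r'')"
      "incr r = replicate j False @ True # tl r'" by blast
    then show ?case by (intro exI[of _ "Suc j"] exI[of _ r']) auto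
  qed
  then show ?thesis using that by blast
qed

definition increment :: "nat \<Rightarrow> com" where
  "increment i = Seq (Loop i (\<lambda>s. s = 2) (Do i (\<lambda>_. (1, Right))))
    (Seq (Do i (\<lambda>_. (2, Left))) (Seq (rewind i (\<lambda>s. s \<noteq> 0)) (mv i Right)))"

lemma runs_increment:
  assumes "\<tau> i = input_tape (bits m)"
  shows "runs (increment i) \<tau> (4 * m + 4) (\<tau>(i := input_tape (bits (Suc m))))"
proof -
  obtain j r where jr: "bits m = replicate j True @ r" "r = [] \<or> (\<exists>r'. r = False # r')"
    "incr (bits m) = replicate j False @ True # tl r"
    using incr_decomp by blast
  have jm: "j \<le> m" using length_bits[of m] jr(1) by simp
  define \<sigma> where "\<sigma> k = \<tau>(i := (strf (replicate k False @ replicate (j - k) True @ r), int k))" for k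
  have \<sigma>0: "\<sigma> 0 = \<tau>" using assms jr by (auto simp: \<sigma>_def input_tape_eq)
  have 1: "runs (Loop i (\<lambda>s. s = 2) (Do i (\<lambda>_. (1, Right)))) (\<sigma> 0) (Suc (j * Suc 1)) (\<sigma> j)"
  proof (rule runs_Loop)
    fix k assume k: "k < j"
    then have s: "replicate (j - k) True = True # replicate (j - Suc k) True"
      by (metis Suc_diff_Suc replicate_Suc)
    have eq: "replicate k False @ replicate (j - k) True @ r = replicate k False @ True # (replicate (j - Suc k) True @ r)"
      by (simp add: s)
    have "strf (replicate k False @ True # (replicate (j - Suc k) True @ r)) (int k) = 2"
      using strf_nth[of k "replicate k False @ True # (replicate (j - Suc k) True @ r)"]
      by (simp add: sym_of_bit_def nth_append)
    then show "scan (\<sigma> k i) = 2" unfolding \<sigma>_def eq by (simp add: scan_def)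
    have u: "(strf (replicate k False @ True # (replicate (j - Suc k) True @ r)))(int k := 1)
        = strf (replicate (Suc k) False @ replicate (j - Suc k) True @ r)"
      using strf_upd[of "replicate k False" True _ False]
      by (simp add: sym_of_bit_def replicate_append_same[symmetric])
    show "runs (Do i (\<lambda>_. (1, Right))) (\<sigma> k) 1 (\<sigma> (Suc k))"
      by (rule runs_Do) (unfold \<sigma>_def eq, simp add: u[simplified] add.commute)
  next
    have "strf (replicate j False @ r) (int j) \<noteq> 2"
      using jr(2)
    proof
      assume "r = []"
      then have "strf (replicate j False @ r) (int j) = 0" by (simp add: strf_eq_0)
      then show ?thesis by simp
    next
      assume "\<exists>r'. r = False # r'"
      then show ?thesis using strf_nth[of j "replicate j False @ r"] by (auto simp: nth_append)
    qed
    then show "scan (\<sigma> j i) \<noteq> 2" by (simp add: \<sigma>_def scan_def)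
  qed
  let ?s = "replicate j False @ True # tl r"
  have u: "(strf (replicate j False @ r))(int j := 2) = strf ?s"
    using jr(2) strf_upd[of "replicate j False" False _ True] strf_snoc[of "replicate j False" True]
    by (auto simp: sym_of_bit_def)
  let ?a = "\<tau>(i := (strf ?s, -1 + int j))"
  have 2: "runs (Do i (\<lambda>_. (2, Left))) (\<sigma> j) 1 ?a"
    by (rule runs_Do) (simp add: \<sigma>_def u)
  have 3: "runs (rewind i (\<lambda>s. s \<noteq> 0)) ?a (2 * j + 1) (?a(i := (strf ?s, -1)))"
    by (rule runs_rewind) (auto simp: strf_eq_0)
  have 4: "runs (mv i Right) (?a(i := (strf ?s, -1))) 1 (\<tau>(i := input_tape (bits (Suc m))))"
    by (rule runs_mv) (simp add: input_tape_eq bits_Suc jr(3))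
  show ?thesis
    using runs_mono[OF runs_Seq[OF 1 runs_Seq[OF 2 runs_Seq[OF 3 4]]], of "4 * m + 4"] jm
    by (simp add: \<sigma>0 increment_def)
qed

definition count :: "nat \<Rightarrow> nat \<Rightarrow> com" where
  "count i j = Seq (mv i Left) (Loop i (\<lambda>s. s \<noteq> 0) (Seq (increment j) (mv i Left)))"

lemma runs_count:
  assumes "\<tau> i = otape s" "\<tau> j = input_tape (bits 0)" "i \<noteq> j"
  shows "runs (count i j) \<tau> (4 * length s ^ 2 + 6 * length s + 2)
    (\<tau>(i := (strf s, -1), j := input_tape (bits (length s))))"
proof -
  let ?n = "length s"
  define \<sigma> where "\<sigma> k = \<tau>(i := (strf s, int ?n - 1 - int k), j := input_tape (bits k))" for k
  have 1: "runs (mv i Left) \<tau> 1 (\<sigma> 0)"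
    by (rule runs_mv, rule ext) (use assms in \<open>auto simp: \<sigma>_def otape_def\<close>)
  have 2: "runs (Loop i (\<lambda>s. s \<noteq> 0) (Seq (increment j) (mv i Left))) (\<sigma> 0) (Suc (?n * Suc (4 * ?n + 4 + 1))) (\<sigma> ?n)"
  proof (rule runs_Loop)
    fix k assume k: "k < ?n"
    then show "scan (\<sigma> k i) \<noteq> 0" using assms(3) by (auto simp: \<sigma>_def scan_def strf_eq_0)
    have a: "runs (increment j) (\<sigma> k) (4 * ?n + 4) ((\<sigma> k)(j := input_tape (bits (Suc k))))"
      by (rule runs_mono[OF runs_increment[where m = k]]) (use k in \<open>auto simp: \<sigma>_def\<close>)
    have b: "runs (mv i Left) ((\<sigma> k)(j := input_tape (bits (Suc k)))) 1 (\<sigma> (Suc k))"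
      by (rule runs_mv, rule ext) (use assms(3) in \<open>auto simp: \<sigma>_def\<close>)
    show "runs (Seq (increment j) (mv i Left)) (\<sigma> k) (4 * ?n + 4 + 1) (\<sigma> (Suc k))"
      using runs_Seq[OF a b] .
  qed (use assms(3) in \<open>auto simp: \<sigma>_def scan_def strf_eq_0\<close>)
  have "\<sigma> ?n = \<tau>(i := (strf s, -1), j := input_tape (bits ?n))" by (simp add: \<sigma>_def)
  then show ?thesis
    using runs_mono[OF runs_Seq[OF 1 2], of "4 * ?n ^ 2 + 6 * ?n + 2"]
    by (simp add: count_def power2_eq_square algebra_simps)
qed

text \<open>The function \<open>g\<close> recodes each bit while copying. The same counter is
  printed twice, once inside the encoding of the graph, where one bit becomes four, and once plainly
  in the threshold.\<close>

definition print_tape :: "nat \<Rightarrow> nat \<Rightarrow> (bool \<Rightarrow> bool list) \<Rightarrow> com" where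
  "print_tape i w g = Seq (Loop i (\<lambda>s. s \<noteq> 0)
      (Seq (Cond i (\<lambda>s. s = 2) (emits w (g True)) (emits w (g False))) (mv i Right)))
    (Seq (mv i Left) (Seq (rewind i (\<lambda>s. s \<noteq> 0)) (mv i Right)))"

lemma runs_print_tape:
  assumes "\<tau> i = input_tape s" "\<tau> w = otape u" "i \<noteq> w" "\<And>b. length (g b) \<le> 4"
  shows "runs (print_tape i w g) \<tau> (10 * length s + 4) (\<tau>(w := otape (u @ concat (map g s))))"
proof -
  let ?n = "length s"
  define \<sigma> where "\<sigma> k = \<tau>(i := (strf s, int k), w := otape (u @ concat (map g (take k s))))" for k
  have \<sigma>0: "\<sigma> 0 = \<tau>" using assms by (auto simp: \<sigma>_def input_tape_eq fun_eq_iff)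
  have 1: "runs (Loop i (\<lambda>s. s \<noteq> 0) (Seq (Cond i (\<lambda>s. s = 2) (emits w (g True)) (emits w (g False))) (mv i Right)))
    (\<sigma> 0) (Suc (?n * Suc (Suc 5 + 1))) (\<sigma> ?n)"
  proof (rule runs_Loop)
    fix k assume k: "k < ?n"
    then show "scan (\<sigma> k i) \<noteq> 0" using assms(3) by (auto simp: \<sigma>_def scan_def strf_eq_0)
    have sc: "scan (\<sigma> k i) = sym_of_bit (s ! k)" using k assms(3) by (simp add: \<sigma>_def scan_def strf_nth)
    let ?m = "(\<sigma> k)(w := otape ((u @ concat (map g (take k s))) @ g (s ! k)))"
    have "runs (emits w (g (s ! k))) (\<sigma> k) (Suc (length (g (s ! k)))) ?m"
      by (rule runs_emits) (auto simp: \<sigma>_def)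
    then have "runs (emits w (g (s ! k))) (\<sigma> k) 5 ?m"
      by (rule runs_mono) (use assms(4) in simp)
    then have "runs (if scan (\<sigma> k i) = 2 then emits w (g True) else emits w (g False)) (\<sigma> k) 5 ?m"
      unfolding sc by (cases "s ! k") simp_all
    note c = runs_Cond[where P = "\<lambda>s. s = 2" and i = i, OF this]
    have "runs (mv i Right) ?m 1 (\<sigma> (Suc k))"
      by (rule runs_mv, rule ext) (use assms(3) k in \<open>auto simp: \<sigma>_def take_Suc_conv_app_nth\<close>)
    from runs_Seq[OF c this]
    show "runs (Seq (Cond i (\<lambda>s. s = 2) (emits w (g True)) (emits w (g False))) (mv i Right)) (\<sigma> k) (Suc 5 + 1) (\<sigma> (Suc k))" .
  qed (use assms(3) in \<open>auto simp: \<sigma>_def scan_def strf_eq_0\<close>)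
  let ?b = "(\<sigma> ?n)(i := (strf s, -1 + int ?n))"
  have 2: "runs (mv i Left) (\<sigma> ?n) 1 ?b"
    by (rule runs_mv) (use assms(3) in \<open>auto simp: \<sigma>_def\<close>)
  have 3: "runs (rewind i (\<lambda>s. s \<noteq> 0)) ?b (2 * ?n + 1) (?b(i := (strf s, -1)))"
    by (rule runs_rewind) (auto simp: strf_eq_0)
  have 4: "runs (mv i Right) (?b(i := (strf s, -1))) 1 (\<tau>(w := otape (u @ concat (map g s))))"
    by (rule runs_mv, rule ext) (use assms in \<open>auto simp: \<sigma>_def input_tape_eq\<close>)
  show ?thesis
    using runs_mono[OF runs_Seq[OF 1 runs_Seq[OF 2 runs_Seq[OF 3 4]]], of "10 * ?n + 4"]
    by (simp add: \<sigma>0 print_tape_def)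
qed

text \<open>The number to be counted is first printed in unary by \<open>C\<close> on a scratch
  tape. The shape of the result is that of the final instance: \<open>Suc m\<close> for
  \<open>m\<close> items forms the top bits both of the heavy weight and of the threshold, which is
  the same number.\<close>

theorem polytime_lp_count:
  assumes A: "lp 0 A" and B: "lp 0 B" and C: "lp 0 C" and g: "\<And>b. length (g b) \<le> 4"
  shows "polytime_computable (\<lambda>x. A x [] @ concat (map g (bits (length (C x [])))) @
    B x [] @ bits (length (C x [])))"
proof -
  have "\<exists>R. \<forall>w>Suc R. (\<exists>c p. implements R w 0 A c p) \<and> (\<exists>c p. implements R w 0 B c p) \<and> (\<exists>c p. implements R w 0 C c p)"
  proof -
    obtain Ra Rb Rc where "\<forall>R\<ge>Ra. \<forall>w>Suc R. \<exists>c p. implements R w 0 A c p"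
      "\<forall>R\<ge>Rb. \<forall>w>Suc R. \<exists>c p. implements R w 0 B c p"
      "\<forall>R\<ge>Rc. \<forall>w>Suc R. \<exists>c p. implements R w 0 C c p"
      using A B C unfolding lp_def by metis
    then show ?thesis by (intro exI[of _ "Ra + Rb + Rc"]) simp
  qed
  then obtain R where R: "\<And>w. w > Suc R \<Longrightarrow> \<exists>c p. implements R w 0 A c p" "\<And>w. w > Suc R \<Longrightarrow> \<exists>c p. implements R w 0 B c p"
    "\<And>w. w > Suc R \<Longrightarrow> \<exists>c p. implements R w 0 C c p" by blast
  define scr ctr out where "scr = R + 2" and "ctr = R + 3" and "out = R + 4"
  obtain ca pa where ca: "implements R out 0 A ca pa" using R(1)[of out] by (auto simp: out_def)
  obtain cb pb where cb: "implements R out 0 B cb pb" using R(2)[of out] by (auto simp: out_def)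
  obtain cc pc where cc: "implements R scr 0 C cc pc" using R(3)[of scr] by (auto simp: scr_def)
  define prog where "prog = Seq (copy_rulers R) (Seq (Do (Suc R) (\<lambda>_. (3, Stay))) (Seq cc (Seq (count scr ctr)
    (Seq ca (Seq (print_tape ctr out g) (Seq cb (print_tape ctr out (\<lambda>b. [b]))))))))"
  define p where "p = [:R:] * [:20, 10:] + 2 + pc + (4 * pc ^ 2 + 6 * pc + 2) + pa + (10 * pc + 4) + pb + (10 * pc + 4)"
  have wf: "wf_com (Suc out) 5 prog"
    using ca cb wf_com_mono[of "Suc scr" 5 cc "Suc out"] cc wf_copy_rulers[of R "Suc out"]
    by (auto simp: prog_def implements_def count_def increment_def print_tape_def out_def scr_def ctr_def)
  show ?thesis
  proof (rule polytime_computable_exec[OF wf, where p = p])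
    fix x :: "bool list"
    let ?n = "length x"
    let ?A = "A x []" and ?B = "B x []" and ?C = "C x []"
    let ?m = "bits (length ?C)"
    have e: "env 0 x []" by (simp add: env_def)
    have lC: "length ?C \<le> poly pc ?n" using cc e by (simp add: implements_def)
    have lm: "length ?m \<le> poly pc ?n" using lC length_bits[of "length ?C"] by simp
    define t1 where "t1 = (\<lambda>i. if 1 \<le> i \<and> i \<le> R then (ruler x, 0) else init_tapes x i)"
    define t2 where "t2 = t1(Suc R := (mark0, 0))"
    have 1: "runs (copy_rulers R) (init_tapes x) (R * (10 * ?n + 20) + 1) t1"
      unfolding t1_def by (rule runs_copy_rulers)
    have 2: "runs (Do (Suc R) (\<lambda>_. (3, Stay))) t1 1 t2"
      by (rule runs_Do) (auto simp: t1_def t2_def init_tapes_def blank_tape_def mark0_def fun_eq_iff)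
    have r2: "regs R x [] t2" by (auto simp: regs_def t1_def t2_def)
    have s2: "t2 scr = otape []" "t2 ctr = input_tape (bits 0)" "t2 out = otape []"
      by (auto simp: t2_def t1_def scr_def ctr_def out_def init_tapes_def blank_otape bits.simps[of 0] otape_def input_tape_eq)
    define t3 where "t3 = t2(scr := otape ([] @ ?C))"
    have 3: "runs cc t2 (poly pc ?n) t3"
      using cc e r2 s2(1) unfolding implements_def t3_def by blast
    define t4 where "t4 = t3(scr := (strf ?C, -1), ctr := input_tape ?m)"
    have 4: "runs (count scr ctr) t3 (4 * poly pc ?n ^ 2 + 6 * poly pc ?n + 2) t4"
      unfolding t4_def
      by (rule runs_mono[OF runs_count]) (use s2 lC in \<open>auto simp: t3_def scr_def ctr_def intro!: add_mono power_mono\<close>)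
    have r4: "regs R x [] t4" using r2 by (auto simp: t4_def t3_def scr_def ctr_def)
    have s4: "t4 ctr = input_tape ?m" "t4 out = otape []"
      using s2 by (auto simp: t4_def t3_def scr_def ctr_def out_def)
    define t5 where "t5 = t4(out := otape ([] @ ?A))"
    have 5: "runs ca t4 (poly pa ?n) t5"
      using ca e r4 s4(2) unfolding implements_def t5_def by blast
    define t6 where "t6 = t5(out := otape (?A @ concat (map g ?m)))"
    have s5: "t5 ctr = input_tape ?m" "t5 out = otape ?A" using s4 by (auto simp: t5_def ctr_def out_def)
    have 6: "runs (print_tape ctr out g) t5 (10 * poly pc ?n + 4) t6"
      unfolding t6_def
      by (rule runs_mono[OF runs_print_tape[OF s5 _ g]]) (use lm in \<open>auto simp: ctr_def out_def\<close>)
    have r6: "regs R x [] t6" using r4 by (auto simp: t6_def t5_def out_def)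
    have s6: "t6 ctr = input_tape ?m" "t6 out = otape (?A @ concat (map g ?m))"
      using s5 by (auto simp: t6_def ctr_def out_def)
    define t7 where "t7 = t6(out := otape ((?A @ concat (map g ?m)) @ ?B))"
    have 7: "runs cb t6 (poly pb ?n) t7"
      using cb e r6 s6(2) unfolding implements_def t7_def by blast
    have s7: "t7 ctr = input_tape ?m" "t7 out = otape ((?A @ concat (map g ?m)) @ ?B)"
      using s6 by (auto simp: t7_def ctr_def out_def)
    define t8 where "t8 = t7(out := otape (((?A @ concat (map g ?m)) @ ?B) @ concat (map (\<lambda>b. [b]) ?m)))"
    have 8: "runs (print_tape ctr out (\<lambda>b. [b])) t7 (10 * poly pc ?n + 4) t8"
      unfolding t8_def
      by (rule runs_mono[OF runs_print_tape[OF s7]]) (use lm in \<open>auto simp: ctr_def out_def\<close>)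
    have "runs prog (init_tapes x) (poly p ?n) t8"
      unfolding prog_def
      by (rule runs_mono[OF runs_Seq[OF 1 runs_Seq[OF 2 runs_Seq[OF 3 runs_Seq[OF 4 runs_Seq[OF 5 runs_Seq[OF 6 runs_Seq[OF 7 8]]]]]]]])
        (simp add: p_def algebra_simps)
    moreover have "t8 out = (fst (input_tape (?A @ concat (map g ?m) @ ?B @ ?m)), int (length (?A @ concat (map g ?m) @ ?B @ ?m)))"
      by (simp add: t8_def otape_def strf_def)
    ultimately show "\<exists>t \<tau>. t \<le> poly p ?n \<and> exec prog (init_tapes x) t \<tau> \<and>
        (\<exists>pos. \<tau> out = (fst (input_tape (?A @ concat (map g ?m) @ ?B @ ?m)), pos))"
      unfolding runs_def by blast
  qed simp
qed

subsection \<open>Loops over numbers of several digits\<close>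

definition base :: "bool list \<Rightarrow> nat" where
  "base x = length x + 2"

lemma base_gt_1 [simp]: "base x > 1" "base x > 0" "base x > Suc 0" "base x \<noteq> 0"
  by (auto simp: base_def)

primrec digits :: "nat \<Rightarrow> nat \<Rightarrow> nat \<Rightarrow> nat list" where
  "digits b 0 a = []"
| "digits b (Suc d) a = digits b d (a div b) @ [a mod b]"

definition undigits :: "nat \<Rightarrow> nat list \<Rightarrow> nat" where
  "undigits b ds = foldl (\<lambda>a v. a * b + v) 0 ds"

lemma undigits_Nil [simp]: "undigits b [] = 0"
  by (simp add: undigits_def)

lemma undigits_snoc [simp]: "undigits b (ds @ [v]) = undigits b ds * b + v"
  by (simp add: undigits_def)

lemma length_digits [simp]: "length (digits b d a) = d"
  by (induction d arbitrary: a) auto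

lemma undigits_digits: "a < b ^ d \<Longrightarrow> undigits b (digits b d a) = a"
proof (induction d arbitrary: a)
  case (Suc d)
  have "a div b < b ^ d" using Suc.prems by (simp add: less_mult_imp_div_less mult.commute)
  with Suc.IH show ?case by simp
qed simp

lemma concat_map_blocks:
  assumes "b > 0"
  shows "concat (map (\<lambda>a. concat (map (\<lambda>v. G a v) [0..<b])) [0..<n]) =
    concat (map (\<lambda>a. G (a div b) (a mod b)) [0..<n * b])"
proof (induction n)
  case (Suc n)
  have "[0..<Suc n * b] = [0..<n * b] @ map (\<lambda>v. n * b + v) [0..<b]"
    using upt_add_eq_append[of 0 "n * b" b] map_add_upt[of "n * b" b] by (simp add: add.commute)
  moreover have "map (\<lambda>v. G ((n * b + v) div b) ((n * b + v) mod b)) [0..<b] = map (G n) [0..<b]"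
    using assms by (intro map_cong) auto
  ultimately have "concat (map (\<lambda>a. G (a div b) (a mod b)) [0..<Suc n * b]) =
      concat (map (\<lambda>a. G (a div b) (a mod b)) [0..<n * b]) @ concat (map (\<lambda>v. G n v) [0..<b])"
    by (simp only: map_append map_map o_def concat_append)
  with Suc show ?case by simp
qed simp

text \<open>The innermost loop runs over the least significant digit, so the nested loops visit the
  numbers below \<open>base x ^ d\<close> in increasing order. Order matters because the output is a
  list.\<close>

lemma lp_for_number:
  assumes "lp (k + d) F"
  shows "lp k (\<lambda>x e. concat (map (\<lambda>a. F x (e @ digits (base x) d a)) [0..<base x ^ d]))"
  using assms
proof (induction d arbitrary: F)
  case 0
  then show ?case by simp
next
  case (Suc d)
  have "lp (k + d) (\<lambda>x e. concat (map (\<lambda>v. F x (e @ [v])) [0..<base x]))"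
    using lp_for[of "k + d" F] Suc.prems by (simp add: base_def)
  from Suc.IH[OF this] show ?case
    by (rule lp_cong) (subst concat_map_blocks, simp_all add: mult.commute)
qed

section \<open>Comparing numbers given by their digits\<close>

definition number :: "nat \<Rightarrow> nat \<Rightarrow> bool list \<Rightarrow> nat list \<Rightarrow> nat" where
  "number i d x e = undigits (base x) (take d (drop i e))"

lemma number_0 [simp]: "number i 0 x e = 0"
  by (simp add: number_def)

lemma number_Suc: "i + d < length e \<Longrightarrow> number i (Suc d) x e = number i d x e * base x + e ! (i + d)"
  by (simp add: number_def take_Suc_conv_app_nth)

lemma env_nth: "env k x e \<Longrightarrow> r < k \<Longrightarrow> e ! r < base x"
  by (auto simp: env_def base_def)

lemma env_length: "env k x e \<Longrightarrow> length e = k"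
  by (auto simp: env_def)

lemma digit_eq_iff:
  fixes a u :: nat
  assumes "u < b" "u' < b"
  shows "a * b + u = a' * b + u' \<longleftrightarrow> a = a' \<and> u = u'"
  using assms by (metis add.commute div_mult_self3 div_less mod_mult_self3 mod_less add_0 less_nat_zero_code)

lemma digit_suc_iff:
  fixes a u :: nat
  assumes "u < b" "u' < b"
  shows "Suc (a * b + u) = a' * b + u' \<longleftrightarrow> (a = a' \<and> u + 1 = u') \<or> (Suc a = a' \<and> u = b - 1 \<and> u' = 0)"
proof (cases "Suc u < b")
  case True
  then show ?thesis using digit_eq_iff[of "Suc u" b u' a a'] assms by auto
next
  case False
  then have "Suc (a * b + u) = Suc a * b + 0" "u = b - 1" using assms by auto
  then show ?thesis using digit_eq_iff[of 0 b u' "Suc a" a'] assms by auto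
qed

lemma cond_digit_0: "r < k \<Longrightarrow> cond k (\<lambda>x e. e ! r = 0)"
  by (rule cond_cong[OF cond_ruler[of r k "\<lambda>s. s = 3" False]]) auto

lemma cond_digit_1: "r < k \<Longrightarrow> cond k (\<lambda>x e. e ! r = 1)"
  by (rule cond_cong[OF cond_ruler[of r k "\<lambda>s. s = 3" True]]) auto

lemma cond_digit_max: "r < k \<Longrightarrow> cond k (\<lambda>x e. e ! r = base x - 1)"
  by (rule cond_cong[OF cond_ruler[of r k "\<lambda>s. s = 4" False]]) (auto simp: ruler_eq_4 base_def)

lemma cond_number_eq:
  assumes "i + d \<le> k" "j + d \<le> k" "i \<noteq> j"
  shows "cond k (\<lambda>x e. number i d x e = number j d x e)"
  using assms
proof (induction d)
  case (Suc d)
  have 1: "cond k (\<lambda>x e. number i d x e = number j d x e)" using Suc by simp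
  have 2: "cond k (\<lambda>x e. e ! (i + d) = e ! (j + d))"
    using cond_digit_eq[of "i + d" k "j + d" False] Suc.prems by simp
  show ?case
    by (rule cond_cong[OF cond_conj[OF 1 2]])
      (use Suc.prems in \<open>simp add: number_Suc env_length digit_eq_iff env_nth\<close>)
qed auto

text \<open>Either the last digits are successive and the higher parts agree, or there is a carry:
  the last digit passes from \<open>base x - 1\<close> to 0 and the higher parts are
  successive.\<close>

lemma cond_number_suc:
  assumes "i + d \<le> k" "j + d \<le> k" "i \<noteq> j"
  shows "cond k (\<lambda>x e. Suc (number i d x e) = number j d x e)"
  using assms
proof (induction d)
  case (Suc d)
  have 1: "cond k (\<lambda>x e. Suc (number i d x e) = number j d x e)" using Suc by simp
  have 2: "cond k (\<lambda>x e. number i d x e = number j d x e)" using Suc.prems by (intro cond_number_eq) auto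
  have 3: "cond k (\<lambda>x e. e ! (i + d) + 1 = e ! (j + d))"
    using cond_digit_eq[of "i + d" k "j + d" True] Suc.prems by simp
  have 4: "cond k (\<lambda>x e. e ! (i + d) = base x - 1)" "cond k (\<lambda>x e. e ! (j + d) = 0)"
    using Suc.prems by (intro cond_digit_max cond_digit_0; simp)+
  show ?case
    by (rule cond_cong[OF cond_disj[OF cond_conj[OF 2 3] cond_conj[OF 1 cond_conj[OF 4]]]])
      (use Suc.prems in \<open>simp add: number_Suc env_length digit_suc_iff env_nth\<close>)
qed auto

lemma cond_number_const:
  assumes "i + length K \<le> k" "set K \<subseteq> {0, 1}"
  shows "cond k (\<lambda>x e. number i (length K) x e = undigits (base x) K)"
  using assms
proof (induction K rule: rev_induct)
  case (snoc v K)
  have 1: "cond k (\<lambda>x e. number i (length K) x e = undigits (base x) K)" using snoc by simp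
  have v: "v = 0 \<or> v = 1" using snoc.prems by auto
  have 2: "cond k (\<lambda>x e. e ! (i + length K) = v)"
    using cond_digit_0[of "i + length K" k] cond_digit_1[of "i + length K" k] snoc.prems v by auto
  show ?case
    by (rule cond_cong[OF cond_conj[OF 1 2]])
      (use snoc.prems v digit_eq_iff[where u' = v] in \<open>auto simp: number_Suc env_length env_nth\<close>)
qed auto

lemma undigits_pow: "undigits b (1 # replicate m 0) = b ^ m"
proof (induction m)
  case (Suc m)
  have "1 # replicate (Suc m) 0 = (1 # replicate m 0) @ [0 :: nat]"
    by (simp add: replicate_append_same)
  then show ?case using Suc by (simp only: undigits_snoc) simp
qed (simp add: undigits_def)

lemma undigits_zeros: "undigits b (replicate m 0) = 0"
proof (induction m)
  case (Suc m)
  have "replicate (Suc m) 0 = replicate m 0 @ [0 :: nat]"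
    by (simp add: replicate_append_same)
  then show ?case using Suc by (simp only: undigits_snoc)
qed simp

lemma cond_number_zero: "i + d \<le> k \<Longrightarrow> cond k (\<lambda>x e. number i d x e = 0)"
  using cond_number_const[of i "replicate d 0" k] by (simp add: undigits_zeros set_replicate_conv_if)

lemma cond_number_pow: "i + Suc m \<le> k \<Longrightarrow> cond k (\<lambda>x e. number i (Suc m) x e = base x ^ m)"
  using cond_number_const[of i "1 # replicate m 0" k] undigits_pow
  by (simp add: set_replicate_conv_if)

text \<open>Being below the place value of the leading digit means that this digit is 0.\<close>

lemma cond_number_less_pow:
  assumes "i + Suc m \<le> k"
  shows "cond k (\<lambda>x e. number i (Suc m) x e < base x ^ m)"
proof -
  have "number i (Suc m) x e < base x ^ m \<longleftrightarrow> e ! i = 0" if e: "env k x e" for x e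
    using assms
  proof (induction m)
    case 0
    then show ?case using e by (simp add: number_Suc env_length)
  next
    case (Suc m)
    have "number i (Suc (Suc m)) x e < base x ^ m * base x \<longleftrightarrow> number i (Suc m) x e < base x ^ m"
    proof -
      have "e ! (i + Suc m) < base x" using e Suc.prems by (intro env_nth) auto
      then have "number i (Suc (Suc m)) x e div base x = number i (Suc m) x e"
        using e Suc.prems by (simp add: number_Suc[of i "Suc m"] env_length)
      then show ?thesis
        by (metis base_gt_1(2) div_less_iff_less_mult)
    qed
    with Suc show ?case by (simp add: mult.commute)
  qed
  then show ?thesis
    using assms by (intro cond_cong[OF cond_digit_0[of i k]]) auto
qed

lemma number_div_mod:
  assumes "env k x e" "i + d < k"
  shows "number i (Suc d) x e div base x = number i d x e" "number i (Suc d) x e mod base x = e ! (i + d)"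
  using assms env_nth[OF assms] by (auto simp: number_Suc env_length)

lemma cond_number_mod:
  assumes "i + d < k"
  shows "cond k (\<lambda>x e. P (ruler x (int (number i (Suc d) x e mod base x))))"
  by (rule cond_cong[OF cond_ruler[of "i + d" k P False]]) (use assms in \<open>simp_all add: number_div_mod\<close>)

section \<open>Loops over items and elements\<close>

lemma lp_concat_list:
  assumes "\<And>a. a \<in> set as \<Longrightarrow> lp k (F a)"
  shows "lp k (\<lambda>x e. concat (map (\<lambda>a. F a x e) as))"
  using assms by (induction as) (auto intro: lp_const lp_append)

text \<open>All triples of a kind, a time below \<open>D\<close> and a position below
  \<open>2 * D\<close>. Kind and parity of the position are outermost: they are unrolled in the
  program, and only \<open>t\<close> and \<open>P\<close> become loops.\<close>

definition grid :: "'a list \<Rightarrow> nat \<Rightarrow> ('a \<times> nat \<times> nat) list" where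
  "grid K D = concat (map (\<lambda>\<kappa>. concat (map (\<lambda>h. concat (map (\<lambda>t. concat (map (\<lambda>P. [(\<kappa>, t, 2 * P + h)])
    [0..<D])) [0..<D])) [0, 1])) K)"

lemma set_grid: "set (grid K D) = set K \<times> {..<D} \<times> {..<2 * D}"
proof -
  have "\<exists>P<D. q = 2 * P \<or> q = Suc (2 * P)" if "q < 2 * D" for q
    using that by (intro exI[of _ "q div 2"]) auto
  then show ?thesis by (fastforce simp: grid_def)
qed

lemma distinct_concat_map:
  assumes "distinct as" "\<And>a. a \<in> set as \<Longrightarrow> distinct (f a)"
    "\<And>a b. a \<in> set as \<Longrightarrow> b \<in> set as \<Longrightarrow> a \<noteq> b \<Longrightarrow> set (f a) \<inter> set (f b) = {}"
  shows "distinct (concat (map f as))"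
  using assms by (induction as) auto

lemma distinct_grid: "distinct K \<Longrightarrow> distinct (grid K D)"
  unfolding grid_def
  by (intro distinct_concat_map) (auto, presburger+)

lemma lp_grid:
  assumes "\<And>\<kappa> h. \<kappa> \<in> set K \<Longrightarrow> h \<in> {0, 1} \<Longrightarrow>
    lp (k + d + d) (\<lambda>x e. F x (take k e) (\<kappa>, number k d x e, 2 * number (k + d) d x e + h))"
  shows "lp k (\<lambda>x e. concat (map (F x e) (grid K (base x ^ d))))"
proof -
  have 1: "lp k (\<lambda>x e. concat (map (\<lambda>t. concat (map (\<lambda>P. F x e (\<kappa>, t, 2 * P + h)) [0..<base x ^ d])) [0..<base x ^ d]))"
    if "\<kappa> \<in> set K" "h \<in> {0, 1}" for \<kappa> h
  proof (rule lp_cong[OF lp_for_number[OF lp_for_number[OF assms[OF that]]]])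
    fix x e assume "env k x e"
    then have [simp]: "length e = k" by (simp add: env_length)
    show "concat (map (\<lambda>a. concat (map (\<lambda>aa. F x (take k ((e @ digits (base x) d a) @ digits (base x) d aa))
        (\<kappa>, number k d x ((e @ digits (base x) d a) @ digits (base x) d aa),
         2 * number (k + d) d x ((e @ digits (base x) d a) @ digits (base x) d aa) + h)) [0..<base x ^ d])) [0..<base x ^ d]) =
      concat (map (\<lambda>t. concat (map (\<lambda>P. F x e (\<kappa>, t, 2 * P + h)) [0..<base x ^ d])) [0..<base x ^ d])"
      by (intro arg_cong[where f = concat] map_cong refl) (simp add: number_def undigits_digits)
  qed
  have 2: "lp k (\<lambda>x e. concat (map (\<lambda>\<kappa>. concat (map (\<lambda>h. concat (map (\<lambda>t. concat (map (\<lambda>P. F x e (\<kappa>, t, 2 * P + h))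
      [0..<base x ^ d])) [0..<base x ^ d])) [0, 1])) K))"
    by (intro lp_concat_list 1) auto
  have c: "concat (map f (concat (map g as))) = concat (map (\<lambda>a. concat (map f (g a))) as)" for f :: "'a \<times> nat \<times> nat \<Rightarrow> bool list"
    and g :: "'c \<Rightarrow> _" and as
    by (induction as) auto
  show ?thesis
    by (rule lp_cong[OF 2]) (simp add: grid_def c o_def del: upt_Suc)
qed

text \<open>For \<open>b = base x\<close> there are \<open>length x ^ i\<close> tokens, so tokens count out the value of a monomial
  at the input length.\<close>

fun token :: "nat \<Rightarrow> nat \<Rightarrow> nat \<Rightarrow> bool" where
  "token b 0 j \<longleftrightarrow> j = 0"
| "token b (Suc i) j \<longleftrightarrow> 0 < j mod b \<and> j mod b < b - 1 \<and> token b i (j div b)"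

text \<open>A digit strictly between 0 and \<open>base x - 1\<close> is a ruler cell that carries an
  input bit, so a single scan recognises it. The digits above the lowest \<open>i\<close> must all
  vanish.\<close>

lemma cond_token: "i \<le> d \<Longrightarrow> s + d \<le> k \<Longrightarrow> cond k (\<lambda>x e. token (base x) i (number s d x e))"
proof (induction i arbitrary: d)
  case 0
  then show ?case by (auto intro: cond_number_zero)
next
  case (Suc i)
  then obtain d' where d: "d = Suc d'" by (cases d) auto
  have "ruler x (int v) = 1 \<or> ruler x (int v) = 2 \<longleftrightarrow> 0 < v \<and> v < base x - 1" for x v
    using sym_of_bit_simps(3,6) by (auto simp: ruler_def base_def sym_of_bit_def)
  then have 1: "cond k (\<lambda>x e. 0 < number s d x e mod base x \<and> number s d x e mod base x < base x - 1)"
    using cond_number_mod[of s d' k "\<lambda>s. s = 1 \<or> s = 2"] Suc.prems by (simp add: d)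
  have 2: "cond k (\<lambda>x e. token (base x) i (number s d' x e))"
    using Suc by (simp add: d)
  show ?case
    by (rule cond_cong[OF cond_conj[OF 1 2]]) (use Suc.prems in \<open>simp add: d number_div_mod\<close>)
qed

lemma token_less: "b > 0 \<Longrightarrow> token b i j \<Longrightarrow> j < b ^ i"
proof (induction i arbitrary: j)
  case (Suc i)
  then have "j div b < b ^ i" by simp
  then show ?case using Suc.prems by (simp add: div_less_iff_less_mult mult.commute)
qed simp

text \<open>Each of the \<open>i\<close> low digits has \<open>b - 2\<close> admissible values, and
  \<open>b - 2\<close> is the length of the input when \<open>b\<close> is its base.\<close>

lemma card_token:
  assumes "b \<ge> 2"
  shows "card {j. token b i j} = (b - 2) ^ i"
proof (induction i)
  case (Suc i)
  have "bij_betw (\<lambda>(a, v). a * b + v) ({j. token b i j} \<times> {0<..<b - 1}) {j. token b (Suc i) j}"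
  proof (rule bij_betw_byWitness[where f' = "\<lambda>j. (j div b, j mod b)"])
    have "(a * b + v) div b = a" "(a * b + v) mod b = v" if "v < b - 1" for a v
      using that by auto
    then show "\<forall>a\<in>{j. token b i j} \<times> {0<..<b - 1}. (\<lambda>j. (j div b, j mod b)) ((\<lambda>(a, v). a * b + v) a) = a"
      "(\<lambda>(a, v). a * b + v) ` ({j. token b i j} \<times> {0<..<b - 1}) \<subseteq> {j. token b (Suc i) j}"
      by auto
  qed auto
  then have "card {j. token b (Suc i) j} = card ({j. token b i j} \<times> {0<..<b - 1})"
    by (simp add: bij_betw_same_card)
  moreover have "b - 1 - Suc 0 = b - 2" by simp
  ultimately show ?case using Suc by (simp add: card_cartesian_product mult.commute)
qed simp

section \<open>Exact cover and weighted stars\<close>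

subsection \<open>Connected safe sets in stars\<close>

lemma strongly_connected_no_arcs:
  assumes "strongly_connected H" "arcs_ends H = {}"
  obtains v where "verts H = {v}"
proof -
  obtain v where v: "v \<in> verts H" using assms(1) by (auto simp: strongly_connected_def)
  have "u = v" if "u \<in> verts H" for u
  proof -
    have "u \<rightarrow>\<^sup>*\<^bsub>H\<^esub> v" using assms(1) that v by (auto simp: strongly_connected_def)
    from reachable_rtranclI[OF this] show ?thesis by (simp add: assms(2))
  qed
  with v that show ?thesis by blast
qed

lemma strongly_connected_center:
  assumes "wf_digraph H" "c \<in> verts H"
    "\<And>v. v \<in> verts H \<Longrightarrow> v \<noteq> c \<Longrightarrow> v \<rightarrow>\<^bsub>H\<^esub> c \<and> c \<rightarrow>\<^bsub>H\<^esub> v"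
  shows "strongly_connected H"
proof -
  interpret wf_digraph H by fact
  have "v \<rightarrow>\<^sup>*\<^bsub>H\<^esub> c \<and> c \<rightarrow>\<^sup>*\<^bsub>H\<^esub> v" if "v \<in> verts H" for v
    using assms(2) assms(3)[OF that] by (cases "v = c") auto
  then show ?thesis
    using assms(2) reachable_trans unfolding strongly_connected_def by blast
qed

lemma sccs_strongly_connected:
  assumes "wf_digraph H" "strongly_connected H"
  shows "H \<in> pre_digraph.sccs H" "C \<in> pre_digraph.sccs H \<Longrightarrow> verts C = verts H"
proof -
  have i: "induced_subgraph H H"
    using assms(1) by (auto simp: induced_subgraph_def subgraph_def compatible_def wf_digraph_def)
  have s: "verts H' \<subseteq> verts H" if "induced_subgraph H' H" for H'
    using that by (auto simp: induced_subgraph_def subgraph_def)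
  show "H \<in> pre_digraph.sccs H"
    using i assms(2) s by (auto simp: pre_digraph.sccs_def)
  show "verts C = verts H" if "C \<in> pre_digraph.sccs H"
    using that i s[of C] assms(2) by (auto simp: pre_digraph.sccs_def)
qed

lemma sccs_no_arcs:
  assumes "wf_digraph H" "arcs H = {}"
  shows "v \<in> verts H \<Longrightarrow> H \<restriction> {v} \<in> pre_digraph.sccs H"
    "C \<in> pre_digraph.sccs H \<Longrightarrow> \<exists>v\<in>verts H. verts C = {v}"
proof -
  have a: "arcs_ends H' = {}" "verts H' \<subseteq> verts H" if "induced_subgraph H' H" for H'
    using that assms(2) by (auto simp: induced_subgraph_def subgraph_def arcs_ends_conv)
  have v: "\<exists>v\<in>verts H. verts H' = {v}" if "induced_subgraph H' H" "strongly_connected H'" for H'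
    using strongly_connected_no_arcs[OF that(2) a(1)[OF that(1)]] a(2)[OF that(1)] by (metis insert_subset)
  then show "\<exists>v\<in>verts H. verts C = {v}" if "C \<in> pre_digraph.sccs H"
    using that by (auto simp: pre_digraph.sccs_def)
  assume m: "v \<in> verts H"
  have wf: "wf_digraph (H \<restriction> {v})"
    using assms(2) by (auto simp: induce_subgraph_def wf_digraph_def)
  then have "induced_subgraph (H \<restriction> {v}) H"
    using assms m by (auto simp: induced_subgraph_def subgraph_def compatible_def induce_subgraph_def)
  moreover have "strongly_connected (H \<restriction> {v})"
    by (rule strongly_connected_center[OF wf, of v]) auto
  ultimately show "H \<restriction> {v} \<in> pre_digraph.sccs H"
    using v by (auto simp: pre_digraph.sccs_def psubset_eq) (metis singletonD subset_singletonD insert_not_empty)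
qed

definition star_graph :: "nat \<Rightarrow> nat pair_pre_digraph" where
  "star_graph n = \<lparr>pverts = {..<n}, parcs = {(i, j). i < n \<and> j < n \<and> i \<noteq> j \<and> (i = 0 \<or> j = 0)}\<rparr>"

lemma star_graph_simps [simp]:
  "pverts (star_graph n) = {..<n}"
  "parcs (star_graph n) = {(i, j). i < n \<and> j < n \<and> i \<noteq> j \<and> (i = 0 \<or> j = 0)}"
  by (auto simp: star_graph_def)

lemma star_star_graph: "n \<ge> 2 \<Longrightarrow> star (with_proj (star_graph n))"
proof -
  assume n: "n \<ge> 2"
  have "finite {(i, j). i < n \<and> j < n \<and> i \<noteq> j \<and> (i = 0 \<or> j = 0)}"
    by (rule finite_subset[of _ "{..<n} \<times> {..<n}"]) auto
  then have "pair_graph (star_graph n)"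
    by unfold_locales (auto simp: symmetric_def sym_def)
  then interpret pair_graph "star_graph n" .
  have "graph (with_proj (star_graph n))" by unfold_locales
  then show ?thesis
    using n by (auto simp: star_def intro!: bexI[of _ 0])
qed

context
  fixes n :: nat and G :: "(nat, nat \<times> nat) pre_digraph"
  defines "G \<equiv> with_proj (star_graph n)"
begin

lemma wf_induce: "wf_digraph (G \<restriction> S)"
  by (auto simp: wf_digraph_def induce_subgraph_def)

lemma dominates_induce: "u \<rightarrow>\<^bsub>G \<restriction> S\<^esub> v \<longleftrightarrow> u \<in> S \<and> v \<in> S \<and> (u, v) \<in> parcs (star_graph n)"
  by (auto simp: arcs_ends_conv induce_subgraph_def G_def image_iff)

lemma strongly_connected_with_center:
  assumes "0 \<in> S" "S \<subseteq> {..<n}"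
  shows "strongly_connected (G \<restriction> S)"
  by (rule strongly_connected_center[OF wf_induce, of 0]) (use assms in \<open>auto simp: dominates_induce\<close>)

lemma connected_with_center:
  assumes "0 \<in> S" "S \<subseteq> {..<n}"
  shows "connected (G \<restriction> S)"
proof -
  interpret wf_digraph "G \<restriction> S" by (rule wf_induce)
  have "u \<rightarrow>\<^sup>*\<^bsub>mk_symmetric (G \<restriction> S)\<^esub> v" if "u \<in> S" "v \<in> S" for u v
    using strongly_connected_with_center[OF assms] that
    by (intro reachable_mk_symmetricI) (auto simp: strongly_connected_def)
  then show ?thesis
    using assms by (auto simp: connected_def strongly_connected_def)
qed

lemma no_arcs_without_center: "0 \<notin> S \<Longrightarrow> arcs (G \<restriction> S) = {}"
  by (auto simp: induce_subgraph_def G_def)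

lemma connected_without_center:
  assumes "connected (G \<restriction> S)" "0 \<notin> S"
  obtains v where "S = {v}"
proof (rule strongly_connected_no_arcs[OF assms(1)[unfolded connected_def]])
  show "arcs_ends (with_proj (mk_symmetric (G \<restriction> S))) = {}"
    using no_arcs_without_center[OF assms(2)] by (simp add: parcs_mk_symmetric)
qed (use that in auto)

text \<open>A set with the center induces a single component, and removing it leaves isolated
  leaves, all adjacent to the center.\<close>

lemma safe_with_center:
  assumes "0 \<in> S" "S \<subseteq> {..<n}"
  shows "safe G w S \<longleftrightarrow> (\<forall>v\<in>{..<n} - S. w v \<le> sum w S)"
proof -
  let ?D = "{..<n} - S"
  have V: "verts G = {..<n}" by (simp add: G_def)
  have na: "arcs (G \<restriction> ?D) = {}" using assms by (intro no_arcs_without_center) auto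
  note C = sccs_strongly_connected[OF wf_induce strongly_connected_with_center[OF assms]]
  note D = sccs_no_arcs[OF wf_induce na]
  show ?thesis
  proof
    assume safe: "safe G w S"
    show "\<forall>v\<in>?D. w v \<le> sum w S"
    proof
      fix v assume v: "v \<in> ?D"
      have "adjacent_subgraphs G (G \<restriction> S) ((G \<restriction> ?D) \<restriction> {v})"
        using v assms by (auto simp: adjacent_subgraphs_def G_def intro!: bexI[of _ 0])
      then show "w v \<le> sum w S"
        using safe C(1) D(1)[of v] v unfolding safe_def V by (fastforce simp: weight_def)
    qed
  next
    assume w: "\<forall>v\<in>?D. w v \<le> sum w S"
    show "safe G w S"
      unfolding safe_def V
    proof (intro conjI ballI impI)
      fix C' D' assume "C' \<in> pre_digraph.sccs (G \<restriction> S)" "D' \<in> pre_digraph.sccs (G \<restriction> ?D)"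
      then have "verts C' = S" "\<exists>v\<in>?D. verts D' = {v}" using C(2) D(2) by auto
      then show "weight w D' \<le> weight w C'" using w by (auto simp: weight_def)
    qed (use assms in auto)
  qed
qed

text \<open>The complement of a leaf contains the center, so it is one component, and it is adjacent
  to the leaf.\<close>

lemma safe_leaf:
  assumes "safe G w {v}" "v < n" "v \<noteq> 0"
  shows "sum w ({..<n} - {v}) \<le> w v"
proof -
  let ?D = "{..<n} - {v}"
  have V: "verts G = {..<n}" by (simp add: G_def)
  have "strongly_connected (G \<restriction> ?D)"
    using assms by (intro strongly_connected_with_center) auto
  then have D: "G \<restriction> ?D \<in> pre_digraph.sccs (G \<restriction> ?D)"
    by (rule sccs_strongly_connected(1)[OF wf_induce])
  have "strongly_connected (G \<restriction> {v})"
    by (rule strongly_connected_center[OF wf_induce, of v]) auto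
  then have C: "G \<restriction> {v} \<in> pre_digraph.sccs (G \<restriction> {v})"
    by (rule sccs_strongly_connected(1)[OF wf_induce])
  have "adjacent_subgraphs G (G \<restriction> {v}) (G \<restriction> ?D)"
    using assms by (auto simp: adjacent_subgraphs_def G_def intro!: bexI[of _ 0])
  then have "weight w (G \<restriction> ?D) \<le> weight w (G \<restriction> {v})"
    using assms(1) C D unfolding safe_def V by blast
  then show ?thesis by (simp add: weight_def)
qed

text \<open>The set of all vertices is connected and safe, so the minimum is taken over a nonempty
  finite set and is attained.\<close>

lemma cs_star_le_iff:
  assumes "n > 0"
  shows "cs G w \<le> k \<longleftrightarrow> (\<exists>S. safe G w S \<and> connected (G \<restriction> S) \<and> sum w S \<le> k)"
proof -
  let ?A = "{sum w S | S. safe G w S \<and> connected (G \<restriction> S)}"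
  have "?A \<subseteq> sum w ` Pow {..<n}" by (auto simp: safe_def G_def)
  then have fin: "finite ?A" by (rule finite_subset) simp
  have "sum w {..<n} \<in> ?A"
    using safe_with_center[of "{..<n}" w] connected_with_center[of "{..<n}"] assms by auto
  then have "?A \<noteq> {}" by blast
  from Min_le_iff[OF fin this] show ?thesis by (auto simp: cs_def)
qed

end

subsection \<open>From exact cover to weighted stars\<close>

primrec num :: "bool list \<Rightarrow> nat" where
  "num [] = 0"
| "num (b # s) = of_bool b + 2 * num s"

lemma num_append: "num (s @ t) = num s + 2 ^ length s * num t"
  by (induction s) (auto simp: algebra_simps)

lemma num_replicate_False [simp]: "num (replicate m False) = 0"
  by (induction m) auto

lemma num_pos: "s \<noteq> [] \<Longrightarrow> last s \<Longrightarrow> num s > 0"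
  by (induction s) (auto split: if_splits)

text \<open>A final \<open>True\<close> is the leading bit, so there are no leading zeros and the
  string is the canonical representation.\<close>

lemma bits_num: "s \<noteq> [] \<Longrightarrow> last s \<Longrightarrow> bits (num s) = s"
proof (induction s)
  case (Cons b s)
  show ?case
  proof (cases "s = []")
    case True
    with Cons.prems show ?thesis by (simp add: bits.simps[of 1] bits.simps[of 0] bits.simps[of "Suc 0"])
  next
    case False
    then show ?thesis
      unfolding bits.simps[of "num (b # s)"] using Cons num_pos[of s] by auto
  qed
qed simp

lemma num_bits: "num (bits k) = k"
proof (induction k rule: less_induct)
  case (less k)
  then show ?case by (cases "k = 0") (auto simp: bits.simps[of k] bits.simps[of 0] odd_iff_mod_2_eq_one)
qed

lemma last_bits: "k > 0 \<Longrightarrow> bits k \<noteq> [] \<and> last (bits k)"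
proof (induction k rule: less_induct)
  case (less k)
  show ?case
  proof (cases "k = 1")
    case True
    then show ?thesis by (simp add: bits.simps[of 1] bits.simps[of 0] bits.simps[of "Suc 0"])
  next
    case False
    with less show ?thesis by (auto simp: bits.simps[of k])
  qed
qed

section \<open>Expansions with bounded digits below an arbitrary leading part\<close>

primrec horner :: "nat \<Rightarrow> nat list \<Rightarrow> nat \<Rightarrow> nat" where
  "horner X [] a = a"
| "horner X (c # ds) a = c + X * horner X ds a"

lemma horner_sum:
  "(\<Sum>i\<in>A. horner X (map (f i) es) (g i)) = horner X (map (\<lambda>e. \<Sum>i\<in>A. f i e) es) (\<Sum>i\<in>A. g i)"
  by (induction es) (auto simp: sum.distrib sum_distrib_left[symmetric])

lemma horner_eq_iff:
  assumes "\<And>e. e \<in> set es \<Longrightarrow> f e < X \<and> g e < X"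
  shows "horner X (map f es) a = horner X (map g es) b \<longleftrightarrow> (\<forall>e\<in>set es. f e = g e) \<and> a = b"
  using assms
proof (induction es)
  case (Cons e es)
  have "f e + X * h = g e + X * h' \<longleftrightarrow> f e = g e \<and> h = h'" for h h'
    using digit_eq_iff[of "f e" X "g e" h h'] Cons.prems[of e] by (auto simp: algebra_simps)
  with Cons show ?case by auto
qed simp

lemma horner_ge: "horner X ds a \<ge> a * X ^ length ds"
proof (induction ds)
  case (Cons c ds)
  have "X * (a * X ^ length ds) \<le> X * horner X ds a" using Cons by (rule mult_le_mono2)
  from trans_le_add2[OF this, of c] show ?case by (simp add: mult.left_commute)
qed simp

lemma horner_less:
  assumes "\<And>c. c \<in> set ds \<Longrightarrow> c < X"
  shows "horner X ds a < Suc a * X ^ length ds"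
  using assms
proof (induction ds)
  case (Cons c ds)
  then have "Suc (horner X ds a) \<le> Suc a * X ^ length ds" by (simp add: Suc_le_eq)
  then have "X * Suc (horner X ds a) \<le> X * (Suc a * X ^ length ds)" by (rule mult_le_mono2)
  moreover have "c < X" using Cons.prems by simp
  ultimately show ?case by (simp add: algebra_simps)
qed simp

definition exact_cover :: "'i list \<Rightarrow> 'e list \<Rightarrow> ('i \<Rightarrow> 'e \<Rightarrow> bool) \<Rightarrow> ('e \<Rightarrow> bool) \<Rightarrow> bool" where
  "exact_cover Is Es cov need \<longleftrightarrow>
    (\<exists>A\<subseteq>set Is. \<forall>e\<in>set Es. card {i \<in> A. cov i e} = of_bool (need e))"

text \<open>One digit per element: a bit padded by as many zeros as there are items. The base
  \<open>2 ^ Suc m\<close> exceeds the number \<open>m\<close> of items, so adding the digits of any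
  set of items causes no carry, and printing needs no arithmetic.\<close>

definition row :: "'i list \<Rightarrow> 'e list \<Rightarrow> ('e \<Rightarrow> bool) \<Rightarrow> bool list" where
  "row Is Es P = concat (map (\<lambda>e. P e # map (\<lambda>_. False) Is) Es)"

text \<open>Vertex 0 is the center; it is followed by the items, as many leaves of the same weight as the
  center, which make up for the unknown number of chosen items, and the heavy leaf.\<close>

definition weight_strs :: "'i list \<Rightarrow> 'e list \<Rightarrow> ('i \<Rightarrow> 'e \<Rightarrow> bool) \<Rightarrow> ('e \<Rightarrow> bool) \<Rightarrow> bool list list" where
  "weight_strs Is Es cov need =
    (row Is Es (\<lambda>_. False) @ [True]) # map (\<lambda>i. row Is Es (cov i) @ [True]) Is @
    map (\<lambda>_. row Is Es (\<lambda>_. False) @ [True]) Is @ [row Is Es need @ bits (Suc (length Is))]"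

lemma num_row: "num (row Is Es P @ t) = horner (2 ^ Suc (length Is)) (map (\<lambda>e. of_bool (P e)) Es) (num t)"
proof (induction Es)
  case Nil
  then show ?case by (simp add: row_def)
next
  case (Cons e Es)
  have "row Is (e # Es) P @ t = P e # replicate (length Is) False @ (row Is Es P @ t)"
    by (simp add: row_def map_replicate_const)
  then show ?case using Cons by (simp add: num_append algebra_simps)
qed

locale cover_star =
  fixes Is :: "'i list" and Es :: "'e list" and cov :: "'i \<Rightarrow> 'e \<Rightarrow> bool" and need :: "'e \<Rightarrow> bool"
  assumes distinct_items: "distinct Is" and items: "Is \<noteq> []"
begin

definition "m = length Is"
definition "n = 2 * m + 2"
definition "strs = weight_strs Is Es cov need"
definition "w v = num (strs ! v)"
definition "X = (2::nat) ^ Suc m"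
text \<open>The place value of the leading part. Center, item leaves and dummies have weights in
  \<open>[B, 2 * B)\<close>, and the heavy leaf has weight in
  \<open>[Suc m * B, Suc (Suc m) * B)\<close>.\<close>

definition "B = X ^ length Es"
definition "W = num (row Is Es need @ bits (Suc m))"

lemma m_pos: "m \<ge> 1"
  using items by (simp add: m_def Suc_le_eq)

lemma length_strs: "length strs = n"
  by (simp add: strs_def weight_strs_def n_def m_def)

lemma strs_last: "s \<in> set strs \<Longrightarrow> s \<noteq> [] \<and> last s"
  using last_bits[of "Suc (length Is)"] by (auto simp: strs_def weight_strs_def)

lemma X_gt: "m < X"
  unfolding X_def using less_exp[of "Suc m"] by simp

lemma X_gt_1: "1 < X"
  unfolding X_def by (rule one_less_power) auto

lemma W_eq: "W = horner X (map (\<lambda>e. of_bool (need e)) Es) (Suc m)"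
  by (simp add: W_def num_row num_bits X_def m_def del: power_Suc)

lemma w_heavy: "w (n - 1) = W"
  by (simp add: w_def strs_def weight_strs_def n_def W_def m_def nth_append nth_Cons')

definition digit :: "nat \<Rightarrow> 'e \<Rightarrow> nat" where
  "digit v e = of_bool (1 \<le> v \<and> v \<le> m \<and> cov (Is ! (v - 1)) e)"

lemma w_eq: "v < n - 1 \<Longrightarrow> w v = horner X (map (digit v) Es) 1"
proof -
  assume v: "v < n - 1"
  have "strs ! v = row Is Es (\<lambda>e. 1 \<le> v \<and> v \<le> m \<and> cov (Is ! (v - 1)) e) @ [True]"
  proof -
    consider "v = 0" | "1 \<le> v" "v \<le> m" | "v > m" by linarith
    then show ?thesis
      by cases (use v in \<open>auto simp: strs_def weight_strs_def n_def m_def nth_append nth_Cons'\<close>)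
  qed
  then show ?thesis
    unfolding w_def digit_def by (simp only: num_row) (simp add: X_def m_def)
qed

lemma w_ge: "v < n - 1 \<Longrightarrow> B \<le> w v"
  using horner_ge[of 1 X "map (digit v) Es"] by (simp add: w_eq B_def)

lemma w_less: "v < n - 1 \<Longrightarrow> w v < 2 * B"
proof -
  assume "v < n - 1"
  moreover have "c < X" if "c \<in> set (map (digit v) Es)" for c using X_gt_1 that by (auto simp: digit_def)
  from horner_less[of "map (digit v) Es" X 1, OF this] have "horner X (map (digit v) Es) 1 < 2 * B" by (simp add: B_def)
  ultimately show ?thesis by (simp add: w_eq)
qed

lemma W_ge: "Suc m * B \<le> W"
  using horner_ge[of "Suc m" X "map (\<lambda>e. of_bool (need e)) Es"] by (simp add: W_eq B_def)

lemma W_less: "W < Suc (Suc m) * B"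
proof -
  have "c < X" if "c \<in> set (map (\<lambda>e. of_bool (need e)) Es)" for c using X_gt_1 that by auto
  from horner_less[of "map (\<lambda>e. of_bool (need e)) Es" X "Suc m", OF this] show ?thesis
    unfolding W_eq B_def by simp
qed

lemma B_pos: "B > 0"
  by (simp add: B_def X_def)

text \<open>The leading part of the sum counts the vertices of \<open>S\<close>; the digit of an
  element counts the chosen items covering it, which is at most \<open>m\<close> and hence below the
  base. Equality with \<open>W\<close> can therefore be read digit by digit.\<close>

lemma sum_w:
  assumes "S \<subseteq> {..<n - 1}"
  shows "sum w S = W \<longleftrightarrow> (\<forall>e\<in>set Es. card {i. i < m \<and> Suc i \<in> S \<and> cov (Is ! i) e} = of_bool (need e)) \<and> card S = Suc m"
proof -
  have fin: "finite S" using assms finite_subset by blast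
  have "sum w S = (\<Sum>v\<in>S. horner X (map (digit v) Es) 1)"
    using assms by (intro sum.cong) (auto simp: w_eq)
  also have "\<dots> = horner X (map (\<lambda>e. \<Sum>v\<in>S. digit v e) Es) (card S)"
    by (simp add: horner_sum)
  finally have s: "sum w S = horner X (map (\<lambda>e. \<Sum>v\<in>S. digit v e) Es) (card S)" .
  have d: "(\<Sum>v\<in>S. digit v e) = card {i. i < m \<and> Suc i \<in> S \<and> cov (Is ! i) e}" for e
  proof -
    have "(\<Sum>v\<in>S. digit v e) = card {v \<in> S. 1 \<le> v \<and> v \<le> m \<and> cov (Is ! (v - 1)) e}"
      using fin by (simp add: digit_def Int_def)
    also have "{v \<in> S. 1 \<le> v \<and> v \<le> m \<and> cov (Is ! (v - 1)) e} = Suc ` {i. i < m \<and> Suc i \<in> S \<and> cov (Is ! i) e}"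
      by (auto simp: image_iff Suc_le_eq gr0_conv_Suc)
    finally show ?thesis by (simp add: card_image)
  qed
  have "card {i. i < m \<and> Suc i \<in> S \<and> cov (Is ! i) e} < X" for e
  proof -
    have "card {i. i < m \<and> Suc i \<in> S \<and> cov (Is ! i) e} \<le> card {..<m}"
      by (rule card_mono) auto
    then show ?thesis using X_gt by simp
  qed
  then show ?thesis
    unfolding s W_eq d using X_gt_1 by (subst horner_eq_iff) auto
qed

lemma cover_iff: "exact_cover Is Es cov need \<longleftrightarrow> (\<exists>S\<subseteq>{..<n - 1}. 0 \<in> S \<and> sum w S = W)"
proof
  assume "exact_cover Is Es cov need"
  then obtain A where A: "A \<subseteq> set Is" "\<And>e. e \<in> set Es \<Longrightarrow> card {i \<in> A. cov i e} = of_bool (need e)"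
    by (auto simp: exact_cover_def)
  define J where "J = {j. j < m \<and> Is ! j \<in> A}"
  \<comment> \<open>Dummy \<open>i\<close> is vertex \<open>Suc (m + i)\<close>. Together with the
    center and the chosen items, \<open>m - card J\<close> dummies bring the size to
    \<open>Suc m\<close>, the leading part of \<open>W\<close>.\<close>
  define S where "S = insert 0 (Suc ` J \<union> (\<lambda>i. Suc (m + i)) ` {..<m - card J})"
  have fJ: "finite J" "card J \<le> m"
    using card_mono[of "{..<m}" J] by (auto simp: J_def)
  have S: "S \<subseteq> {..<n - 1}" "0 \<in> S" by (auto simp: S_def J_def n_def)
  have "card {i. i < m \<and> Suc i \<in> S \<and> cov (Is ! i) e} = of_bool (need e)" if e: "e \<in> set Es" for e
  proof -
    have "{i. i < m \<and> Suc i \<in> S \<and> cov (Is ! i) e} = {j \<in> J. cov (Is ! j) e}"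
      by (auto simp: S_def J_def)
    then have "card {i. i < m \<and> Suc i \<in> S \<and> cov (Is ! i) e} = card {j \<in> J. cov (Is ! j) e}" by simp
    also have "\<dots> = card ((\<lambda>j. Is ! j) ` {j \<in> J. cov (Is ! j) e})"
      using distinct_items by (intro card_image[symmetric]) (auto simp: inj_on_def J_def m_def nth_eq_iff_index_eq)
    also have "(\<lambda>j. Is ! j) ` {j \<in> J. cov (Is ! j) e} = {i \<in> A. cov i e}"
      using A(1) by (auto simp: J_def image_iff m_def) (metis in_set_conv_nth subsetD)
    finally show ?thesis using A(2)[OF e] by simp
  qed
  moreover have "card S = Suc m"
  proof -
    have "card S = Suc (card (Suc ` J \<union> (\<lambda>i. Suc (m + i)) ` {..<m - card J}))"
      unfolding S_def using fJ by (subst card_insert_disjoint) auto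
    also have "card (Suc ` J \<union> (\<lambda>i. Suc (m + i)) ` {..<m - card J}) = card J + (m - card J)"
      using fJ by (subst card_Un_disjoint) (auto simp: card_image inj_on_def J_def)
    finally show ?thesis using fJ by simp
  qed
  ultimately have "sum w S = W" using sum_w[OF S(1)] by simp
  with S show "\<exists>S\<subseteq>{..<n - 1}. 0 \<in> S \<and> sum w S = W" by blast
next
  assume "\<exists>S\<subseteq>{..<n - 1}. 0 \<in> S \<and> sum w S = W"
  then obtain S where S: "S \<subseteq> {..<n - 1}" "sum w S = W" by blast
  define A where "A = {Is ! i | i. i < m \<and> Suc i \<in> S}"
  have "card {i \<in> A. cov i e} = of_bool (need e)" if "e \<in> set Es" for e
  proof -
    have "{i \<in> A. cov i e} = (\<lambda>j. Is ! j) ` {i. i < m \<and> Suc i \<in> S \<and> cov (Is ! i) e}"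
      by (auto simp: A_def)
    moreover have "inj_on (\<lambda>j. Is ! j) {i. i < m \<and> Suc i \<in> S \<and> cov (Is ! i) e}"
      using distinct_items by (auto simp: inj_on_def m_def nth_eq_iff_index_eq)
    ultimately show ?thesis
      using sum_w[OF S(1)] S(2) that by (simp add: card_image)
  qed
  moreover have "A \<subseteq> set Is" by (auto simp: A_def m_def)
  ultimately show "exact_cover Is Es cov need" by (auto simp: exact_cover_def)
qed

lemma cs_le_iff: "cs (with_proj (star_graph n)) w \<le> W \<longleftrightarrow> exact_cover Is Es cov need"
proof -
  have n: "n > 0" "n - 1 < n" "n - 1 \<noteq> 0" by (auto simp: n_def)
  have two: "2 * B \<le> W"
  proof -
    have "2 * B \<le> Suc m * B" using m_pos by (intro mult_le_mono1) simp
    with W_ge show ?thesis by linarith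
  qed
  have le: "w v \<le> W" if "v < n" for v
  proof -
    have "v = n - 1 \<or> v < n - 1" using that by linarith
    then show ?thesis using w_less[of v] w_heavy two by auto
  qed
  have V: "{..<n} = insert (n - 1) {..<n - 1}" using n by auto
  show ?thesis
    unfolding cs_star_le_iff[OF n(1)] cover_iff
  proof
    assume "\<exists>S\<subseteq>{..<n - 1}. 0 \<in> S \<and> sum w S = W"
    then obtain S where S: "S \<subseteq> {..<n - 1}" "0 \<in> S" "sum w S = W" by blast
    then have "S \<subseteq> {..<n}" by auto
    with S safe_with_center[of S n w] connected_with_center[of S n] le
    show "\<exists>S. safe (with_proj (star_graph n)) w S \<and> connected (with_proj (star_graph n) \<restriction> S) \<and> sum w S \<le> W"
      by (intro exI[of _ S]) auto
  next
    assume "\<exists>S. safe (with_proj (star_graph n)) w S \<and> connected (with_proj (star_graph n) \<restriction> S) \<and> sum w S \<le> W"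
    then obtain S where S: "safe (with_proj (star_graph n)) w S" "connected (with_proj (star_graph n) \<restriction> S)" "sum w S \<le> W"
      by blast
    have Sn: "S \<subseteq> {..<n}" using S(1) by (simp add: safe_def)
    then have fin: "finite S" using finite_subset by blast
    show "\<exists>S\<subseteq>{..<n - 1}. 0 \<in> S \<and> sum w S = W"
    proof (cases "0 \<in> S")
      case True
      \<comment> \<open>The center has positive weight, so center and heavy leaf together already
        exceed \<open>W\<close>.\<close>
      have "n - 1 \<notin> S"
      proof
        assume "n - 1 \<in> S"
        then have "sum w {0, n - 1} \<le> sum w S" using True fin by (intro sum_mono2) auto
        then have "w 0 + W \<le> W" using S(3) n w_heavy by simp
        moreover have "w 0 > 0" using w_ge[of 0] B_pos by (simp add: n_def)
        ultimately show False by simp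
      qed
      then have "n - 1 \<in> {..<n} - S" using n by simp
      then have "W \<le> sum w S"
        using S(1) safe_with_center[OF True Sn, of w] w_heavy by metis
      with S(3) have "sum w S = W" by simp
      moreover have "S \<subseteq> {..<n - 1}" using Sn \<open>n - 1 \<notin> S\<close> V by auto
      ultimately show ?thesis using True by blast
    next
      case False
      then obtain v where v: "S = {v}" using connected_without_center[OF S(2)] by blast
      then have vn: "v < n" "v \<noteq> 0" using Sn False by auto
      have ge: "sum w ({..<n} - {v}) \<le> w v" using safe_leaf[of n w v] S(1) v vn by simp
      \<comment> \<open>A single leaf is never safe. The rest around the heavy leaf weighs at least
        \<open>(2 * m + 1) * B\<close>, which exceeds \<open>W\<close> because
        \<open>m >= 1\<close>. The rest around any other leaf contains the heavy one, of weight at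
        least \<open>2 * B\<close>.\<close>
      have False
      proof (cases "v = n - 1")
        case True
        have "(2 * m + 1) * B = (\<Sum>v<n - 1. B)" by (simp add: n_def)
        also have "\<dots> \<le> sum w {..<n - 1}" by (rule sum_mono) (auto intro: w_ge)
        also have "{..<n - 1} = {..<n} - {v}" using True V by auto
        finally have "(2 * m + 1) * B \<le> W" using ge True w_heavy by simp
        moreover have "Suc (Suc m) * B \<le> (2 * m + 1) * B" using m_pos by (intro mult_le_mono1) simp
        ultimately show False using W_less by linarith
      next
        case False
        then have "w (n - 1) \<le> sum w ({..<n} - {v})" using n by (intro member_le_sum) auto
        moreover have "w v < 2 * B" using False vn by (intro w_less) auto
        ultimately show False using ge two w_heavy by linarith
      qed
      then show ?thesis ..
    qed
  qed
qed

text \<open>The exceptional vertex is the heavy leaf, and every other weight is at least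
  \<open>B\<close>. The total is at most
  \<open>Suc (Suc m) * B + (2 * m + 1) * (2 * B) = (5 * m + 4) * B\<close>. Divided by
  \<open>n = 2 * m + 2\<close> this stays below \<open>5/2\<close> times \<open>B\<close>, hence
  well within the factor 4.\<close>

lemma instance_promise:
  "star (with_proj (star_graph n)) \<and> pverts (star_graph n) = {..<card (pverts (star_graph n))} \<and>
    (\<forall>u\<in>pverts (star_graph n). w u > 0) \<and>
    (\<exists>u'\<in>pverts (star_graph n). 1 / real (card (pverts (star_graph n))) * real (weight w (with_proj (star_graph n)))
      \<le> 4 * real (Min {w u | u. u \<in> pverts (star_graph n) - {u'}}))"
proof (intro conjI bexI[of _ "n - 1"])
  show "star (with_proj (star_graph n))" by (rule star_star_graph) (simp add: n_def)
  have V: "{..<n} = insert (n - 1) {..<n - 1}" by (auto simp: n_def)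
  have W0: "W > 0" using W_ge B_pos by (simp add: less_le_trans)
  show "\<forall>u\<in>pverts (star_graph n). w u > 0"
    using w_ge B_pos W0 w_heavy V by (auto simp: less_le_trans)
  let ?M = "Min {w u | u. u \<in> pverts (star_graph n) - {n - 1}}"
  have "B \<le> ?M"
  proof (rule Min.boundedI)
    have "{w u | u. u \<in> pverts (star_graph n) - {n - 1}} = w ` ({..<n} - {n - 1})" by auto
    then show "finite {w u | u. u \<in> pverts (star_graph n) - {n - 1}}" by simp
    have "0 < n" "0 \<noteq> n - 1" by (auto simp: n_def)
    then have "w 0 \<in> {w u | u. u \<in> pverts (star_graph n) - {n - 1}}" by (auto intro!: exI[of _ 0])
    then show "{w u | u. u \<in> pverts (star_graph n) - {n - 1}} \<noteq> {}" by blast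
  qed (use w_ge in auto)
  then have M: "4 * n * B \<le> 4 * n * ?M" by (rule mult_le_mono2)
  have wB: "weight w (with_proj (star_graph n)) \<le> 4 * n * B"
  proof -
    have "weight w (with_proj (star_graph n)) = W + sum w {..<n - 1}"
      unfolding weight_def with_proj_simps star_graph_simps V using w_heavy by simp
    also have "sum w {..<n - 1} \<le> (\<Sum>v<n - 1. 2 * B)" by (rule sum_mono) (simp add: w_less less_imp_le)
    also have "W + (\<Sum>v<n - 1. 2 * B) \<le> Suc (Suc m) * B + (2 * m + 1) * (2 * B)"
      using W_less by (simp add: n_def)
    also have "\<dots> = (5 * m + 4) * B" by (simp add: algebra_simps)
    also have "\<dots> \<le> (4 * n) * B" by (intro mult_le_mono1) (simp add: n_def)
    finally show ?thesis by simp
  qed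
  have "real (weight w (with_proj (star_graph n))) \<le> real (4 * n * ?M)"
    using le_trans[OF wB M] by (rule of_nat_mono)
  then have "real (weight w (with_proj (star_graph n))) \<le> real n * (4 * real ?M)"
    by (simp only: of_nat_mult of_nat_numeral mult.commute mult.left_commute)
  then show "1 / real (card (pverts (star_graph n))) * real (weight w (with_proj (star_graph n))) \<le> 4 * real ?M"
    by (simp add: field_simps n_def)
qed (auto simp: n_def)

text \<open>The strings that define the weights end in \<open>True\<close>, so they are literally
  the binary representations required by the encoding and can be printed as they stand.\<close>

lemma enc_instance:
  "enc_weighted_graph (star_graph n, w) = replicate n True @ [False] @
    concat (map (\<lambda>s. concat (map (\<lambda>b. [True, b]) s) @ [False]) strs) @
    concat (map (\<lambda>i. map (\<lambda>j. i \<noteq> j \<and> (i = 0 \<or> j = 0)) [0..<n]) [0..<n])"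
proof -
  have "map (\<lambda>i. enc_nat (w i)) [0..<n] = map (\<lambda>s. concat (map (\<lambda>b. [True, b]) s) @ [False]) (map (\<lambda>i. strs ! i) [0..<n])"
    using strs_last length_strs by (auto simp: enc_nat_def w_def bits_num)
  also have "map (\<lambda>i. strs ! i) [0..<n] = strs"
    using length_strs map_nth by metis
  finally have 1: "map (\<lambda>i. enc_nat (w i)) [0..<n] = map (\<lambda>s. concat (map (\<lambda>b. [True, b]) s) @ [False]) strs" .
  have 2: "map (\<lambda>i. map (\<lambda>j. (i, j) \<in> parcs (star_graph n)) [0..<n]) [0..<n] =
      map (\<lambda>i. map (\<lambda>j. i \<noteq> j \<and> (i = 0 \<or> j = 0)) [0..<n]) [0..<n]"
    by (auto intro!: map_cong)
  show ?thesis
    unfolding enc_weighted_graph_def case_prod_conv Let_def star_graph_simps(1) card_lessThan 1 2 ..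
qed

end

section \<open>Exact cover and verifiers\<close>

subsection \<open>Runs of a verifier\<close>

text \<open>Extends the transition function to the halting state by a transition that changes
  nothing. A halted run thus continues through all later times of the tableau, including the
  acceptance time.\<close>

definition next_step :: "tm \<Rightarrow> nat \<times> nat list \<Rightarrow> nat \<times> (nat \<times> dir) list" where
  "next_step M r = (if fst r < states M then delta M (fst r) (snd r) else (fst r, idle_acts (snd r)))"

definition config_at :: "tm \<Rightarrow> bool list \<Rightarrow> nat \<Rightarrow> config" where
  "config_at M z t = (step M ^^ t) (init_config M z)"

definition tape_at :: "tm \<Rightarrow> bool list \<Rightarrow> nat \<Rightarrow> nat \<Rightarrow> tape" where
  "tape_at M z t i = snd (config_at M z t) ! i"

definition rule_at :: "tm \<Rightarrow> bool list \<Rightarrow> nat \<Rightarrow> nat \<times> nat list" where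
  "rule_at M z t = (fst (config_at M z t), map scan (snd (config_at M z t)))"

lemma step_next_step:
  "step M (q, tps) = (fst (next_step M (q, map scan tps)), map2 act (snd (next_step M (q, map scan tps))) tps)"
proof -
  have s: "map (\<lambda>(t, p). t p) tps = map scan tps"
    by (simp add: scan_def case_prod_beta)
  have "map2 act (idle_acts (map scan tps)) tps = tps"
    by (rule nth_equalityI) (auto simp: idle_acts_def act_stay)
  then show ?thesis by (simp add: next_step_def s case_prod_beta)
qed

locale verifier =
  fixes M :: tm and z :: "bool list"
  assumes wf: "wf_tm M"
begin

abbreviation "k \<equiv> tapes M"
abbreviation "cf \<equiv> config_at M z"
abbreviation "tp \<equiv> tape_at M z"
abbreviation "rl \<equiv> rule_at M z"

definition valid_rule :: "nat \<times> nat list \<Rightarrow> bool" where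
  "valid_rule r \<longleftrightarrow> fst r \<le> states M \<and> length (snd r) = k \<and> set (snd r) \<subseteq> {..<symbols M}"

lemma next_step_wf:
  assumes "valid_rule r"
  shows "fst (next_step M r) \<le> states M" "length (snd (next_step M r)) = k"
    "fst ` set (snd (next_step M r)) \<subseteq> {..<symbols M}"
proof -
  have "fst (next_step M r) \<le> states M \<and> length (snd (next_step M r)) = k \<and>
    fst ` set (snd (next_step M r)) \<subseteq> {..<symbols M}"
  proof (cases "fst r < states M")
    case True
    have "case delta M (fst r) (snd r) of (q', acts) \<Rightarrow>
        q' \<le> states M \<and> length acts = tapes M \<and> fst ` set acts \<subseteq> {..<symbols M}"
      using wf[unfolded wf_tm_def, THEN conjunct2, THEN conjunct2, rule_format, OF True, of "snd r"] assms
      by (simp add: valid_rule_def)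
    then show ?thesis using True by (simp add: next_step_def case_prod_beta)
  next
    case False
    then show ?thesis using assms by (auto simp: next_step_def valid_rule_def idle_acts_def)
  qed
  then show "fst (next_step M r) \<le> states M" "length (snd (next_step M r)) = k"
    "fst ` set (snd (next_step M r)) \<subseteq> {..<symbols M}" by auto
qed

lemma k_pos: "k \<ge> 1" "symbols M \<ge> 3"
  using wf by (auto simp: wf_tm_def)

lemma cf_0: "cf 0 = (0, input_tape z # replicate (k - 1) blank_tape)"
  by (simp add: config_at_def init_config_def)

lemma cf_Suc: "cf (Suc t) = (fst (next_step M (rl t)), map2 act (snd (next_step M (rl t))) (snd (cf t)))"
  using step_next_step[of M "fst (cf t)" "snd (cf t)"] by (simp add: config_at_def rule_at_def)

lemma cf_wf: "fst (cf t) \<le> states M \<and> length (snd (cf t)) = k \<and> (\<forall>i<k. \<forall>p. fst (tp t i) p < symbols M)"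
proof (induction t)
  case 0
  then show ?case
    using k_pos by (auto simp: cf_0 tape_at_def input_tape_def blank_tape_def nth_Cons' sym_of_bit_def)
next
  case (Suc t)
  have v: "valid_rule (rl t)"
    using Suc by (auto simp: valid_rule_def rule_at_def scan_def tape_at_def in_set_conv_nth split_beta) (metis fst_conv)
  note w = next_step_wf[OF v]
  have "fst (tp (Suc t) i) p < symbols M" if "i < k" for i p
  proof -
    have "tp (Suc t) i = act (snd (next_step M (rl t)) ! i) (tp t i)"
      using that Suc w(2) by (simp add: tape_at_def cf_Suc)
    moreover have "fst (snd (next_step M (rl t)) ! i) < symbols M"
      using w(2,3) that by (metis image_subset_iff lessThan_iff nth_mem)
    ultimately show ?thesis
      using Suc that by (cases "snd (next_step M (rl t)) ! i"; cases "tp t i") auto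
  qed
  with Suc w show ?case by (simp add: cf_Suc)
qed

lemma valid_rl: "valid_rule (rl t)"
  using cf_wf[of t] by (auto simp: valid_rule_def rule_at_def scan_def tape_at_def in_set_conv_nth split_beta) (metis fst_conv)

lemma rl_simps: "fst (rl t) = fst (cf t)" "i < k \<Longrightarrow> snd (rl t) ! i = scan (tp t i)"
  using cf_wf[of t] by (auto simp: rule_at_def tape_at_def)

lemma tp_Suc: "i < k \<Longrightarrow> tp (Suc t) i = act (snd (next_step M (rl t)) ! i) (tp t i)"
  using cf_wf[of t] next_step_wf(2)[OF valid_rl] by (simp add: tape_at_def cf_Suc)

lemma halted:
  assumes "fst (cf t) = states M" "t \<le> t'"
  shows "cf t' = cf t"
  using assms(2)
proof (induction t' rule: dec_induct)
  case (step n)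
  then have "cf (Suc n) = Defs.step M (cf t)" by (simp add: config_at_def)
  also have "\<dots> = cf t" using assms(1) by (cases "cf t") simp
  finally show ?case .
qed simp

lemma pos_bound:
  assumes "i < k"
  shows "\<bar>snd (tp t i)\<bar> \<le> int t"
proof (induction t)
  case 0
  then show ?case using assms by (auto simp: tape_at_def cf_0 input_tape_def blank_tape_def nth_Cons')
next
  case (Suc t)
  obtain s d where "snd (next_step M (rl t)) ! i = (s, d)" by fastforce
  then show ?case using Suc tp_Suc[OF assms, of t] by (cases "tp t i"; cases d) auto
qed

text \<open>After halting the heads no longer move, so the bound holds at all times. It keeps the
  heads within the positions of the tableau.\<close>

lemma pos_bound_halt:
  assumes "i < k" "fst (cf T) = states M"
  shows "\<bar>snd (tp t i)\<bar> \<le> int T"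
proof (cases "t \<le> T")
  case True
  then show ?thesis using pos_bound[OF assms(1), of t] by linarith
next
  case False
  then have "cf t = cf T" by (intro halted[OF assms(2)]) simp
  then show ?thesis using pos_bound[OF assms(1), of T] by (simp add: tape_at_def)
qed

end

subsection \<open>The tableau as an exact cover problem\<close>

text \<open>A wire is used together with a time and a position. \<open>WCell i s\<close>: this cell
  of tape \<open>i\<close> holds \<open>s\<close>. \<open>WHead i\<close>: head \<open>i\<close> is
  here. \<open>WSync i r\<close>: head \<open>i\<close> is told that the transition with left-hand
  side \<open>r\<close> applies. \<open>WState s\<close>: the state is \<open>s\<close>.
  \<open>WGuess f\<close>: left of this position the certificate has not yet ended
  (\<open>f\<close>) or has ended. Wires without a natural position use position 0.\<close>

datatype wire =
    WCell nat nat
  | WHead nat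
  | WSync nat "nat \<times> nat list"
  | WState nat
  | WGuess bool

text \<open>A wire contributes both its ends. The time of a token element is not a time: it numbers
  the tokens of family \<open>\<mu>\<close>.\<close>

datatype elem = Prod wire | Cons wire | Tok nat | Trash

text \<open>\<open>IStep r\<close> selects the transition and informs every head;
  \<open>IHead i r\<close> carries it out on tape \<open>i\<close>; \<open>ICell\<close> preserves
  an unvisited cell. \<open>IBit b \<mu>\<close> guesses a certificate bit, its time component being
  the number of the token it pays with; \<open>IFree\<close> absorbs unspent tokens.
  \<open>IEnd f\<close> puts a blank, where \<open>f\<close> marks the first one after the
  certificate.\<close>

datatype item =
    IStep "nat \<times> nat list"
  | IHead nat "nat \<times> nat list"
  | ICell nat nat
  | IBit bool nat
  | IEnd bool
  | IFree nat
  | IIdle wire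

text \<open>Phrased by equality and successor in either order, which are tests the printing machine
  has.\<close>

fun moves :: "dir \<Rightarrow> nat \<Rightarrow> nat \<Rightarrow> bool" where
  "moves Left q q' \<longleftrightarrow> Suc q' = q"
| "moves Stay q q' \<longleftrightarrow> q = q'"
| "moves Right q q' \<longleftrightarrow> Suc q = q'"

lemma moves_iff: "moves d q q' \<longleftrightarrow> int q' = int q + shift d"
  by (cases d) auto

primrec produces :: "tm \<Rightarrow> item \<Rightarrow> nat \<Rightarrow> nat \<Rightarrow> wire \<Rightarrow> nat \<Rightarrow> nat \<Rightarrow> bool" where
  "produces M (IStep r) t q w t' q' = (case w of
      WSync i r' \<Rightarrow> r' = r \<and> t = t' \<and> q' = 0
    | WState s \<Rightarrow> s = fst (next_step M r) \<and> Suc t = t' \<and> q' = 0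
    | _ \<Rightarrow> False)"
| "produces M (IHead i r) t q w t' q' = (case w of
      WCell i' s \<Rightarrow> i' = i \<and> s = fst (snd (next_step M r) ! i) \<and> Suc t = t' \<and> q = q'
    | WHead i' \<Rightarrow> i' = i \<and> Suc t = t' \<and> moves (snd (snd (next_step M r) ! i)) q q'
    | _ \<Rightarrow> False)"
| "produces M (ICell i s) t q w t' q' = (case w of
      WCell i' s' \<Rightarrow> i' = i \<and> s' = s \<and> Suc t = t' \<and> q = q'
    | _ \<Rightarrow> False)"
| "produces M (IBit c \<mu>) t q w t' q' = (case w of
      WCell i s \<Rightarrow> i = 0 \<and> s = sym_of_bit c \<and> t' = 0 \<and> q = q'
    | WGuess f \<Rightarrow> f \<and> t' = 0 \<and> Suc q = q'
    | _ \<Rightarrow> False)"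
| "produces M (IEnd f) t q w t' q' = (case w of
      WCell i s \<Rightarrow> i = 0 \<and> s = 0 \<and> t' = 0 \<and> q = q'
    | WGuess f' \<Rightarrow> \<not> f' \<and> t' = 0 \<and> Suc q = q'
    | _ \<Rightarrow> False)"
| "produces M (IFree \<mu>) t q w t' q' = False"
| "produces M (IIdle w0) t q w t' q' = (w = w0 \<and> t = t' \<and> q = q')"

text \<open>A bit takes the flag \<open>True\<close> and passes it on, while both kinds of
  \<open>IEnd\<close> pass on \<open>False\<close>. From left to right this allows only bits, then
  one \<open>IEnd True\<close>, then \<open>IEnd False\<close> throughout.\<close>

primrec consumes :: "item \<Rightarrow> nat \<Rightarrow> nat \<Rightarrow> wire \<Rightarrow> nat \<Rightarrow> nat \<Rightarrow> bool" where
  "consumes (IStep r) t q w t' q' = (case w of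
      WState s \<Rightarrow> s = fst r \<and> t = t' \<and> q' = 0
    | _ \<Rightarrow> False)"
| "consumes (IHead i r) t q w t' q' = (case w of
      WCell i' s \<Rightarrow> i' = i \<and> s = snd r ! i \<and> t = t' \<and> q = q'
    | WHead i' \<Rightarrow> i' = i \<and> t = t' \<and> q = q'
    | WSync i' r' \<Rightarrow> i' = i \<and> r' = r \<and> t = t' \<and> q' = 0
    | _ \<Rightarrow> False)"
| "consumes (ICell i s) t q w t' q' = (case w of
      WCell i' s' \<Rightarrow> i' = i \<and> s' = s \<and> t = t' \<and> q = q'
    | _ \<Rightarrow> False)"
| "consumes (IBit c \<mu>) t q w t' q' = (case w of
      WGuess f \<Rightarrow> f \<and> t' = 0 \<and> q = q'
    | _ \<Rightarrow> False)"
| "consumes (IEnd f) t q w t' q' = (case w of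
      WGuess f' \<Rightarrow> f' = f \<and> t' = 0 \<and> q = q'
    | _ \<Rightarrow> False)"
| "consumes (IFree \<mu>) t q w t' q' = False"
| "consumes (IIdle w0) t q w t' q' = (w = w0 \<and> t = t' \<and> q = q')"

text \<open>Cell \<open>z\<close> of a tape is represented by the position \<open>z + origin c\<close>; the acceptance time is \<open>c\<close>.
  The idle item of the wire of the accepting output symbol is ruled out by covering \<open>Trash\<close>.\<close>

definition origin :: "nat \<Rightarrow> nat" where
  "origin c = 2 * (c + 1)"

definition guess_start :: "bool list \<Rightarrow> nat \<Rightarrow> nat" where
  "guess_start x c = 2 * (c + base x)"

primrec covers_elem :: "tm \<Rightarrow> nat \<Rightarrow> item \<Rightarrow> nat \<Rightarrow> nat \<Rightarrow> elem \<Rightarrow> nat \<Rightarrow> nat \<Rightarrow> bool" where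
  "covers_elem M c it t q (Prod w) t' q' = produces M it t q w t' q'"
| "covers_elem M c it t q (Cons w) t' q' = consumes it t q w t' q'"
| "covers_elem M c it t q (Tok \<mu>) t' q' = ((case it of IBit _ \<mu>' \<Rightarrow> \<mu>' = \<mu> | IFree \<mu>' \<Rightarrow> \<mu>' = \<mu> | _ \<Rightarrow> False) \<and> t = t' \<and> q' = 0)"
| "covers_elem M c it t q Trash t' q' = (it = IIdle (WCell (tapes M - 1) 2) \<and> t = c \<and> q = origin c)"

definition covers :: "tm \<Rightarrow> nat \<Rightarrow> item \<times> nat \<times> nat \<Rightarrow> elem \<times> nat \<times> nat \<Rightarrow> bool" where
  "covers M c = (\<lambda>(it, t, q) (el, t', q'). covers_elem M c it t q el t' q')"

text \<open>The fixed part of the initial input tape. With \<open>v = q div 2 - c\<close>, both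
  cells of the pair \<open>v\<close> hold the symbol of ruler cell \<open>v\<close>; the pair
  \<open>v = length x + 1\<close> is the separator 01, and the certificate starts after it, at
  \<open>guess_start\<close>.\<close>

definition init_sym :: "bool list \<Rightarrow> nat \<Rightarrow> nat \<Rightarrow> nat" where
  "init_sym x c q = (if q < origin c then 0 else if q div 2 - c \<le> length x then ruler x (int (q div 2 - c))
    else if even q then 1 else 2)"

primrec free :: "bool list \<Rightarrow> nat \<Rightarrow> wire \<Rightarrow> nat \<Rightarrow> nat \<Rightarrow> bool" where
  "free x c (WCell i s) t q \<longleftrightarrow> t \<noteq> 0 \<or> i = 0 \<and> guess_start x c \<le> q"
| "free x c (WHead i) t q \<longleftrightarrow> t \<noteq> 0"
| "free x c (WSync i r) t q \<longleftrightarrow> q = 0"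
| "free x c (WState s) t q \<longleftrightarrow> q = 0 \<and> t \<noteq> 0"
| "free x c (WGuess f) t q \<longleftrightarrow> t = 0 \<and> guess_start x c < q"

primrec given :: "bool list \<Rightarrow> nat \<Rightarrow> wire \<Rightarrow> nat \<Rightarrow> nat \<Rightarrow> bool" where
  "given x c (WCell i s) t q \<longleftrightarrow> t = 0 \<and> (if i = 0 then q < guess_start x c \<and> s = init_sym x c q else s = 0)"
| "given x c (WHead i) t q \<longleftrightarrow> t = 0 \<and> q = origin c"
| "given x c (WSync i r) t q \<longleftrightarrow> False"
| "given x c (WState s) t q \<longleftrightarrow> t = 0 \<and> q = 0 \<and> s = 0"
| "given x c (WGuess f) t q \<longleftrightarrow> t = 0 \<and> q = guess_start x c \<and> f"

primrec needed_elem :: "bool list \<Rightarrow> nat \<Rightarrow> (nat \<Rightarrow> nat \<Rightarrow> bool) \<Rightarrow> elem \<Rightarrow> nat \<Rightarrow> nat \<Rightarrow> bool" where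
  "needed_elem x c tok (Prod w) t q = free x c w t q"
| "needed_elem x c tok (Cons w) t q = (free x c w t q \<or> given x c w t q)"
| "needed_elem x c tok (Tok \<mu>) t q = (q = 0 \<and> tok \<mu> t)"
| "needed_elem x c tok Trash t q = False"

definition needed :: "bool list \<Rightarrow> nat \<Rightarrow> (nat \<Rightarrow> nat \<Rightarrow> bool) \<Rightarrow> elem \<times> nat \<times> nat \<Rightarrow> bool" where
  "needed x c tok = (\<lambda>(el, t, q). needed_elem x c tok el t q)"

definition rules :: "tm \<Rightarrow> (nat \<times> nat list) list" where
  "rules M = List.product [0..<Suc (states M)] (List.n_lists (tapes M) [0..<symbols M])"

definition wires :: "tm \<Rightarrow> wire list" where
  "wires M = concat (map (\<lambda>i. map (WCell i) [0..<symbols M]) [0..<tapes M]) @ map WHead [0..<tapes M] @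
    concat (map (\<lambda>i. map (WSync i) (rules M)) [0..<tapes M]) @ map WState [0..<Suc (states M)] @ [WGuess True, WGuess False]"

text \<open>Distinctness, which the passage to stars requires, is enforced by
  \<open>remdups\<close>.\<close>

definition items :: "tm \<Rightarrow> nat \<Rightarrow> item list" where
  "items M u = remdups (map IStep (rules M) @ concat (map (\<lambda>i. map (IHead i) (rules M)) [0..<tapes M]) @
    concat (map (\<lambda>i. map (ICell i) [0..<symbols M]) [0..<tapes M]) @
    map (IBit True) [0..<u] @ map (IBit False) [0..<u] @ [IEnd True, IEnd False] @ map IFree [0..<u] @ map IIdle (wires M))"

definition elems :: "tm \<Rightarrow> nat \<Rightarrow> elem list" where
  "elems M u = map Prod (wires M) @ map Cons (wires M) @ map Tok [0..<u] @ [Trash]"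

lemma set_rules: "r \<in> set (rules M) \<longleftrightarrow> fst r \<le> states M \<and> length (snd r) = tapes M \<and> set (snd r) \<subseteq> {..<symbols M}"
  by (cases r) (auto simp: rules_def set_n_lists lessThan_atLeast0)

lemma wires_iff [simp]:
  "WCell i s \<in> set (wires M) \<longleftrightarrow> i < tapes M \<and> s < symbols M"
  "WHead i \<in> set (wires M) \<longleftrightarrow> i < tapes M"
  "WSync i r \<in> set (wires M) \<longleftrightarrow> i < tapes M \<and> r \<in> set (rules M)"
  "WState s \<in> set (wires M) \<longleftrightarrow> s \<le> states M"
  "WGuess f \<in> set (wires M)"
  by (simp_all add: wires_def image_iff less_Suc_eq_le del: upt_Suc)

lemma items_iff [simp]:
  "IStep r \<in> set (items M u) \<longleftrightarrow> r \<in> set (rules M)"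
  "IHead i r \<in> set (items M u) \<longleftrightarrow> i < tapes M \<and> r \<in> set (rules M)"
  "ICell i s \<in> set (items M u) \<longleftrightarrow> i < tapes M \<and> s < symbols M"
  "IBit c \<mu> \<in> set (items M u) \<longleftrightarrow> \<mu> < u"
  "IEnd f \<in> set (items M u)"
  "IFree \<mu> \<in> set (items M u) \<longleftrightarrow> \<mu> < u"
  "IIdle w \<in> set (items M u) \<longleftrightarrow> w \<in> set (wires M)"
  by (simp_all add: items_def image_iff) auto

lemma elems_iff [simp]:
  "Prod w \<in> set (elems M u) \<longleftrightarrow> w \<in> set (wires M)"
  "Cons w \<in> set (elems M u) \<longleftrightarrow> w \<in> set (wires M)"
  "Tok \<mu> \<in> set (elems M u) \<longleftrightarrow> \<mu> < u"
  "Trash \<in> set (elems M u)"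
  by (simp_all add: elems_def image_iff)

lemma card_eq_of_boolI:
  assumes "b \<Longrightarrow> \<exists>a. S = {a}" "\<not> b \<Longrightarrow> S = {}"
  shows "card S = of_bool b"
  using assms by (cases b) auto

lemma nth_concat_double: "j < 2 * length x \<Longrightarrow> concat (map (\<lambda>b. [b, b]) x) ! j = x ! (j div 2)"
proof (induction x arbitrary: j)
  case (Cons b x)
  show ?case
  proof (cases "j < 2")
    case True
    then have "j = 0 \<or> j = 1" by auto
    then show ?thesis by auto
  next
    case False
    then obtain j' where j: "j = Suc (Suc j')" by (metis add_2_eq_Suc le_Suc_ex not_less)
    then show ?thesis using Cons by simp
  qed
qed simp

lemma length_concat_double [simp]: "length (concat (map (\<lambda>b. [b, b]) x)) = 2 * length x"
  by (induction x) auto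

lemma strf_pair_prefix:
  assumes "q < guess_start x c"
  shows "strf (pair_str x y) (int q - int (origin c)) = init_sym x c q"
proof (cases "q < origin c")
  case True
  then show ?thesis by (auto simp: init_sym_def strf_eq_0)
next
  case False
  define j where "j = q - origin c"
  have j: "int q - int (origin c) = int j" "q = origin c + j" using False by (auto simp: j_def)
  have jl: "j < 2 * length x + 2" using assms j by (auto simp: guess_start_def origin_def base_def)
  have qd: "q div 2 - c = Suc (j div 2)" "even q = even j" using j by (auto simp: origin_def)
  show ?thesis
  proof (cases "j < 2 * length x")
    case True
    then have "strf (pair_str x y) (int j) = sym_of_bit (x ! (j div 2))"
      by (subst strf_nth) (auto simp: pair_str_def nth_append nth_concat_double)
    moreover have "j div 2 < length x" using True by auto
    ultimately show ?thesis using False j qd by (auto simp: init_sym_def ruler_def)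
  next
    case nl: False
    then have jj: "j = 2 * length x \<or> j = Suc (2 * length x)" using jl by auto
    have "strf (pair_str x y) (int j) = sym_of_bit (pair_str x y ! j)"
      using jl by (intro strf_nth) (simp add: pair_str_def)
    also have "\<dots> = (if even j then 1 else 2)"
      using jj by (auto simp: pair_str_def nth_append sym_of_bit_def)
    finally show ?thesis
      using False j qd nl by (auto simp: init_sym_def)
  qed
qed

lemma strf_pair_suffix:
  "strf (pair_str x y) (int (guess_start x c + j) - int (origin c)) = (if j < length y then sym_of_bit (y ! j) else 0)"
proof -
  have e: "int (guess_start x c + j) - int (origin c) = int (2 * length x + 2 + j)"
    by (simp add: guess_start_def origin_def base_def)
  show ?thesis
  proof (cases "j < length y")
    case True
    then show ?thesis unfolding e by (subst strf_nth) (auto simp: pair_str_def nth_append)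
  next
    case False
    then show ?thesis unfolding e by (auto simp: strf_eq_0 pair_str_def simp del: of_nat_add of_nat_mult)
  qed
qed

section \<open>How non-idle items act on each kind of wire\<close>

primrec guess_item :: "item \<Rightarrow> bool" where
  "guess_item (IStep r) = False"
| "guess_item (IHead i r) = False"
| "guess_item (ICell i s) = False"
| "guess_item (IBit b \<mu>) = True"
| "guess_item (IEnd f) = True"
| "guess_item (IFree \<mu>) = False"
| "guess_item (IIdle w) = False"

definition is_bit :: "item \<Rightarrow> bool" where
  "is_bit it = (case it of IBit b \<mu> \<Rightarrow> True | _ \<Rightarrow> False)"

definition guess_in :: "item \<Rightarrow> bool" where
  "guess_in it = (case it of IEnd f \<Rightarrow> f | _ \<Rightarrow> True)"

definition guess_sym :: "item \<Rightarrow> nat" where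
  "guess_sym it = (case it of IBit b \<mu> \<Rightarrow> sym_of_bit b | _ \<Rightarrow> 0)"

definition busy :: "item \<Rightarrow> bool" where
  "busy it \<longleftrightarrow> (\<forall>w. it \<noteq> IIdle w)"

lemma busy_simps [simp]: "busy (IStep r)" "busy (IHead i r)" "busy (ICell i s)" "busy (IBit b \<mu>)" "busy (IEnd f)"
  "\<not> busy (IIdle w)"
  by (auto simp: busy_def)

lemma consumes_WGuess: "busy it \<Longrightarrow> consumes it t q (WGuess f) t' q' \<longleftrightarrow> guess_item it \<and> f = guess_in it \<and> t' = 0 \<and> q = q'"
  by (cases it) (auto simp: guess_in_def busy_def)

lemma produces_WGuess: "busy it \<Longrightarrow> produces M it t q (WGuess f) t' q' \<longleftrightarrow> guess_item it \<and> f = is_bit it \<and> t' = 0 \<and> Suc q = q'"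
  by (cases it) (auto simp: is_bit_def busy_def)

lemma produces_WCell_0: "busy it \<Longrightarrow> produces M it t q (WCell 0 s) 0 q' \<longleftrightarrow> guess_item it \<and> s = guess_sym it \<and> q = q'"
  by (cases it) (auto simp: guess_sym_def busy_def)

lemma consumes_WState: "busy it \<Longrightarrow> consumes it t q (WState s) t' q' \<longleftrightarrow> (\<exists>r. it = IStep r \<and> s = fst r) \<and> t = t' \<and> q' = 0"
  by (cases it) (auto simp: busy_def)

lemma produces_WState: "busy it \<Longrightarrow> produces M it t q (WState s) t' q' \<longleftrightarrow>
    (\<exists>r. it = IStep r \<and> s = fst (next_step M r)) \<and> Suc t = t' \<and> q' = 0"
  by (cases it) (auto simp: busy_def)

lemma consumes_WSync: "busy it \<Longrightarrow> consumes it t q (WSync i r) t' q' \<longleftrightarrow> it = IHead i r \<and> t = t' \<and> q' = 0"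
  by (cases it) (auto simp: busy_def)

lemma produces_WSync: "busy it \<Longrightarrow> produces M it t q (WSync i r) t' q' \<longleftrightarrow> it = IStep r \<and> t = t' \<and> q' = 0"
  by (cases it) (auto simp: busy_def)

lemma produces_WHead: "busy it \<Longrightarrow> produces M it t q (WHead i) t' q' \<longleftrightarrow>
    (\<exists>r. it = IHead i r \<and> moves (snd (snd (next_step M r) ! i)) q q') \<and> Suc t = t'"
  by (cases it) (auto simp: busy_def)

lemma consumes_WCell: "busy it \<Longrightarrow> consumes it t q (WCell i s) t' q' \<longleftrightarrow>
    ((\<exists>r. it = IHead i r \<and> s = snd r ! i) \<or> it = ICell i s) \<and> t = t' \<and> q = q'"
  by (cases it) (auto simp: busy_def)

lemma produces_WCell_Suc: "busy it \<Longrightarrow> produces M it t q (WCell i s) (Suc t') q' \<longleftrightarrow>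
    ((\<exists>r. it = IHead i r \<and> s = fst (snd (next_step M r) ! i)) \<or> it = ICell i s) \<and> t = t' \<and> q = q'"
  by (cases it) (auto simp: busy_def)

text \<open>\<open>L\<close> bounds the certificate and is the number of tokens, \<open>T0\<close>
  bounds the running time, and \<open>D\<close> limits times and half the positions. The number
  \<open>c\<close> is both the acceptance time and, up to the factor 2, the room left of the input;
  its size keeps heads and certificate within range and the run halted by time
  \<open>c\<close>.\<close>

locale tableau =
  fixes M :: tm and x :: "bool list" and L D c T0 u :: nat and tok :: "nat \<Rightarrow> nat \<Rightarrow> bool"
  assumes wf: "wf_tm M"
    and halts: "length y \<le> L \<Longrightarrow> \<exists>t\<le>T0. fst (config_at M (pair_str x y) t) = states M"
    and c_large: "2 * base x + L + T0 + 4 \<le> c" and D_large: "2 * c \<le> D"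
    and tokens: "card {(\<mu>, j). \<mu> < u \<and> j < D \<and> tok \<mu> j} = L"
begin

abbreviation "Is \<equiv> grid (items M u) D"
abbreviation "Es \<equiv> grid (elems M u) D"
abbreviation "ys \<equiv> guess_start x c"
abbreviation "cell y t i q \<equiv> fst (tape_at M (pair_str x y) t i) (int q - int (origin c))"
abbreviation "hd_pos y t i \<equiv> snd (tape_at M (pair_str x y) t i) + int (origin c)"

definition accepts :: "bool list \<Rightarrow> bool" where
  "accepts y \<longleftrightarrow> fst (tape_at M (pair_str x y) c (tapes M - 1)) 0 = 2"

lemma D_bounds: "0 < D" "0 < c" "c < D" "origin c < 2 * D" "ys < 2 * D" "ys + L < 2 * D"
  using c_large D_large by (auto simp: origin_def guess_start_def base_def)

lemma cell_0:
  assumes "i < tapes M" "q < 2 * D"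
  shows "cell y 0 i q = (if i = 0 then if q < ys then init_sym x c q
    else if q - ys < length y then sym_of_bit (y ! (q - ys)) else 0 else 0)"
proof -
  interpret verifier M "pair_str x y" using wf by unfold_locales
  have "tape_at M (pair_str x y) 0 i = (if i = 0 then input_tape (pair_str x y) else blank_tape)"
    using assms(1) by (auto simp: tape_at_def cf_0 nth_Cons')
  then show ?thesis
    using strf_pair_prefix[of q x c y] strf_pair_suffix[of x y c "q - ys"]
    by (auto simp: input_tape_eq blank_tape_def)
qed

lemma hd_pos_0: "i < tapes M \<Longrightarrow> hd_pos y 0 i = int (origin c)"
proof -
  interpret verifier M "pair_str x y" using wf by unfold_locales
  assume "i < tapes M"
  then show ?thesis by (auto simp: tape_at_def cf_0 nth_Cons' input_tape_def blank_tape_def)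
qed

lemma cell_Suc:
  assumes "i < tapes M"
  shows "cell y (Suc t) i q = (if int q = hd_pos y t i
    then fst (snd (next_step M (rule_at M (pair_str x y) t)) ! i) else cell y t i q)"
proof -
  interpret verifier M "pair_str x y" using wf by unfold_locales
  show ?thesis
    using tp_Suc[OF assms, of t]
    by (cases "snd (next_step M (rule_at M (pair_str x y) t)) ! i"; cases "tape_at M (pair_str x y) t i") auto
qed

lemma hd_pos_Suc:
  assumes "i < tapes M"
  shows "hd_pos y (Suc t) i = hd_pos y t i + shift (snd (snd (next_step M (rule_at M (pair_str x y) t)) ! i))"
proof -
  interpret verifier M "pair_str x y" using wf by unfold_locales
  show ?thesis
    using tp_Suc[OF assms, of t]
    by (cases "snd (next_step M (rule_at M (pair_str x y) t)) ! i"; cases "tape_at M (pair_str x y) t i") auto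
qed

lemma scan_cell:
  assumes "i < tapes M" "int q = hd_pos y t i"
  shows "snd (rule_at M (pair_str x y) t) ! i = cell y t i q"
proof -
  interpret verifier M "pair_str x y" using wf by unfold_locales
  show ?thesis using rl_simps(2)[OF assms(1)] assms(2) by (simp add: scan_def)
qed

subsection \<open>A cover yields an accepted certificate\<close>

context
  fixes A
  assumes A: "A \<subseteq> set Is"
    and exact: "\<And>e. e \<in> set Es \<Longrightarrow> card {i \<in> A. covers M c i e} = of_bool (needed x c tok e)"
begin

lemma A_wf: "(it, t, q) \<in> A \<Longrightarrow> it \<in> set (items M u) \<and> t < D \<and> q < 2 * D"
  using A by (auto simp: set_grid)

lemma cover_unique:
  assumes "el \<in> set (elems M u)" "t < D" "q < 2 * D" "a \<in> A" "covers M c a (el, t, q)"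
  shows "needed_elem x c tok el t q" "b \<in> A \<Longrightarrow> covers M c b (el, t, q) \<Longrightarrow> b = a"
proof -
  let ?S = "{i \<in> A. covers M c i (el, t, q)}"
  have fin: "finite ?S" using A finite_subset by fastforce
  have card: "card ?S = of_bool (needed x c tok (el, t, q))"
    using assms(1-3) by (intro exact) (simp add: set_grid)
  have a: "a \<in> ?S" using assms by simp
  then have "card ?S \<noteq> 0" using fin by (metis card_eq_0_iff empty_iff)
  then show "needed_elem x c tok el t q" using card by (auto simp: needed_def)
  then have "card ?S = 1" using card by (simp add: needed_def)
  then show "b = a" if "b \<in> A" "covers M c b (el, t, q)"
    using a that by (metis (mono_tags, lifting) card_1_singletonE mem_Collect_eq singletonD)
qed

lemma cover_exists:
  assumes "el \<in> set (elems M u)" "t < D" "q < 2 * D" "needed_elem x c tok el t q"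
  obtains it t' q' where "(it, t', q') \<in> A" "covers_elem M c it t' q' el t q"
proof -
  have "card {i \<in> A. covers M c i (el, t, q)} = of_bool (needed x c tok (el, t, q))"
    using assms(1-3) by (intro exact) (simp add: set_grid)
  then have "card {i \<in> A. covers M c i (el, t, q)} = 1" using assms(4) by (simp add: needed_def)
  then have "{i \<in> A. covers M c i (el, t, q)} \<noteq> {}" by (metis card.empty zero_neq_one)
  then show ?thesis using that by (auto simp: covers_def)
qed

definition consumed :: "wire \<Rightarrow> nat \<Rightarrow> nat \<Rightarrow> bool" where
  "consumed w t q \<longleftrightarrow> (\<exists>it t' q'. (it, t', q') \<in> A \<and> busy it \<and> consumes it t' q' w t q)"

definition produced :: "wire \<Rightarrow> nat \<Rightarrow> nat \<Rightarrow> bool" where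
  "produced w t q \<longleftrightarrow> (\<exists>it t' q'. (it, t', q') \<in> A \<and> busy it \<and> produces M it t' q' w t q)"

lemma consumer_unique:
  assumes "w \<in> set (wires M)" "t < D" "q < 2 * D" "(it, t1, q1) \<in> A" "consumes it t1 q1 w t q"
    "(it', t2, q2) \<in> A" "consumes it' t2 q2 w t q"
  shows "it' = it \<and> t2 = t1 \<and> q2 = q1"
  using cover_unique(2)[of "Cons w" t q "(it, t1, q1)" "(it', t2, q2)"] assms by (simp add: covers_def)

text \<open>If the idle item of a free wire is chosen, it takes both ends and excludes every other
  item there; if not, both ends are taken by busy items. On a wire that is not free the idle item is
  impossible, because it would cover a producing end that must stay uncovered.\<close>

lemma consumed_iff:
  assumes w: "w \<in> set (wires M)" "t < D" "q < 2 * D"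
  shows "consumed w t q \<longleftrightarrow> (if free x c w t q then produced w t q else given x c w t q)"
proof -
  let ?a = "(IIdle w, t, q)"
  have cc: "covers M c ?a (Cons w, t, q)" "covers M c ?a (Prod w, t, q)" by (auto simp: covers_def)
  have idle: "it = IIdle w \<and> t' = t \<and> q' = q" if "\<not> busy it" "consumes it t' q' w t q \<or> produces M it t' q' w t q" for it t' q'
    using that by (auto simp: busy_def)
  show ?thesis
  proof (cases "free x c w t q")
    case True
    show ?thesis
    proof (cases "?a \<in> A")
      case a: True
      have "\<not> busy it" if "(it, t', q') \<in> A" "consumes it t' q' w t q" for it t' q'
        using cover_unique(2)[of "Cons w" t q ?a "(it, t', q')"] w a that cc by (simp add: covers_def)
      moreover have "\<not> busy it" if "(it, t', q') \<in> A" "produces M it t' q' w t q" for it t' q'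
        using cover_unique(2)[of "Prod w" t q ?a "(it, t', q')"] w a that cc by (simp add: covers_def)
      ultimately have "\<not> consumed w t q" "\<not> produced w t q"
        by (auto simp: consumed_def produced_def)
      then show ?thesis using True by simp
    next
      case a: False
      obtain it t' q' where 1: "(it, t', q') \<in> A" "consumes it t' q' w t q"
        using cover_exists[of "Cons w" t q] w True by auto
      obtain it2 t2 q2 where 2: "(it2, t2, q2) \<in> A" "produces M it2 t2 q2 w t q"
        using cover_exists[of "Prod w" t q] w True by auto
      have "busy it" "busy it2" using idle 1 2 a by blast+
      then have "consumed w t q" "produced w t q"
        using 1 2 by (auto simp: consumed_def produced_def)
      then show ?thesis using True by simp
    qed
  next
    case False
    have na: "?a \<notin> A" using cover_unique(1)[of "Prod w" t q ?a] w cc False by auto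
    show ?thesis
    proof
      assume "consumed w t q"
      then obtain it t' q' where "(it, t', q') \<in> A" "consumes it t' q' w t q" by (auto simp: consumed_def)
      then have "needed_elem x c tok (Cons w) t q"
        using cover_unique(1)[of "Cons w" t q "(it, t', q')"] w by (simp add: covers_def)
      then show "if free x c w t q then produced w t q else given x c w t q" using False by simp
    next
      assume "if free x c w t q then produced w t q else given x c w t q"
      then have "needed_elem x c tok (Cons w) t q" using False by simp
      then obtain it t' q' where 1: "(it, t', q') \<in> A" "consumes it t' q' w t q"
        using cover_exists[of "Cons w" t q] w by auto
      then have "busy it" using idle na by blast
      with 1 show "consumed w t q" by (auto simp: consumed_def)
    qed
  qed
qed

definition guess_at :: "nat \<Rightarrow> item \<Rightarrow> nat \<Rightarrow> bool" where
  "guess_at q it t \<longleftrightarrow> (it, t, q) \<in> A \<and> guess_item it"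

lemma guess_busy: "guess_item it \<Longrightarrow> busy it"
  by (cases it) auto

lemma consumed_WGuess: "consumed (WGuess f) 0 q \<longleftrightarrow> (\<exists>it t. guess_at q it t \<and> f = guess_in it)"
  unfolding consumed_def guess_at_def by (simp add: consumes_WGuess cong: conj_cong) (blast dest: guess_busy)

lemma produced_WGuess: "produced (WGuess f) 0 (Suc q) \<longleftrightarrow> (\<exists>it t. guess_at q it t \<and> f = is_bit it)"
  unfolding produced_def guess_at_def by (simp add: produces_WGuess cong: conj_cong) (blast dest: guess_busy)

lemma produced_WCell_guess: "produced (WCell 0 s) 0 q \<longleftrightarrow> (\<exists>it t. guess_at q it t \<and> s = guess_sym it)"
  unfolding produced_def guess_at_def by (simp add: produces_WCell_0 cong: conj_cong) (blast dest: guess_busy)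

lemma guess_same:
  assumes "guess_at q it t" "guess_at q it' t'" "guess_in it = guess_in it'" "q < 2 * D"
  shows "it' = it" "t' = t"
proof -
  have "consumes it t q (WGuess (guess_in it)) 0 q" "consumes it' t' q (WGuess (guess_in it)) 0 q"
    using assms consumes_WGuess guess_busy by (auto simp: guess_at_def)
  then show "it' = it" "t' = t"
    using consumer_unique[of "WGuess (guess_in it)" 0 q it t q it' t' q] assms D_bounds by (auto simp: guess_at_def)
qed

text \<open>Exactly one guess item sits at each position, by induction from left to right. The flag
  \<open>True\<close> is given at the first position, and the unique item at one position produces
  the single flag that enters the next.\<close>

lemma guess_ex1:
  assumes "ys \<le> q" "q < 2 * D"
  shows "\<exists>it t. guess_at q it t \<and> (\<forall>it' t'. guess_at q it' t' \<longrightarrow> it' = it \<and> t' = t)"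
  using assms
proof (induction q rule: dec_induct)
  case base
  have c: "consumed (WGuess f) 0 ys \<longleftrightarrow> f" for f
    using consumed_iff[of "WGuess f" 0 ys] base D_bounds by simp
  then obtain it t where i: "guess_at ys it t" using consumed_WGuess by blast
  have "guess_in it'" if "guess_at ys it' t'" for it' t' using c consumed_WGuess that by blast
  then have "guess_in it = guess_in it'" if "guess_at ys it' t'" for it' t' using that i by blast
  then show ?case using i guess_same[OF i] base by blast
next
  case (step q)
  then obtain it t where i: "guess_at q it t" "\<And>it' t'. guess_at q it' t' \<Longrightarrow> it' = it \<and> t' = t"
    by force
  have c: "consumed (WGuess f) 0 (Suc q) \<longleftrightarrow> f = is_bit it" for f
  proof -
    have "produced (WGuess f) 0 (Suc q) \<longleftrightarrow> f = is_bit it"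
      unfolding produced_WGuess using i by blast
    then show ?thesis
      using consumed_iff[of "WGuess f" 0 "Suc q"] step.hyps step.prems D_bounds by simp
  qed
  then obtain it' t' where i': "guess_at (Suc q) it' t'" using consumed_WGuess by blast
  have "guess_in it' = is_bit it" if "guess_at (Suc q) it' t'" for it' t' using c consumed_WGuess that by blast
  then have "guess_in it' = guess_in it2" if "guess_at (Suc q) it2 t2" for it2 t2 using that i' by blast
  then show ?case using i' guess_same[OF i'] step.prems by blast
qed

text \<open>The bits form an initial run, since a bit needs the flag \<open>True\<close> from its
  left neighbour and only a bit passes it on. Distinct bits pay with distinct tokens, so the run has
  length at most \<open>L\<close>.\<close>

lemma certificate:
  obtains y where "length y \<le> L"
    "\<And>q s. ys \<le> q \<Longrightarrow> q < 2 * D \<Longrightarrow> s < symbols M \<Longrightarrow> consumed (WCell 0 s) 0 q \<longleftrightarrow>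
      s = (if q - ys < length y then sym_of_bit (y ! (q - ys)) else 0)"
proof -
  obtain gi gt where g: "\<And>q. ys \<le> q \<Longrightarrow> q < 2 * D \<Longrightarrow> guess_at q (gi q) (gt q)"
    "\<And>q it' t'. ys \<le> q \<Longrightarrow> q < 2 * D \<Longrightarrow> guess_at q it' t' \<Longrightarrow> it' = gi q \<and> t' = gt q"
    using guess_ex1 by metis
  have k0: "0 < tapes M" using wf by (auto simp: wf_tm_def)
  have cell: "consumed (WCell 0 s) 0 q \<longleftrightarrow> s = guess_sym (gi q)" if "ys \<le> q" "q < 2 * D" "s < symbols M" for q s
  proof -
    have "produced (WCell 0 s) 0 q \<longleftrightarrow> s = guess_sym (gi q)"
      unfolding produced_WCell_guess using g(1)[OF that(1,2)] g(2)[OF that(1,2)] by blast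
    then show ?thesis using consumed_iff[of "WCell 0 s" 0 q] that D_bounds k0 by simp
  qed
  have down: "is_bit (gi q)" if "is_bit (gi (Suc q))" "ys \<le> q" "Suc q < 2 * D" for q
  proof -
    have "guess_in (gi (Suc q))" using that(1) by (cases "gi (Suc q)") (auto simp: is_bit_def guess_in_def)
    then have "consumed (WGuess True) 0 (Suc q)" using g(1)[of "Suc q"] that consumed_WGuess[of True "Suc q"] by auto
    then have "produced (WGuess True) 0 (Suc q)"
      using consumed_iff[of "WGuess True" 0 "Suc q"] that D_bounds by simp
    then show ?thesis using produced_WGuess[of True q] g(2)[of q] that by auto
  qed
  \<comment> \<open>The alternative \<open>ys + j >= 2 * D\<close> ensures that the least number
    exists even if every position in range were a bit.\<close>
  define l where "l = (LEAST j. ys + j \<ge> 2 * D \<or> \<not> is_bit (gi (ys + j)))"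
  have ex: "ys + (2 * D - ys) \<ge> 2 * D \<or> \<not> is_bit (gi (ys + (2 * D - ys)))" using D_bounds by simp
  have l1: "ys + l \<ge> 2 * D \<or> \<not> is_bit (gi (ys + l))"
    unfolding l_def by (rule LeastI[where P = "\<lambda>j. ys + j \<ge> 2 * D \<or> \<not> is_bit (gi (ys + j))", OF ex])
  have l2: "ys + j < 2 * D \<and> is_bit (gi (ys + j))" if "j < l" for j
    using not_less_Least[OF that[unfolded l_def]] by auto
  have l3: "\<not> is_bit (gi (ys + j))" if "l \<le> j" "ys + j < 2 * D" for j
    using that
  proof (induction j rule: dec_induct)
    case base
    then show ?case using l1 by auto
  next
    case (step j)
    then show ?case using down[of "ys + j"] by auto
  qed
  \<comment> \<open>The token paid for bit \<open>j\<close>, that is, family and number; the default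
    is not met for \<open>j < l\<close>.\<close>
  define tk where "tk j = (case gi (ys + j) of IBit b \<mu> \<Rightarrow> (\<mu>, gt (ys + j)) | _ \<Rightarrow> (0, 0))" for j
  have tk: "\<exists>b. (IBit b (fst (tk j)), snd (tk j), ys + j) \<in> A" if "j < l" for j
    using l2[OF that] g(1)[of "ys + j"] by (cases "gi (ys + j)") (auto simp: tk_def is_bit_def guess_at_def)
  let ?T = "{(\<mu>, j). \<mu> < u \<and> j < D \<and> tok \<mu> j}"
  have "l \<le> card ?T"
  proof -
    have tok: "tk j \<in> ?T" if j: "j < l" for j
    proof -
      obtain b where b: "(IBit b (fst (tk j)), snd (tk j), ys + j) \<in> A" using tk[OF j] by blast
      have r: "fst (tk j) < u" "snd (tk j) < D" using A_wf[OF b] by auto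
      have "tok (fst (tk j)) (snd (tk j))"
        using cover_unique(1)[of "Tok (fst (tk j))" "snd (tk j)" 0, OF _ _ _ b] r D_bounds by (simp add: covers_def)
      with r show ?thesis by (auto simp: case_prod_beta)
    qed
    have "inj_on tk {..<l}"
    proof (rule inj_onI)
      fix j j' assume jj: "j \<in> {..<l}" "j' \<in> {..<l}" "tk j = tk j'"
      obtain b b' where b: "(IBit b (fst (tk j)), snd (tk j), ys + j) \<in> A"
        "(IBit b' (fst (tk j)), snd (tk j), ys + j') \<in> A" using tk[of j] tk[of j'] jj by auto
      have r: "fst (tk j) < u" "snd (tk j) < D" using A_wf[OF b(1)] by auto
      show "j = j'"
        using cover_unique(2)[of "Tok (fst (tk j))" "snd (tk j)" 0, OF _ _ _ b(1) _ b(2)] r D_bounds by (simp add: covers_def)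
    qed
    then have "card (tk ` {..<l}) = l" by (simp add: card_image)
    moreover have "finite ?T" by (rule finite_subset[of _ "{..<u} \<times> {..<D}"]) auto
    then have "card (tk ` {..<l}) \<le> card ?T" by (rule card_mono, intro image_subsetI tok) simp
    ultimately show ?thesis by simp
  qed
  then have lL: "l \<le> L" using tokens by simp
  define y where "y = map (\<lambda>j. guess_sym (gi (ys + j)) = 2) [0..<l]"
  have ly: "length y = l" by (simp add: y_def)
  have sym: "guess_sym (gi q) = (if q - ys < length y then sym_of_bit (y ! (q - ys)) else 0)" if "ys \<le> q" "q < 2 * D" for q
  proof (cases "q - ys < l")
    case True
    have "is_bit (gi q)" using l2[OF True] that by simp
    then show ?thesis using True that by (cases "gi q") (auto simp: y_def is_bit_def guess_sym_def)
  next
    case False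
    then have "\<not> is_bit (gi q)" using l3[of "q - ys"] that by simp
    then show ?thesis using False ly by (cases "gi q") (auto simp: is_bit_def guess_sym_def)
  qed
  show ?thesis by (rule that[of y]) (use lL ly cell sym in auto)
qed

text \<open>By induction on time, the consumed wires are those of the real configuration on the
  certificate read off above. The state wire only fixes the state of the selected transition; the
  sync wires force every head to use it, and the cell wires then force its symbols to be the scanned
  ones.\<close>

lemma cover_sound: "\<exists>y. length y \<le> L \<and> accepts y"
proof -
  obtain y where y: "length y \<le> L" "\<And>q s. ys \<le> q \<Longrightarrow> q < 2 * D \<Longrightarrow> s < symbols M \<Longrightarrow> consumed (WCell 0 s) 0 q \<longleftrightarrow>
      s = (if q - ys < length y then sym_of_bit (y ! (q - ys)) else 0)"
    using certificate by blast
  interpret verifier M "pair_str x y" using wf by unfold_locales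
  let ?r = "rule_at M (pair_str x y)"
  define inv where "inv t \<longleftrightarrow>
    (\<forall>i<tapes M. \<forall>q<2 * D. \<forall>s<symbols M. consumed (WCell i s) t q \<longleftrightarrow> cell y t i q = s) \<and>
    (\<forall>i<tapes M. \<forall>q<2 * D. consumed (WHead i) t q \<longleftrightarrow> int q = hd_pos y t i) \<and>
    (\<forall>s\<le>states M. consumed (WState s) t 0 \<longleftrightarrow> s = fst (?r t))" for t
  have "inv t" if "t < D" for t
    using that
  proof (induction t)
    case 0
    have "consumed (WCell i s) 0 q \<longleftrightarrow> cell y 0 i q = s" if "i < tapes M" "q < 2 * D" "s < symbols M" for i q s
    proof (cases "i = 0 \<and> ys \<le> q")
      case True
      then show ?thesis using y(2)[of q s] cell_0[of i q y] that by auto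
    next
      case False
      then show ?thesis using consumed_iff[of "WCell i s" 0 q] cell_0[of i q y] that D_bounds by auto
    qed
    moreover have "consumed (WHead i) 0 q \<longleftrightarrow> int q = hd_pos y 0 i" if "i < tapes M" "q < 2 * D" for i q
      using consumed_iff[of "WHead i" 0 q] hd_pos_0[of i y] that D_bounds by auto
    moreover have "consumed (WState s) 0 0 \<longleftrightarrow> s = fst (?r 0)" if "s \<le> states M" for s
      using consumed_iff[of "WState s" 0 0] that D_bounds by (auto simp: rule_at_def cf_0)
    ultimately show ?case by (simp add: inv_def)
  next
    case (Suc t)
    then have I: "inv t" and tD: "t < D" by simp_all
    have D2: "0 < 2 * D" using D_bounds by simp
    have Ic: "consumed (WCell i s) t q \<longleftrightarrow> cell y t i q = s" if "i < tapes M" "q < 2 * D" "s < symbols M" for i q s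
      using I that by (simp add: inv_def)
    have Ih: "consumed (WHead i) t q \<longleftrightarrow> int q = hd_pos y t i" if "i < tapes M" "q < 2 * D" for i q
      using I that by (simp add: inv_def)
    have Is: "consumed (WState s) t 0 \<longleftrightarrow> s = fst (?r t)" if "s \<le> states M" for s
      using I that by (simp add: inv_def)
    have rs: "fst r \<le> states M" "r \<in> set (rules M)" if "(IStep r, t', q) \<in> A \<or> (IHead i r, t', q) \<in> A" for r i t' q
      using that A_wf[of "IStep r" t' q] A_wf[of "IHead i r" t' q] by (auto simp: set_rules)
    have "fst (?r t) \<le> states M" using valid_rl[of t] by (simp add: valid_rule_def)
    then have "consumed (WState (fst (?r t))) t 0" using Is by simp
    then obtain r q0 where r: "(IStep r, t, q0) \<in> A" "fst r = fst (?r t)"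
      by (auto simp: consumed_def consumes_WState cong: conj_cong)
    have r_unique: "r' = r \<and> q' = q0" if "(IStep r', t, q') \<in> A" for r' q'
    proof -
      have "consumed (WState (fst r')) t 0" unfolding consumed_def using that by (intro exI[of _ "IStep r'"] exI[of _ t] exI[of _ q']) simp
      then have "fst r' = fst (?r t)" using Is rs(1) that by blast
      then show ?thesis
        using consumer_unique[of "WState (fst r)" t 0 "IStep r" t q0 "IStep r'" t q'] that r rs(1)[of r t q0] tD D2 by auto
    qed
    \<comment> \<open>Sync wires are free at every time, so the heads receive exactly what the only
      step item of time \<open>t\<close> announces.\<close>
    have sync: "consumed (WSync i r') t 0 \<longleftrightarrow> r' = r" if "i < tapes M" "r' \<in> set (rules M)" for i r'
    proof -
      have "consumed (WSync i r') t 0 \<longleftrightarrow> produced (WSync i r') t 0"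
        using consumed_iff[of "WSync i r'" t 0] that tD D2 by simp
      also have "\<dots> \<longleftrightarrow> (\<exists>q'. (IStep r', t, q') \<in> A)"
        by (auto simp: produced_def produces_WSync cong: conj_cong)
      finally show ?thesis using r r_unique by blast
    qed
    have rr: "r \<in> set (rules M)" using rs(2) r(1) by blast
    have head_in: "r' = r \<and> int q = hd_pos y t i \<and> snd r ! i = cell y t i q" if "(IHead i r', t, q) \<in> A" for i r' q
    proof -
      have iq: "i < tapes M" "q < 2 * D" "r' \<in> set (rules M)" using A_wf[OF that] by auto
      have "consumed (WSync i r') t 0" unfolding consumed_def using that by (intro exI[of _ "IHead i r'"] exI[of _ t] exI[of _ q]) simp
      then have r': "r' = r" using sync iq by simp
      have "consumed (WHead i) t q" unfolding consumed_def using that by (intro exI[of _ "IHead i r'"] exI[of _ t] exI[of _ q]) simp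
      then have "int q = hd_pos y t i" using Ih iq by simp
      moreover have "consumed (WCell i (snd r' ! i)) t q" unfolding consumed_def using that by (intro exI[of _ "IHead i r'"] exI[of _ t] exI[of _ q]) simp
      moreover have "snd r' ! i < symbols M" using iq by (auto simp: set_rules subset_iff)
      ultimately show ?thesis using Ic iq r' by auto
    qed
    have head_ex: "\<exists>q. (IHead i r, t, q) \<in> A \<and> q < 2 * D" if "i < tapes M" for i
    proof -
      have "consumed (WSync i r) t 0" using sync that rr by simp
      then obtain it t' q where "(it, t', q) \<in> A" "busy it" "consumes it t' q (WSync i r) t 0" by (auto simp: consumed_def)
      moreover from this have "it = IHead i r" "t' = t" by (simp_all add: consumes_WSync)
      ultimately show ?thesis using A_wf by blast
    qed
    have "r = ?r t"
    proof (rule prod_eqI)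
      show "fst r = fst (?r t)" by (rule r)
      show "snd r = snd (?r t)"
      proof (rule nth_equalityI)
        show "length (snd r) = length (snd (?r t))"
          using rr valid_rl[of t] by (simp add: set_rules valid_rule_def)
        fix i assume "i < length (snd r)"
        then have i: "i < tapes M" using rr by (simp add: set_rules)
        then obtain q where "(IHead i r, t, q) \<in> A" using head_ex by blast
        then show "snd r ! i = snd (?r t) ! i" using head_in[of i r q] scan_cell[of i q y t] i by simp
      qed
    qed
    have head: "(IHead i r', t, q) \<in> A \<longleftrightarrow> r' = ?r t \<and> int q = hd_pos y t i" if "i < tapes M" for i r' q
    proof -
      obtain q1 where q1: "(IHead i r, t, q1) \<in> A" using head_ex[OF \<open>i < tapes M\<close>] by blast
      have "q = q1" if "int q = hd_pos y t i" using head_in[OF q1] that by simp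
      then show ?thesis using q1 head_in[of i r' q] \<open>r = ?r t\<close> by auto
    qed
    have St: "Suc t < D" by (rule Suc.prems)
    have "consumed (WState s) (Suc t) 0 \<longleftrightarrow> s = fst (?r (Suc t))" if "s \<le> states M" for s
    proof -
      have "consumed (WState s) (Suc t) 0 \<longleftrightarrow> produced (WState s) (Suc t) 0"
        using consumed_iff[of "WState s" "Suc t" 0] that St D2 by simp
      also have "\<dots> \<longleftrightarrow> (\<exists>r' q'. (IStep r', t, q') \<in> A \<and> s = fst (next_step M r'))"
        by (auto simp: produced_def produces_WState cong: conj_cong)
      also have "\<dots> \<longleftrightarrow> s = fst (next_step M (?r t))" using r r_unique \<open>r = ?r t\<close> by blast
      finally show ?thesis by (simp add: rl_simps cf_Suc)
    qed
    moreover have "consumed (WHead i) (Suc t) q \<longleftrightarrow> int q = hd_pos y (Suc t) i" if "i < tapes M" "q < 2 * D" for i q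
    proof -
      have "consumed (WHead i) (Suc t) q \<longleftrightarrow> produced (WHead i) (Suc t) q"
        using consumed_iff[of "WHead i" "Suc t" q] that St by simp
      also have "\<dots> \<longleftrightarrow> (\<exists>r' q'. (IHead i r', t, q') \<in> A \<and> moves (snd (snd (next_step M r') ! i)) q' q)"
        by (simp add: produced_def produces_WHead cong: conj_cong) (blast intro: busy_simps)
      also have "\<dots> \<longleftrightarrow> int q = hd_pos y (Suc t) i"
        using head[OF that(1)] head_ex[OF that(1)] hd_pos_Suc[OF that(1), of y t] by (auto simp: moves_iff)
      finally show ?thesis .
    qed
    moreover have "consumed (WCell i s) (Suc t) q \<longleftrightarrow> cell y (Suc t) i q = s" if i: "i < tapes M" "q < 2 * D" "s < symbols M" for i q s
    proof -
      have "consumed (WCell i s) (Suc t) q \<longleftrightarrow> produced (WCell i s) (Suc t) q"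
        using consumed_iff[of "WCell i s" "Suc t" q] that St by simp
      also have "\<dots> \<longleftrightarrow> (\<exists>r'. (IHead i r', t, q) \<in> A \<and> s = fst (snd (next_step M r') ! i)) \<or> (ICell i s, t, q) \<in> A"
        by (simp add: produced_def produces_WCell_Suc cong: conj_cong) (blast intro: busy_simps)
      also have "\<dots> \<longleftrightarrow> cell y (Suc t) i q = s"
      proof (cases "int q = hd_pos y t i")
        case True
        then have h: "(IHead i (?r t), t, q) \<in> A" using head i by simp
        \<comment> \<open>Otherwise \<open>s\<close> would be the scanned symbol, and the head item
          and the cell item would consume the same wire.\<close>
        have "(ICell i s, t, q) \<notin> A"
        proof
          assume a: "(ICell i s, t, q) \<in> A"
          then have "consumed (WCell i s) t q" unfolding consumed_def by (intro exI[of _ "ICell i s"] exI[of _ t] exI[of _ q]) simp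
          then have "cell y t i q = s" using Ic i by simp
          then have "snd (?r t) ! i = s" using scan_cell[OF i(1) True] by simp
          then have "consumes (IHead i (?r t)) t q (WCell i s) t q" by simp
          then show False
            using consumer_unique[of "WCell i s" t q "IHead i (?r t)" t q "ICell i s" t q] h a i tD by simp
        qed
        then show ?thesis using head[OF i(1)] True cell_Suc[OF i(1), of y t q] by auto
      next
        case False
        have "(ICell i s, t, q) \<in> A \<longleftrightarrow> consumed (WCell i s) t q"
          using head[OF i(1)] False
          by (simp add: consumed_def consumes_WCell cong: conj_cong) (blast intro: busy_simps)
        then show ?thesis using head[OF i(1)] False cell_Suc[OF i(1), of y t q] Ic i by auto
      qed
      finally show ?thesis .
    qed
    ultimately show ?case by (simp add: inv_def)
  qed
  then have I: "inv c" using D_bounds by simp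
  let ?w = "WCell (tapes M - 1) 2"
  have k: "tapes M - 1 < tapes M" "2 < symbols M" using wf by (auto simp: wf_tm_def)
  then have w: "?w \<in> set (wires M)" by simp
  have "(IIdle ?w, c, origin c) \<notin> A"
    using cover_unique(1)[of Trash 0 0 "(IIdle ?w, c, origin c)"] D_bounds by (auto simp: covers_def)
  moreover obtain it t' q' where 1: "(it, t', q') \<in> A" "consumes it t' q' ?w c (origin c)"
    using cover_exists[of "Cons ?w" c "origin c"] w D_bounds by auto
  ultimately have "busy it" by (auto simp: busy_def)
  with 1 have "consumed ?w c (origin c)" by (auto simp: consumed_def)
  then have "cell y c (tapes M - 1) (origin c) = 2" using I k D_bounds unfolding inv_def by blast
  then show ?thesis using y(1) by (auto simp: accepts_def)
qed

end

end

subsection \<open>An accepted certificate yields a cover\<close>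

lemma sym_of_bit_inject: "sym_of_bit a = sym_of_bit b \<longleftrightarrow> a = b"
  by (auto simp: sym_of_bit_def)

lemma singleton_tripleI:
  assumes "\<And>it t q. (it, t, q) \<in> S \<longleftrightarrow> it = i0 \<and> t = t0 \<and> q = q0"
  shows "\<exists>a. S = {a}"
  using assms by (intro exI[of _ "(i0, t0, q0)"]) auto

lemma empty_tripleI:
  assumes "\<And>it t q. (it, t, q) \<notin> S"
  shows "S = {}"
  using assms by auto

text \<open>An accepted certificate together with an injective payment \<open>g\<close> of its bits
  by tokens.\<close>

locale accepted_tableau = tableau +
  fixes y :: "bool list" and g :: "nat \<Rightarrow> nat \<times> nat"
  assumes ly: "length y \<le> L" and acc: "accepts y"
    and g_inj: "inj_on g {..<length y}"
    and g_tok: "j < length y \<Longrightarrow> g j = (\<mu>, t) \<Longrightarrow> \<mu> < u \<and> t < D \<and> tok \<mu> t"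
begin

sublocale verifier M "pair_str x y" using wf by unfold_locales

text \<open>The wires that the real run uses. The flag is still \<open>True\<close> on entering
  position \<open>ys + length y\<close>, where \<open>IEnd True\<close> consumes it.\<close>

primrec active :: "wire \<Rightarrow> nat \<Rightarrow> nat \<Rightarrow> bool" where
  "active (WCell i s) t q \<longleftrightarrow> cell y t i q = s"
| "active (WHead i) t q \<longleftrightarrow> int q = hd_pos y t i"
| "active (WSync i r) t q \<longleftrightarrow> r = rl t"
| "active (WState s) t q \<longleftrightarrow> s = fst (rl t)"
| "active (WGuess f) t q \<longleftrightarrow> f = (q \<le> ys + length y)"

text \<open>The cover: all actions of the real run, the guess items spelling \<open>y\<close>, one
  free item per unspent token, and the idle items of exactly the free wires that the run does not
  use.\<close>

primrec chosen :: "item \<Rightarrow> nat \<Rightarrow> nat \<Rightarrow> bool" where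
  "chosen (IStep r) t q \<longleftrightarrow> r = rl t \<and> q = 0"
| "chosen (IHead i r) t q \<longleftrightarrow> r = rl t \<and> int q = hd_pos y t i"
| "chosen (ICell i s) t q \<longleftrightarrow> s = cell y t i q \<and> int q \<noteq> hd_pos y t i"
| "chosen (IBit b \<mu>) t q \<longleftrightarrow> ys \<le> q \<and> q - ys < length y \<and> b = y ! (q - ys) \<and> g (q - ys) = (\<mu>, t)"
| "chosen (IEnd f) t q \<longleftrightarrow> t = 0 \<and> ys + length y \<le> q \<and> f = (q = ys + length y)"
| "chosen (IFree \<mu>) t q \<longleftrightarrow> q = 0 \<and> tok \<mu> t \<and> (\<mu>, t) \<notin> g ` {..<length y}"
| "chosen (IIdle w) t q \<longleftrightarrow> free x c w t q \<and> \<not> active w t q"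

definition A :: "(item \<times> nat \<times> nat) set" where
  "A = {(it, t, q). it \<in> set (items M u) \<and> t < D \<and> q < 2 * D \<and> chosen it t q}"

definition cv :: "elem \<Rightarrow> nat \<Rightarrow> nat \<Rightarrow> (item \<times> nat \<times> nat) set" where
  "cv el t q = {a \<in> A. covers M c a (el, t, q)}"

lemma in_cv: "(it, t', q') \<in> cv el t q \<longleftrightarrow>
    it \<in> set (items M u) \<and> t' < D \<and> q' < 2 * D \<and> chosen it t' q' \<and> covers_elem M c it t' q' el t q"
  by (auto simp: cv_def A_def covers_def)

lemma rl_rules [simp]: "rl t \<in> set (rules M)"
  using valid_rl[of t] by (simp add: valid_rule_def set_rules)

text \<open>Heads never leave the range of positions, so at each time each tape really has a head
  item to consume its sync wire.\<close>

lemma head_pos: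
  assumes "i < tapes M"
  obtains q where "q < 2 * D" "int q = hd_pos y t i"
proof -
  obtain T where T: "T \<le> T0" "fst (config_at M (pair_str x y) T) = states M" using halts[OF ly] by blast
  have "\<bar>snd (tape_at M (pair_str x y) t i)\<bar> \<le> int T" by (rule pos_bound_halt[OF assms T(2)])
  then have "0 \<le> hd_pos y t i" "hd_pos y t i < int (2 * D)"
    using T(1) c_large D_large by (auto simp: origin_def)
  then show ?thesis by (intro that[of "nat (hd_pos y t i)"]) auto
qed

text \<open>The unique producer is the idle item for a wrong symbol, the head or cell item of the
  previous time for the right one, and at time 0 the guess item of that position.\<close>

lemma cover_Prod_WCell:
  assumes "i < tapes M" "s < symbols M" "t < D" "q < 2 * D"
  shows "card (cv (Prod (WCell i s)) t q) = of_bool (free x c (WCell i s) t q)"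
proof (rule card_eq_of_boolI)
  assume free: "free x c (WCell i s) t q"
  show "\<exists>a. cv (Prod (WCell i s)) t q = {a}"
  proof (cases "cell y t i q = s")
    case False
    show ?thesis
    proof (rule singleton_tripleI[where ?i0.0 = "IIdle (WCell i s)" and ?t0.0 = t and ?q0.0 = q])
      fix it t' q'
      have e: "\<not> (q - ys < length y)" if "ys + length y \<le> q" using that by arith
      show "(it, t', q') \<in> cv (Prod (WCell i s)) t q \<longleftrightarrow> it = IIdle (WCell i s) \<and> t' = t \<and> q' = q"
        using assms free False cell_Suc[OF assms(1), of y t' q] cell_0[OF assms(1,4), of y]
        by (cases it) (auto simp: in_cv e sym_of_bit_inject)
    qed
  next
    case act: True
    show ?thesis
    proof (cases t)
      case t: (Suc t0)
      show ?thesis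
      proof (cases "int q = hd_pos y t0 i")
        case True
        show ?thesis
        proof (rule singleton_tripleI[where ?i0.0 = "IHead i (rl t0)" and ?t0.0 = t0 and ?q0.0 = q])
          fix it t' q'
          show "(it, t', q') \<in> cv (Prod (WCell i s)) t q \<longleftrightarrow> it = IHead i (rl t0) \<and> t' = t0 \<and> q' = q"
            using assms act t True cell_Suc[OF assms(1), of y t0 q]
            by (cases it) (auto simp: in_cv)
        qed
      next
        case False
        show ?thesis
        proof (rule singleton_tripleI[where ?i0.0 = "ICell i s" and ?t0.0 = t0 and ?q0.0 = q])
          fix it t' q'
          show "(it, t', q') \<in> cv (Prod (WCell i s)) t q \<longleftrightarrow> it = ICell i s \<and> t' = t0 \<and> q' = q"
            using assms act t False cell_Suc[OF assms(1), of y t0 q]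
            by (cases it) (auto simp: in_cv)
        qed
      qed
    next
      case t: 0
      then have i: "i = 0" "ys \<le> q" using free by auto
      show ?thesis
      proof (cases "q - ys < length y")
        case True
        obtain \<mu> j where gj: "g (q - ys) = (\<mu>, j)" by fastforce
        show ?thesis
        proof (rule singleton_tripleI[where ?i0.0 = "IBit (y ! (q - ys)) \<mu>" and ?t0.0 = j and ?q0.0 = q])
          fix it t' q'
          show "(it, t', q') \<in> cv (Prod (WCell i s)) t q \<longleftrightarrow> it = IBit (y ! (q - ys)) \<mu> \<and> t' = j \<and> q' = q"
            using assms act t i True gj g_tok[OF True gj] cell_0[OF assms(1,4), of y]
            by (cases it) (auto simp: in_cv)
        qed
      next
        case False
        show ?thesis
        proof (rule singleton_tripleI[where ?i0.0 = "IEnd (q = ys + length y)" and ?t0.0 = 0 and ?q0.0 = q])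
          fix it t' q'
          show "(it, t', q') \<in> cv (Prod (WCell i s)) t q \<longleftrightarrow> it = IEnd (q = ys + length y) \<and> t' = 0 \<and> q' = q"
            using assms act t i False cell_0[OF assms(1,4), of y]
            by (cases it) (auto simp: in_cv)
        qed
      qed
    qed
  qed
next
  assume nf: "\<not> free x c (WCell i s) t q"
  show "cv (Prod (WCell i s)) t q = {}"
  proof (rule empty_tripleI)
    fix it t' q'
    show "(it, t', q') \<notin> cv (Prod (WCell i s)) t q" using nf by (cases it) (auto simp: in_cv)
  qed
qed

lemma cover_Cons_WCell:
  assumes "i < tapes M" "s < symbols M" "t < D" "q < 2 * D"
  shows "card (cv (Cons (WCell i s)) t q) = of_bool (free x c (WCell i s) t q \<or> given x c (WCell i s) t q)"
proof -
  \<comment> \<open>Cell wires that are not free belong to time 0 and lie outside the certificate;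
    there \<open>given\<close> singles out the initial symbol.\<close>
  have g: "given x c (WCell i s) t q \<longleftrightarrow> cell y t i q = s" if "\<not> free x c (WCell i s) t q"
    using that cell_0[OF assms(1,4), of y] by auto
  show ?thesis
  proof (cases "cell y t i q = s")
    case act: True
    have "\<exists>a. cv (Cons (WCell i s)) t q = {a}"
    proof (cases "int q = hd_pos y t i")
      case True
      show ?thesis
      proof (rule singleton_tripleI[where ?i0.0 = "IHead i (rl t)" and ?t0.0 = t and ?q0.0 = q])
        fix it t' q'
        show "(it, t', q') \<in> cv (Cons (WCell i s)) t q \<longleftrightarrow> it = IHead i (rl t) \<and> t' = t \<and> q' = q"
          using assms act True scan_cell[OF assms(1) True] by (cases it) (auto simp: in_cv)
      qed
    next
      case False
      show ?thesis
      proof (rule singleton_tripleI[where ?i0.0 = "ICell i s" and ?t0.0 = t and ?q0.0 = q])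
        fix it t' q'
        show "(it, t', q') \<in> cv (Cons (WCell i s)) t q \<longleftrightarrow> it = ICell i s \<and> t' = t \<and> q' = q"
          using assms act False by (cases it) (auto simp: in_cv)
      qed
    qed
    then show ?thesis using g act by auto
  next
    case False
    have n: "(it, t', q') \<in> cv (Cons (WCell i s)) t q \<longleftrightarrow>
        it = IIdle (WCell i s) \<and> t' = t \<and> q' = q \<and> free x c (WCell i s) t q" for it t' q'
      using assms False scan_cell[OF assms(1), of q y t] by (cases it) (auto simp: in_cv)
    show ?thesis
    proof (cases "free x c (WCell i s) t q")
      case True
      then have "\<exists>a. cv (Cons (WCell i s)) t q = {a}" using n by (intro singleton_tripleI) blast
      then show ?thesis using True by auto
    next
      case nf: False
      then have "cv (Cons (WCell i s)) t q = {}" using n by (intro empty_tripleI) blast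
      then show ?thesis using nf g False by simp
    qed
  qed
qed

lemma cover_Prod_WHead:
  assumes "i < tapes M" "t < D" "q < 2 * D"
  shows "card (cv (Prod (WHead i)) t q) = of_bool (free x c (WHead i) t q)"
proof (cases t)
  case 0
  have "cv (Prod (WHead i)) t q = {}"
  proof (rule empty_tripleI)
    show "(it, t', q') \<notin> cv (Prod (WHead i)) t q" for it t' q' using 0 by (cases it) (auto simp: in_cv)
  qed
  then show ?thesis using 0 by simp
next
  case t: (Suc t0)
  obtain q0 where q0: "q0 < 2 * D" "int q0 = hd_pos y t0 i" using head_pos[OF assms(1)] by blast
  have p: "moves (snd (snd (next_step M (rl t0)) ! i)) q0 q \<longleftrightarrow> int q = hd_pos y t i"
    unfolding t hd_pos_Suc[OF assms(1)] moves_iff q0(2) ..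
  have "\<exists>a. cv (Prod (WHead i)) t q = {a}"
  proof (cases "int q = hd_pos y t i")
    case True
    show ?thesis
    proof (rule singleton_tripleI[where ?i0.0 = "IHead i (rl t0)" and ?t0.0 = t0 and ?q0.0 = q0])
      fix it t' q'
      have "q' = q0" if "int q' = hd_pos y t0 i" using that q0 by simp
      then show "(it, t', q') \<in> cv (Prod (WHead i)) t q \<longleftrightarrow> it = IHead i (rl t0) \<and> t' = t0 \<and> q' = q0"
        using assms t True q0 p by (cases it) (auto simp: in_cv)
    qed
  next
    case False
    show ?thesis
    proof (rule singleton_tripleI[where ?i0.0 = "IIdle (WHead i)" and ?t0.0 = t and ?q0.0 = q])
      fix it t' q'
      have "q' = q0" if "int q' = hd_pos y t0 i" using that q0 by simp
      then show "(it, t', q') \<in> cv (Prod (WHead i)) t q \<longleftrightarrow> it = IIdle (WHead i) \<and> t' = t \<and> q' = q"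
        using assms t False p by (cases it) (auto simp: in_cv)
    qed
  qed
  then show ?thesis using t by auto
qed

lemma cover_Cons_WHead:
  assumes "i < tapes M" "t < D" "q < 2 * D"
  shows "card (cv (Cons (WHead i)) t q) = of_bool (free x c (WHead i) t q \<or> given x c (WHead i) t q)"
proof -
  have n: "(it, t', q') \<in> cv (Cons (WHead i)) t q \<longleftrightarrow>
     t' = t \<and> q' = q \<and> (if int q = hd_pos y t i then it = IHead i (rl t) else it = IIdle (WHead i) \<and> t \<noteq> 0)" for it t' q'
    using assms by (cases it) (auto simp: in_cv)
  show ?thesis
  proof (rule card_eq_of_boolI)
    assume "free x c (WHead i) t q \<or> given x c (WHead i) t q"
    then have "t \<noteq> 0 \<or> int q = hd_pos y t i" using hd_pos_0[OF assms(1), of y] by auto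
    then show "\<exists>a. cv (Cons (WHead i)) t q = {a}"
      using n by (intro singleton_tripleI[where ?i0.0 = "if int q = hd_pos y t i then IHead i (rl t) else IIdle (WHead i)"]) auto
  next
    assume "\<not> (free x c (WHead i) t q \<or> given x c (WHead i) t q)"
    then have "t = 0" "int q \<noteq> hd_pos y t i" using hd_pos_0[OF assms(1), of y] by auto
    then show "cv (Cons (WHead i)) t q = {}" using n by (intro empty_tripleI) auto
  qed
qed

lemma cover_WSync:
  assumes "i < tapes M" "r \<in> set (rules M)" "t < D" "q < 2 * D"
  shows "card (cv (Prod (WSync i r)) t q) = of_bool (q = 0)" "card (cv (Cons (WSync i r)) t q) = of_bool (q = 0)"
proof -
  have n: "(it, t', q') \<in> cv (Prod (WSync i r)) t q \<longleftrightarrow>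
     t' = t \<and> q' = 0 \<and> q = 0 \<and> it = (if r = rl t then IStep r else IIdle (WSync i r))" for it t' q'
    using assms by (cases it) (auto simp: in_cv)
  show "card (cv (Prod (WSync i r)) t q) = of_bool (q = 0)"
    using n by (intro card_eq_of_boolI singleton_tripleI[where ?q0.0 = 0 and
        ?i0.0 = "if r = rl t then IStep r else IIdle (WSync i r)"] empty_tripleI) auto
  obtain q0 where q0: "q0 < 2 * D" "int q0 = hd_pos y t i" using head_pos[OF assms(1)] by blast
  have n: "(it, t', q') \<in> cv (Cons (WSync i r)) t q \<longleftrightarrow>
     t' = t \<and> q = 0 \<and> (if r = rl t then it = IHead i r \<and> q' = q0 else it = IIdle (WSync i r) \<and> q' = 0)" for it t' q'
  proof -
    have "int q' = hd_pos y t i \<longleftrightarrow> q' = q0" using q0 by auto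
    then show ?thesis using assms q0 by (cases it) (auto simp: in_cv)
  qed
  show "card (cv (Cons (WSync i r)) t q) = of_bool (q = 0)"
    using n
    by (intro card_eq_of_boolI singleton_tripleI[where ?q0.0 = "if r = rl t then q0 else 0" and
        ?i0.0 = "if r = rl t then IHead i r else IIdle (WSync i r)"] empty_tripleI) auto
qed

lemma cover_WState:
  assumes "s \<le> states M" "t < D" "q < 2 * D"
  shows "card (cv (Prod (WState s)) t q) = of_bool (free x c (WState s) t q)"
    "card (cv (Cons (WState s)) t q) = of_bool (free x c (WState s) t q \<or> given x c (WState s) t q)"
proof -
  have r0: "fst (rl 0) = 0" by (simp add: rl_simps cf_0)
  have rS: "fst (rl (Suc t0)) = fst (next_step M (rl t0))" for t0 by (simp add: rl_simps cf_Suc)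
  have n: "(it, t', q') \<in> cv (Prod (WState s)) t q \<longleftrightarrow>
     q = 0 \<and> q' = 0 \<and> t \<noteq> 0 \<and> (if s = fst (rl t) then it = IStep (rl (t - 1)) \<and> t' = t - 1 else it = IIdle (WState s) \<and> t' = t)" for it t' q'
    using assms rS[of "t - 1"] rS[of t'] by (cases it) (auto simp: in_cv)
  show "card (cv (Prod (WState s)) t q) = of_bool (free x c (WState s) t q)"
    using n
    by (intro card_eq_of_boolI singleton_tripleI[where ?t0.0 = "if s = fst (rl t) then t - 1 else t" and
        ?i0.0 = "if s = fst (rl t) then IStep (rl (t - 1)) else IIdle (WState s)"] empty_tripleI) auto
  have n: "(it, t', q') \<in> cv (Cons (WState s)) t q \<longleftrightarrow>
     q = 0 \<and> q' = 0 \<and> t' = t \<and> (if s = fst (rl t) then it = IStep (rl t) else it = IIdle (WState s) \<and> t \<noteq> 0)" for it t' q'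
    using assms by (cases it) (auto simp: in_cv)
  show "card (cv (Cons (WState s)) t q) = of_bool (free x c (WState s) t q \<or> given x c (WState s) t q)"
    using n r0
    by (intro card_eq_of_boolI singleton_tripleI[where
        ?i0.0 = "if s = fst (rl t) then IStep (rl t) else IIdle (WState s)"] empty_tripleI) auto
qed

definition guess_of :: "nat \<Rightarrow> item \<times> nat" where
  "guess_of q = (if q - ys < length y then (IBit (y ! (q - ys)) (fst (g (q - ys))), snd (g (q - ys)))
    else (IEnd (q = ys + length y), 0))"

lemma guess_of_range:
  "fst (guess_of q) \<in> set (items M u)" "snd (guess_of q) < D"
  using g_tok[of "q - ys" "fst (g (q - ys))" "snd (g (q - ys))"] D_bounds by (auto simp: guess_of_def)

lemma cover_Prod_WGuess:
  assumes "t < D" "q < 2 * D"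
  shows "card (cv (Prod (WGuess f)) t q) = of_bool (free x c (WGuess f) t q)"
proof (rule card_eq_of_boolI)
  assume free: "free x c (WGuess f) t q"
  then obtain q0 where q0: "q = Suc q0" "ys \<le> q0" by (cases q) auto
  show "\<exists>a. cv (Prod (WGuess f)) t q = {a}"
  proof (cases "f = (q \<le> ys + length y)")
    case True
    show ?thesis
    proof (rule singleton_tripleI[where ?i0.0 = "fst (guess_of q0)" and ?t0.0 = "snd (guess_of q0)" and ?q0.0 = q0])
      fix it t' q'
      show "(it, t', q') \<in> cv (Prod (WGuess f)) t q \<longleftrightarrow> it = fst (guess_of q0) \<and> t' = snd (guess_of q0) \<and> q' = q0"
        using assms free True q0 guess_of_range[of q0] by (cases it) (auto simp: in_cv guess_of_def split: if_splits)
    qed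
  next
    case False
    show ?thesis
    proof (rule singleton_tripleI[where ?i0.0 = "IIdle (WGuess f)" and ?t0.0 = t and ?q0.0 = q])
      fix it t' q'
      show "(it, t', q') \<in> cv (Prod (WGuess f)) t q \<longleftrightarrow> it = IIdle (WGuess f) \<and> t' = t \<and> q' = q"
        using assms free False q0 by (cases it) (auto simp: in_cv)
    qed
  qed
next
  assume nf: "\<not> free x c (WGuess f) t q"
  show "cv (Prod (WGuess f)) t q = {}"
  proof (rule empty_tripleI)
    fix it t' q'
    show "(it, t', q') \<notin> cv (Prod (WGuess f)) t q" using nf by (cases it) (auto simp: in_cv)
  qed
qed

lemma cover_Cons_WGuess:
  assumes "t < D" "q < 2 * D"
  shows "card (cv (Cons (WGuess f)) t q) = of_bool (free x c (WGuess f) t q \<or> given x c (WGuess f) t q)"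
proof -
  have n: "(it, t', q') \<in> cv (Cons (WGuess f)) t q \<longleftrightarrow> t = 0 \<and> ys \<le> q \<and> q' = q \<and>
     (if f = (q \<le> ys + length y) then it = fst (guess_of q) \<and> t' = snd (guess_of q) else it = IIdle (WGuess f) \<and> t' = t \<and> q \<noteq> ys)" for it t' q'
    using assms guess_of_range[of q] by (cases it) (auto simp: in_cv guess_of_def split: if_splits)
  show ?thesis
    using n
    by (intro card_eq_of_boolI singleton_tripleI[where
        ?i0.0 = "if f = (q \<le> ys + length y) then fst (guess_of q) else IIdle (WGuess f)" and
        ?t0.0 = "if f = (q \<le> ys + length y) then snd (guess_of q) else t" and ?q0.0 = q] empty_tripleI) auto
qed

text \<open>A token is taken by the bit that pays with it, unique by injectivity of
  \<open>g\<close>, and otherwise by its free item.\<close>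

lemma cover_Tok:
  assumes "\<mu> < u" "t < D" "q < 2 * D"
  shows "card (cv (Tok \<mu>) t q) = of_bool (q = 0 \<and> tok \<mu> t)"
proof (rule card_eq_of_boolI)
  assume n: "q = 0 \<and> tok \<mu> t"
  show "\<exists>a. cv (Tok \<mu>) t q = {a}"
  proof (cases "(\<mu>, t) \<in> g ` {..<length y}")
    case True
    then obtain j where j: "j < length y" "g j = (\<mu>, t)" by auto
    have jr: "ys + j < 2 * D" using j ly D_bounds by simp
    have uq: "q' = ys + j" if "ys \<le> q'" "q' - ys < length y" "g (q' - ys) = (\<mu>, t)" for q'
      using inj_onD[OF g_inj, of "q' - ys" j] that j by simp
    show ?thesis
    proof (rule singleton_tripleI[where ?i0.0 = "IBit (y ! j) \<mu>" and ?t0.0 = t and ?q0.0 = "ys + j"])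
      fix it t' q'
      show "(it, t', q') \<in> cv (Tok \<mu>) t q \<longleftrightarrow> it = IBit (y ! j) \<mu> \<and> t' = t \<and> q' = ys + j"
        using assms n j jr True uq[of q'] by (cases it) (auto simp: in_cv)
    qed
  next
    case False
    then have nj: "g j \<noteq> (\<mu>, t)" if "j < length y" for j using that by (metis image_eqI lessThan_iff)
    show ?thesis
    proof (rule singleton_tripleI[where ?i0.0 = "IFree \<mu>" and ?t0.0 = t and ?q0.0 = 0])
      fix it t' q'
      show "(it, t', q') \<in> cv (Tok \<mu>) t q \<longleftrightarrow> it = IFree \<mu> \<and> t' = t \<and> q' = 0"
        using assms n False nj[of "q' - ys"] by (cases it) (auto simp: in_cv)
    qed
  qed
next
  assume n: "\<not> (q = 0 \<and> tok \<mu> t)"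
  show "cv (Tok \<mu>) t q = {}"
  proof (rule empty_tripleI)
    fix it t' q'
    show "(it, t', q') \<notin> cv (Tok \<mu>) t q"
      using n g_tok[of "q' - ys" \<mu> t] by (cases it) (auto simp: in_cv)
  qed
qed

text \<open>Acceptance makes the wire of symbol 2 at the output cell active at time
  \<open>c\<close>, so its idle item is not chosen.\<close>

lemma cover_Trash: "cv Trash t q = {}"
proof (rule empty_tripleI)
  fix it t' q'
  show "(it, t', q') \<notin> cv Trash t q"
    using acc by (auto simp: in_cv accepts_def)
qed

lemma exact_cover_A: "exact_cover Is Es (covers M c) (needed x c tok)"
  unfolding exact_cover_def
proof (intro exI[of _ A] conjI ballI)
  show "A \<subseteq> set Is" by (auto simp: A_def set_grid)
  fix e assume "e \<in> set Es"
  then obtain el t q where e: "e = (el, t, q)" "el \<in> set (elems M u)" "t < D" "q < 2 * D"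
    by (auto simp: set_grid)
  have "card (cv el t q) = of_bool (needed_elem x c tok el t q)"
  proof (cases el)
    case (Prod w)
    then show ?thesis using e
      by (cases w) (auto simp: cover_Prod_WCell cover_Prod_WHead cover_WSync cover_WState cover_Prod_WGuess
          simp del: free.simps, auto)
  next
    case (Cons w)
    then show ?thesis using e
      by (cases w) (auto simp: cover_Cons_WCell cover_Cons_WHead cover_WSync cover_WState cover_Cons_WGuess
          simp del: free.simps given.simps, auto)
  next
    case (Tok \<mu>)
    then show ?thesis using e by (simp add: cover_Tok)
  next
    case Trash
    then show ?thesis by (simp add: cover_Trash)
  qed
  then show "card {i \<in> A. covers M c i e} = of_bool (needed x c tok e)"
    by (simp add: cv_def e needed_def)
qed

end

context tableau
begin

text \<open>For the converse any payment will do, and one exists because there are exactly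
  \<open>L\<close> tokens and at most \<open>L\<close> bits.\<close>

theorem exact_cover_iff:
  "exact_cover Is Es (covers M c) (needed x c tok) \<longleftrightarrow> (\<exists>y. length y \<le> L \<and> accepts y)"
proof
  assume "exact_cover Is Es (covers M c) (needed x c tok)"
  then show "\<exists>y. length y \<le> L \<and> accepts y" using cover_sound by (auto simp: exact_cover_def)
next
  assume "\<exists>y. length y \<le> L \<and> accepts y"
  then obtain y where y: "length y \<le> L" "accepts y" by blast
  let ?T = "{(\<mu>, j). \<mu> < u \<and> j < D \<and> tok \<mu> j}"
  have "finite ?T" by (rule finite_subset[of _ "{..<u} \<times> {..<D}"]) auto
  then obtain g where g: "inj_on g {..<length y}" "g ` {..<length y} \<subseteq> ?T"
    using inj_on_iff_card_le[of "{..<length y}" ?T] tokens y(1) by auto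
  have "\<mu> < u \<and> t < D \<and> tok \<mu> t" if "j < length y" "g j = (\<mu>, t)" for j \<mu> t
  proof -
    have "g j \<in> g ` {..<length y}" using that(1) by simp
    then have "g j \<in> ?T" by (rule subsetD[OF g(2)])
    then show ?thesis using that(2) by simp
  qed
  then interpret accepted_tableau M x L D c T0 u tok y g
    using y g(1) by unfold_locales auto
  show "exact_cover Is Es (covers M c) (needed x c tok)" by (rule exact_cover_A)
qed

end

section \<open>NP-hardness\<close>

subsection \<open>Printing the instance\<close>

text \<open>Item and element kinds are constants of the program. All that remains of the covering
  relation is a fixed Boolean combination of equality and successor tests between times and
  positions.\<close>

lemma cond_covers_elem:
  assumes "cond K (\<lambda>x e. t x e = t' x e)" "cond K (\<lambda>x e. Suc (t x e) = t' x e)"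
    "cond K (\<lambda>x e. q x e = q' x e)" "cond K (\<lambda>x e. Suc (q x e) = q' x e)" "cond K (\<lambda>x e. Suc (q' x e) = q x e)"
    "cond K (\<lambda>x e. t' x e = 0)" "cond K (\<lambda>x e. q' x e = 0)"
    "cond K (\<lambda>x e. t x e = c x)" "cond K (\<lambda>x e. q x e = origin (c x))"
  shows "cond K (\<lambda>x e. covers_elem M (c x) it (t x e) (q x e) el (t' x e) (q' x e))"
proof -
  have mv: "cond K (\<lambda>x e. moves d (q x e) (q' x e))" for d
    using assms by (cases d) simp_all
  have p: "cond K (\<lambda>x e. produces M it (t x e) (q x e) w (t' x e) (q' x e))" for w
    by (cases it; cases w; simp only: produces.simps wire.case) (intro cond_conj cond_const cond_not assms mv)+
  have s: "cond K (\<lambda>x e. consumes it (t x e) (q x e) w (t' x e) (q' x e))" for w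
    by (cases it; cases w; simp only: consumes.simps wire.case) (intro cond_conj cond_const cond_not assms mv)+
  show ?thesis
    by (cases el; simp only: covers_elem.simps) (intro p s cond_conj cond_const assms)+
qed

lemma cond_needed_elem:
  assumes "cond K (\<lambda>x e. t x e = 0)" "cond K (\<lambda>x e. q x e = 0)"
    "cond K (\<lambda>x e. guess_start x (c x) \<le> q x e)" "cond K (\<lambda>x e. q x e = guess_start x (c x))"
    "cond K (\<lambda>x e. q x e = origin (c x))"
    "\<And>s. cond K (\<lambda>x e. q x e < guess_start x (c x) \<and> s = init_sym x (c x) (q x e))"
    "\<And>\<mu>. el = Tok \<mu> \<Longrightarrow> cond K (\<lambda>x e. tok x \<mu> (t x e))"
  shows "cond K (\<lambda>x e. needed_elem x (c x) (tok x) el (t x e) (q x e))"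
proof -
  have lt: "cond K (\<lambda>x e. guess_start x (c x) < q x e)"
    by (rule cond_cong[OF cond_conj[OF assms(3) cond_not[OF assms(4)]]]) auto
  have f: "cond K (\<lambda>x e. free x (c x) w (t x e) (q x e))" for w
    by (cases w; simp only: free.simps) (intro cond_conj cond_disj cond_const cond_not assms lt)+
  have g: "cond K (\<lambda>x e. given x (c x) w (t x e) (q x e))" for w
    by (cases w; simp only: given.simps) (intro assms cond_if cond_const cond_conj)+
  show ?thesis
    using assms(7) by (cases el; simp only: needed_elem.simps) (intro f g cond_conj cond_disj cond_const assms | assumption | rule refl)+
qed

section \<open>Tests on positions split into a number and a parity bit\<close>

context
  fixes i d k h :: nat
  assumes ik: "i + d \<le> k" and h: "h \<in> {0, 1}"
begin

lemma cond_pos_eq: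
  assumes "j + d \<le> k" "i \<noteq> j" "h' \<in> {0, 1}"
  shows "cond k (\<lambda>x e. 2 * number i d x e + h = 2 * number j d x e + h')"
proof (rule cond_cong[OF cond_conj[OF cond_number_eq[OF ik assms(1,2)] cond_const[of k "h = h'"]]])
  show "number i d x e = number j d x e \<and> h = h' \<longleftrightarrow> 2 * number i d x e + h = 2 * number j d x e + h'" for x e
    using h assms(3) by auto presburger+
qed

lemma cond_pos_suc:
  assumes "j + d \<le> k" "i \<noteq> j" "h' \<in> {0, 1}"
  shows "cond k (\<lambda>x e. Suc (2 * number i d x e + h) = 2 * number j d x e + h')"
proof (rule cond_cong[OF cond_if[OF cond_const[of k "h = 0 \<and> h' = 1"] cond_number_eq[OF ik assms(1,2)]
        cond_conj[OF cond_const[of k "h = 1 \<and> h' = 0"] cond_number_suc[OF ik assms(1,2)]]]])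
  show "(if h = 0 \<and> h' = 1 then number i d x e = number j d x e else (h = 1 \<and> h' = 0) \<and> Suc (number i d x e) = number j d x e)
    \<longleftrightarrow> Suc (2 * number i d x e + h) = 2 * number j d x e + h'" for x e
    using h assms(3) by auto presburger+
qed

lemma cond_pos_zero: "cond k (\<lambda>x e. 2 * number i d x e + h = 0)"
  by (rule cond_cong[OF cond_conj[OF cond_number_zero[OF ik] cond_const[of k "h = 0"]]]) auto

end

text \<open>From here on numbers have \<open>a + 3\<close> digits and \<open>c = base x ^ (a + 2)\<close>, so that \<open>c + 1\<close> and
  \<open>c + base x\<close> have only digits 0 and 1, which the printing machine can recognise.\<close>

lemma undigits_origin: "undigits b (1 # replicate a 0 @ [0, 1]) = b ^ (a + 2) + 1"
proof -
  have "1 # replicate a 0 @ [0, 1] = ((1 # replicate a 0) @ [0]) @ [1 :: nat]" by simp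
  then show ?thesis by (simp only: undigits_snoc undigits_pow) (simp add: algebra_simps)
qed

lemma undigits_guess: "undigits b (1 # replicate a 0 @ [1, 0]) = b ^ (a + 2) + b"
proof -
  have "1 # replicate a 0 @ [1, 0] = ((1 # replicate a 0) @ [1]) @ [0 :: nat]" by simp
  then show ?thesis by (simp only: undigits_snoc undigits_pow) (simp add: algebra_simps)
qed

context
  fixes i k h a :: nat
  assumes ik: "i + (a + 3) \<le> k" and h: "h \<in> {0, 1}"
begin

lemma cond_pos_origin: "cond k (\<lambda>x e. 2 * number i (a + 3) x e + h = origin (base x ^ (a + 2)))"
proof -
  have "cond k (\<lambda>x e. number i (a + 3) x e = base x ^ (a + 2) + 1)"
  proof -
    have "cond k (\<lambda>x e. number i (length (1 # replicate a (0 :: nat) @ [0, 1])) x e = undigits (base x) (1 # replicate a 0 @ [0, 1]))"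
      by (rule cond_number_const) (use ik in auto)
    moreover have "length (1 # replicate a (0 :: nat) @ [0, 1]) = a + 3" by simp
    ultimately show ?thesis by (simp only: undigits_origin)
  qed
  from cond_conj[OF this cond_const[of k "h = 0"]] show ?thesis
    by (rule cond_cong) (use h in \<open>auto simp: origin_def, presburger\<close>)
qed

lemma cond_pos_guess: "cond k (\<lambda>x e. 2 * number i (a + 3) x e + h = guess_start x (base x ^ (a + 2)))"
proof -
  have "cond k (\<lambda>x e. number i (a + 3) x e = base x ^ (a + 2) + base x)"
  proof -
    have "cond k (\<lambda>x e. number i (length (1 # replicate a (0 :: nat) @ [1, 0])) x e = undigits (base x) (1 # replicate a 0 @ [1, 0]))"
      by (rule cond_number_const) (use ik in auto)
    moreover have "length (1 # replicate a (0 :: nat) @ [1, 0]) = a + 3" by simp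
    ultimately show ?thesis by (simp only: undigits_guess)
  qed
  from cond_conj[OF this cond_const[of k "h = 0"]] show ?thesis
    by (rule cond_cong) (use h in \<open>auto simp: guess_start_def, presburger\<close>)
qed

text \<open>The doubled input and its separator occupy the \<open>P\<close> from \<open>c\<close> to
  \<open>c + base x - 1\<close>, where \<open>c\<close> is a multiple of the base. So the higher
  digits of \<open>P\<close> tell whether it lies in this block, and its last digit is the ruler
  cell to be scanned.\<close>

lemma block_iff:
  assumes "b > (0 :: nat)"
  shows "P div b = b ^ (a + 1) \<longleftrightarrow> b ^ (a + 2) \<le> P \<and> P < b ^ (a + 2) + b"
proof -
  have e: "b ^ (a + 2) = b ^ (a + 1) * b" by simp
  show ?thesis
  proof
    assume "P div b = b ^ (a + 1)"
    then have "P = b ^ (a + 2) + P mod b" by (metis e div_mult_mod_eq)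
    then show "b ^ (a + 2) \<le> P \<and> P < b ^ (a + 2) + b" using assms mod_less_divisor[of b P] by linarith
  next
    assume "b ^ (a + 2) \<le> P \<and> P < b ^ (a + 2) + b"
    then obtain v where "P = v + b ^ (a + 1) * b" "v < b" unfolding e by (metis add.commute le_Suc_ex nat_add_left_cancel_less)
    then show "P div b = b ^ (a + 1)" using assms by simp
  qed
qed

lemma cond_left: "cond k (\<lambda>x e. number i (a + 3) x e < base x ^ (a + 2))"
  using cond_number_less_pow[of i "a + 2" k] ik by (simp add: eval_nat_numeral)

lemma cond_block: "cond k (\<lambda>x e. number i (a + 3) x e div base x = base x ^ (a + 1))"
proof (rule cond_cong[OF cond_number_pow[of i "a + 1" k]])
  show "number i (Suc (a + 1)) x e = base x ^ (a + 1) \<longleftrightarrow> number i (a + 3) x e div base x = base x ^ (a + 1)"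
    if "env k x e" for x e
    using number_div_mod(1)[OF that, of i "a + 2"] ik by (simp add: eval_nat_numeral)
qed (use ik in simp)

lemma guess_le_iff: "guess_start x (base x ^ (a + 2)) \<le> 2 * P + h \<longleftrightarrow>
    \<not> P < base x ^ (a + 2) \<and> P div base x \<noteq> base x ^ (a + 1)"
  using h block_iff[of "base x" P] by (auto simp: guess_start_def)

lemma cond_pos_guess_le: "cond k (\<lambda>x e. guess_start x (base x ^ (a + 2)) \<le> 2 * number i (a + 3) x e + h)"
  by (rule cond_cong[OF cond_conj[OF cond_not[OF cond_left] cond_not[OF cond_block]]]) (simp only: guess_le_iff)

lemma cond_pos_init:
  "cond k (\<lambda>x e. 2 * number i (a + 3) x e + h < guess_start x (base x ^ (a + 2)) \<and>
    s = init_sym x (base x ^ (a + 2)) (2 * number i (a + 3) x e + h))"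
proof -
  \<comment> \<open>Within the block the left mark 3 stands for the pair of blanks before the input
    and the right mark 4 for the separator, whose bit depends on the parity \<open>h\<close>; any
    other scanned symbol is the cell content itself.\<close>
  define Q where "Q \<rho> \<longleftrightarrow> (if \<rho> = 3 then s = 0 else if \<rho> = 4 then s = (if h = 0 then 1 else 2) else s = \<rho>)" for \<rho> :: nat
  have 1: "cond k (\<lambda>x e. Q (ruler x (int (number i (a + 3) x e mod base x))))"
    using cond_number_mod[of i "a + 2" k Q] ik by (simp add: eval_nat_numeral)
  show ?thesis
  proof (rule cond_cong[OF cond_disj[OF cond_conj[OF cond_left cond_const[of k "s = 0"]] cond_conj[OF cond_block 1]]])
    fix x e
    define P c where "P = number i (a + 3) x e" and "c = base x ^ (a + 2)"
    have par: "(2 * P + h) div 2 = P" "even (2 * P + h) \<longleftrightarrow> h = 0" using h by auto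
    consider "P < c" | "P \<ge> c + base x" | v where "P = c + v" "v < base x"
      by (metis le_Suc_ex nat_add_left_cancel_less not_le)
    then have "(P < c \<and> s = 0 \<or> P div base x = base x ^ (a + 1) \<and> Q (ruler x (int (P mod base x)))) \<longleftrightarrow>
        2 * P + h < guess_start x c \<and> s = init_sym x c (2 * P + h)"
    proof cases
      case 1
      then show ?thesis using h block_iff[of "base x" P] by (auto simp: c_def guess_start_def init_sym_def origin_def)
    next
      case 2
      then show ?thesis using block_iff[of "base x" P] by (auto simp: c_def guess_start_def)
    next
      case (3 v)
      have m: "P mod base x = v" "P div base x = base x ^ (a + 1)" using 3 block_iff[of "base x" P] by (auto simp: c_def)
      have l: "2 * P + h < guess_start x c" using 3 h by (auto simp: guess_start_def)
      show ?thesis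
      proof (cases "v = 0")
        case True
        then show ?thesis using m l 3 h by (auto simp: Q_def init_sym_def origin_def)
      next
        case False
        then have "init_sym x c (2 * P + h) = (if v \<le> length x then ruler x (int v) else if h = 0 then 1 else 2)"
          using 3 par by (auto simp: init_sym_def origin_def)
        moreover have "ruler x (int v) = 4 \<longleftrightarrow> \<not> v \<le> length x" using 3 by (auto simp: ruler_eq_4 base_def)
        ultimately show ?thesis using m l False 3(1) by (auto simp: Q_def)
      qed
    qed
    then show "(number i (a + 3) x e < base x ^ (a + 2) \<and> s = 0 \<or> number i (a + 3) x e div base x = base x ^ (a + 1) \<and>
        Q (ruler x (int (number i (a + 3) x e mod base x)))) \<longleftrightarrow>
      2 * number i (a + 3) x e + h < guess_start x (base x ^ (a + 2)) \<and>
        s = init_sym x (base x ^ (a + 2)) (2 * number i (a + 3) x e + h)"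
      by (simp add: P_def c_def)
  qed
qed

end

lemma number_take: "i + d \<le> k \<Longrightarrow> number i d x (take k e) = number i d x e"
  by (simp add: number_def drop_take min_def)

definition mtok :: "nat list \<Rightarrow> bool list \<Rightarrow> nat \<Rightarrow> nat \<Rightarrow> bool" where
  "mtok ms x \<mu> j \<longleftrightarrow> token (base x) (ms ! \<mu>) j"

context
  fixes M :: tm and ms :: "nat list" and a :: nat
  assumes ms: "\<And>i. i \<in> set ms \<Longrightarrow> i \<le> a + 3"
begin

abbreviation "cc x \<equiv> base x ^ (a + 2)"
abbreviation "IS x \<equiv> grid (items M (length ms)) (base x ^ (a + 3))"
abbreviation "ES x \<equiv> grid (elems M (length ms)) (base x ^ (a + 3))"
abbreviation "cov x \<equiv> covers M (cc x)"
abbreviation "nd x \<equiv> needed x (cc x) (mtok ms x)"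

text \<open>Running through the items without inspecting them is how their number enters in
  unary.\<close>

lemma lp_items:
  assumes "\<And>k. lp k (\<lambda>x e. s x)"
  shows "lp k (\<lambda>x e. concat (replicate (length (IS x)) (s x)))"
proof -
  have "lp k (\<lambda>x e. concat (map (\<lambda>_. s x) (IS x)))" by (rule lp_grid) (rule assms)
  then show ?thesis by (simp add: map_replicate_const)
qed

text \<open>The first \<open>k\<close> variables belong to the surrounding loop, in particular to
  the item whose row is printed; the two further groups of \<open>a + 3\<close> digits describe the
  element.\<close>

lemma lp_row:
  assumes "\<And>el h. el \<in> set (elems M (length ms)) \<Longrightarrow> h \<in> {0, 1} \<Longrightarrow> cond (k + (a + 3) + (a + 3))
    (\<lambda>x e. P x (take k e) (el, number k (a + 3) x e, 2 * number (k + (a + 3)) (a + 3) x e + h))"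
  shows "lp k (\<lambda>x e. concat (map g (row (IS x) (ES x) (P x e))))"
proof -
  have "lp k (\<lambda>x e. concat (map (\<lambda>el. (if P x e el then g True else g False) @ concat (replicate (length (IS x)) (g False))) (ES x)))"
    by (rule lp_grid) (intro lp_append lp_if lp_const lp_items assms)
  moreover have "concat (map g (row I E Q)) = concat (map (\<lambda>el. (if Q el then g True else g False) @ concat (replicate (length I) (g False))) E)"
    for I :: "(item \<times> nat \<times> nat) list" and E :: "(elem \<times> nat \<times> nat) list" and Q
    by (induction E) (auto simp: row_def map_replicate_const)
  ultimately show ?thesis by simp
qed

lemma lp_row_need: "lp k (\<lambda>x e. concat (map g (row (IS x) (ES x) (nd x))))"
proof (rule lp_row)
  fix el h assume el: "el \<in> set (elems M (length ms))" and h: "h \<in> {0 :: nat, 1}"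
  let ?K = "k + (a + 3) + (a + 3)" and ?i = "k + (a + 3)"
  have i: "?i + (a + 3) \<le> ?K" "k + (a + 3) \<le> ?K" by simp_all
  have tk: "cond ?K (\<lambda>x e. mtok ms x \<mu> (number k (a + 3) x e))" if "el = Tok \<mu>" for \<mu>
    unfolding mtok_def using el that by (intro cond_token ms) auto
  show "cond ?K (\<lambda>x e. nd x (el, number k (a + 3) x e, 2 * number ?i (a + 3) x e + h))"
    unfolding needed_def prod.case
    by (rule cond_needed_elem) (intro tk cond_number_zero[OF i(2)] cond_pos_zero[OF i(1) h] cond_pos_guess_le[OF i(1) h]
        cond_pos_guess[OF i(1) h] cond_pos_origin[OF i(1) h] cond_pos_init[OF i(1) h] | assumption)+
qed

lemma lp_row_zero: "lp k (\<lambda>x e. concat (map g (row (IS x) (ES x) (\<lambda>_. False))))"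
  by (rule lp_row) (rule cond_const)

lemma lp_row_items: "lp k (\<lambda>x e. concat (map (\<lambda>it. concat (map g (row (IS x) (ES x) (cov x it))) @ s) (IS x)))"
proof (rule lp_grid, rule lp_append[OF _ lp_const], rule lp_row)
  fix \<kappa> el and h h' :: nat assume h: "h \<in> {0, 1}" "h' \<in> {0, 1}"
  let ?d = "a + 3"
  let ?k = "k + ?d + ?d"
  let ?K = "?k + ?d + ?d"
  have l: "k + ?d \<le> ?k" "k + ?d + ?d \<le> ?k" "k + ?d \<le> ?K" "k + ?d + ?d \<le> ?K" "?k + ?d \<le> ?K" "?k + ?d + ?d \<le> ?K" by simp_all
  have n: "k \<noteq> ?k" "k + ?d \<noteq> ?k + ?d" "?k + ?d \<noteq> k + ?d" by simp_all
  have pw: "cond ?K (\<lambda>x e. number k ?d x e = cc x)"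
    using cond_number_pow[of k "a + 2" ?K] by (simp add: eval_nat_numeral)
  show "cond ?K (\<lambda>x e. cov x (\<kappa>, number k ?d x (take ?k e), 2 * number (k + ?d) ?d x (take ?k e) + h)
      (el, number ?k ?d x e, 2 * number (?k + ?d) ?d x e + h'))"
    unfolding covers_def prod.case number_take[OF l(1)] number_take[OF l(2)]
    by (rule cond_covers_elem)
      (intro pw cond_number_eq cond_number_suc cond_number_zero cond_pos_zero cond_pos_origin cond_pos_eq cond_pos_suc l n h)+
qed

abbreviation "mm x \<equiv> length (IS x)"
text \<open>A weight bit \<open>b\<close> becomes \<open>True, b\<close> in the self-delimiting
  code, and \<open>pair_str\<close> then doubles both.\<close>

abbreviation "quad \<equiv> \<lambda>b. [True, True, b, b]"

text \<open>Everything before the top bits of the heavy weight. The suffix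
  \<open>[True, True, True, True, False, False]\<close> is the leading bit of an ordinary weight
  with its terminator.\<close>

definition print_A :: "bool list \<Rightarrow> bool list" where
  "print_A x = concat (replicate (2 * mm x + 2) [True, True]) @ [False, False] @
    (concat (map quad (row (IS x) (ES x) (\<lambda>_. False))) @ [True, True, True, True, False, False]) @
    concat (map (\<lambda>it. concat (map quad (row (IS x) (ES x) (cov x it))) @ [True, True, True, True, False, False]) (IS x)) @
    concat (replicate (mm x) (concat (map quad (row (IS x) (ES x) (\<lambda>_. False))) @ [True, True, True, True, False, False])) @
    concat (map quad (row (IS x) (ES x) (nd x)))"

text \<open>Everything between the two copies of the count: the terminator of the heavy weight, the
  doubled adjacency matrix, the separator of the pair, and the lower digits of the threshold, which
  are no longer doubled.\<close>

definition print_B :: "bool list \<Rightarrow> bool list" where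
  "print_B x = [False, False] @ ([False, False] @ concat (replicate (2 * mm x + 1) [True, True])) @
    concat (replicate (2 * mm x + 1) ([True, True] @ concat (replicate (2 * mm x + 1) [False, False]))) @
    [False, True] @ concat (map (\<lambda>b. [b]) (row (IS x) (ES x) (nd x)))"

definition print_C :: "bool list \<Rightarrow> bool list" where
  "print_C x = concat (replicate (mm x) [True]) @ [True]"

lemma concat_replicate_comm: "concat (replicate n z) @ z = z @ concat (replicate n z)"
  by (induction n) auto

lemma lp_twice:
  assumes "\<And>k. lp k (\<lambda>x e. s x)"
  shows "lp k (\<lambda>x e. concat (replicate (2 * mm x + 1) (s x)))"
proof -
  have "lp k (\<lambda>x e. concat (replicate (mm x) (s x)) @ concat (replicate (mm x) (s x)) @ s x)"
    by (intro lp_append lp_items assms)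
  moreover have "concat (replicate (2 * n + 1) z) = concat (replicate n z) @ concat (replicate n z) @ z" for n and z :: "bool list"
    by (simp add: mult_2 replicate_add concat_replicate_comm)
  ultimately show ?thesis by simp
qed

lemma lp_print_A: "lp k (\<lambda>x e. print_A x)"
proof -
  have r: "concat (replicate (2 * n + 2) z) = concat (replicate (2 * n + 1) z) @ z" for n and z :: "bool list"
    by (simp add: concat_replicate_comm)
  show ?thesis
    unfolding print_A_def r
    by (intro lp_append lp_twice lp_items lp_row_items lp_row_need lp_row_zero lp_const)
qed

lemma lp_print_B: "lp k (\<lambda>x e. print_B x)"
  unfolding print_B_def by (intro lp_append lp_twice lp_row_need lp_const)

lemma lp_print_C: "lp k (\<lambda>x e. print_C x)"
  unfolding print_C_def by (intro lp_append lp_items lp_const)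

lemma polytime_instance:
  "polytime_computable (\<lambda>x. print_A x @ concat (map quad (bits (Suc (mm x)))) @ print_B x @ bits (Suc (mm x)))"
proof -
  have "length (print_C x) = Suc (mm x)" for x
    by (simp add: print_C_def length_concat sum_list_replicate)
  with polytime_lp_count[OF lp_print_A lp_print_B lp_print_C, of quad] show ?thesis by simp
qed

lemma concat_double: "concat (map (\<lambda>b. [b, b]) (concat xss)) = concat (map (\<lambda>xs. concat (map (\<lambda>b. [b, b]) xs)) xss)"
  by (induction xss) auto

lemma double_pairs: "concat (map (\<lambda>b. [b, b]) (concat (map (\<lambda>b. [True, b]) s))) = concat (map quad s)"
  by (induction s) auto

lemma star_matrix:
  "concat (map (\<lambda>i. map (\<lambda>j. i \<noteq> j \<and> (i = 0 \<or> j = 0)) [0..<Suc n]) [0..<Suc n]) =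
    (False # replicate n True) @ concat (replicate n (True # replicate n False))"
proof -
  have "map (\<lambda>j. (0 :: nat) \<noteq> j \<and> (0 = 0 \<or> j = 0)) [0..<Suc n] = False # replicate n True"
    by (rule nth_equalityI) (auto simp: nth_Cons' simp del: upt_Suc)
  moreover have "map (\<lambda>j. i \<noteq> j \<and> (i = 0 \<or> j = 0)) [0..<Suc n] = True # replicate n False" if "i \<in> set [1..<Suc n]" for i
    using that by (intro nth_equalityI) (auto simp: nth_Cons' simp del: upt_Suc)
  then have "map (\<lambda>i. map (\<lambda>j. i \<noteq> j \<and> (i = 0 \<or> j = 0)) [0..<Suc n]) [1..<Suc n] = map (\<lambda>_. True # replicate n False) [1..<Suc n]"
    by (rule map_cong[OF refl])
  then have "map (\<lambda>i. map (\<lambda>j. i \<noteq> j \<and> (i = 0 \<or> j = 0)) [0..<Suc n]) [1..<Suc n] = replicate n (True # replicate n False)"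
    by (simp add: map_replicate_const del: upt_Suc)
  moreover have "[0..<Suc n] = 0 # [1..<Suc n]" by (simp add: upt_conv_Cons del: upt_Suc)
  ultimately show ?thesis by (simp del: upt_Suc)
qed

lemma instance_eq:
  assumes "cover_star (IS x)"
  shows "pair_str (enc_weighted_graph (star_graph (cover_star.n (IS x)), cover_star.w (IS x) (ES x) (cov x) (nd x)))
      (bits (cover_star.W (IS x) (ES x) (nd x))) =
    print_A x @ concat (map quad (bits (Suc (mm x)))) @ print_B x @ bits (Suc (mm x))"
proof -
  interpret cover_star "IS x" "ES x" "cov x" "nd x" by (rule assms)
  have W: "bits W = row (IS x) (ES x) (nd x) @ bits (Suc (mm x))"
    unfolding W_def using last_bits[of "Suc (mm x)"] by (subst bits_num) (auto simp: m_def)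
  have n: "n = Suc (2 * mm x + 1)" by (simp add: n_def m_def)
  have d: "concat (map (\<lambda>b. [b, b]) (replicate k b)) = concat (replicate k [b, b])" for k b
    by (induction k) auto
  show ?thesis
    unfolding pair_str_def enc_instance W
    unfolding n star_matrix strs_def weight_strs_def print_A_def print_B_def
    by (simp add: concat_double double_pairs d o_def map_replicate_const)
qed

end

subsection \<open>The reduction\<close>

lemma poly_nat_mono: "m \<le> n \<Longrightarrow> poly (q :: nat poly) m \<le> poly q n"
  by (induction q) (auto intro!: add_mono mult_mono)

text \<open>Replaces the time bound by a pure power of the base, a number with a single nonzero
  digit. A constant \<open>a\<close> is absorbed by
  \<open>a <= 2 ^ a <= (n + 2) ^ a\<close>.\<close>

lemma poly_le_power: "\<exists>m. \<forall>n. poly (q :: nat poly) n \<le> (n + 2) ^ m"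
proof (induction q)
  case 0
  then show ?case by simp
next
  case (pCons a q)
  then obtain m where m: "\<And>n. poly q n \<le> (n + 2) ^ m" by blast
  have "poly (pCons a q) n \<le> (n + 2) ^ (a + m + 2)" for n
  proof -
    have "a \<le> 2 ^ a" by (simp add: less_exp less_imp_le)
    also have "\<dots> \<le> (n + 2) ^ a" by (rule power_mono) auto
    also have "\<dots> \<le> (n + 2) ^ (a + m + 1)" by (rule power_increasing) auto
    finally have 1: "a \<le> (n + 2) ^ (a + m + 1)" .
    have "n * poly q n \<le> (n + 2) * (n + 2) ^ m" by (rule mult_mono) (use m in auto)
    also have "\<dots> \<le> (n + 2) ^ (a + m + 1)" using power_increasing[of "m + 1" "a + m + 1" "n + 2"] by simp
    finally have 2: "n * poly q n \<le> (n + 2) ^ (a + m + 1)" .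
    have "poly (pCons a q) n \<le> 2 * (n + 2) ^ (a + m + 1)" using 1 2 by simp
    also have "\<dots> \<le> (n + 2) * (n + 2) ^ (a + m + 1)" by (rule mult_le_mono1) simp
    finally show ?thesis by simp
  qed
  then show ?case by blast
qed

text \<open>A polynomial with natural coefficients is a sum of monomials, each repeated according to
  its coefficient. Every entry becomes one family of tokens.\<close>

definition monomials :: "nat poly \<Rightarrow> nat list" where
  "monomials p = concat (map (\<lambda>i. replicate (coeff p i) i) [0..<Suc (degree p)])"

lemma set_monomials: "i \<in> set (monomials p) \<Longrightarrow> i \<le> degree p"
  by (auto simp: monomials_def split: if_splits)

lemma sum_monomials: "(\<Sum>\<mu><length (monomials p). n ^ (monomials p ! \<mu>)) = poly p n"
proof -
  have "(\<Sum>\<mu><length (monomials p). n ^ (monomials p ! \<mu>)) = sum_list (map (\<lambda>i. n ^ i) (monomials p))"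
    by (simp add: sum_list_sum_nth atLeast0LessThan)
  also have "\<dots> = sum_list (map (\<lambda>i. coeff p i * n ^ i) [0..<Suc (degree p)])"
  proof -
    have "sum_list (map (\<lambda>i. n ^ i) (concat (map (\<lambda>i. replicate (coeff p i) i) is))) =
        sum_list (map (\<lambda>i. coeff p i * n ^ i) is)" for "is"
      by (induction "is") (auto simp: sum_list_replicate)
    then show ?thesis by (simp only: monomials_def)
  qed
  also have "\<dots> = (\<Sum>i\<le>degree p. coeff p i * n ^ i)"
    by (simp add: interv_sum_list_conv_sum_set_nat atLeast0AtMost atLeastLessThanSuc_atLeastAtMost del: upt_Suc)
  finally show ?thesis by (simp add: poly_altdef)
qed

lemma card_mtok:
  assumes "\<And>i. i \<in> set ms \<Longrightarrow> i \<le> d"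
  shows "card {(\<mu>, j). \<mu> < length ms \<and> j < base x ^ d \<and> mtok ms x \<mu> j} = (\<Sum>\<mu><length ms. length x ^ (ms ! \<mu>))"
proof -
  have b: "base x \<ge> 2" "base x - 2 = length x" by (auto simp: base_def)
  have less: "j < base x ^ d" if "\<mu> < length ms" "token (base x) (ms ! \<mu>) j" for \<mu> j
  proof -
    have "j < base x ^ (ms ! \<mu>)" using token_less[OF _ that(2)] by simp
    also have "\<dots> \<le> base x ^ d" using assms[of "ms ! \<mu>"] that(1) by (intro power_increasing) (auto simp: base_def)
    finally show ?thesis .
  qed
  then have "{(\<mu>, j). \<mu> < length ms \<and> j < base x ^ d \<and> mtok ms x \<mu> j} = (SIGMA \<mu>:{..<length ms}. {j. token (base x) (ms ! \<mu>) j})"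
    by (auto simp: mtok_def)
  moreover have "finite {j. token (base x) (ms ! \<mu>) j}" if "\<mu> < length ms" for \<mu>
  proof (rule finite_subset)
    show "{j. token (base x) (ms ! \<mu>) j} \<subseteq> {..<base x ^ d}" using less[OF that] by blast
  qed simp
  ultimately show ?thesis by (simp add: card_token[OF b(1)] b(2))
qed

lemma last_tape_at:
  assumes "wf_tm M"
  shows "last (snd (config_at M z t)) = tape_at M z t (tapes M - 1)"
proof -
  interpret verifier M z using assms by unfold_locales
  have "length (snd (config_at M z t)) = tapes M" "tapes M \<ge> 1" using cf_wf k_pos by auto
  then show ?thesis by (simp add: tape_at_def last_conv_nth flip: length_greater_0_conv)
qed

lemma NP_tableau:
  assumes "L \<in> NP_class"
  obtains M a p where "degree p \<le> a"
    "\<And>x. exact_cover (IS M (monomials p) a x) (ES M (monomials p) a x) (cov M a x) (nd (monomials p) a x) \<longleftrightarrow> x \<in> L"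
proof -
  obtain R p where R: "R \<in> P_class" "\<And>x. x \<in> L \<longleftrightarrow> (\<exists>y. length y \<le> poly p (length x) \<and> pair_str x y \<in> R)"
    using assms by (auto simp: NP_class_def)
  obtain M r where M: "wf_tm M" "computes_in_time M (\<lambda>z. [z \<in> R]) (poly r)"
    using R(1) by (auto simp: P_class_def polytime_computable_def)
  \<comment> \<open>The terms are those required of \<open>c\<close>: \<open>2 * base x + 4\<close>
    is \<open>2 * n + 8\<close> for inputs of length \<open>n\<close>, and \<open>r\<close> is
    composed with the bound \<open>2 * n + 2 + p(n)\<close> on the length of the paired
    string.\<close>
  obtain m where m: "\<And>n. poly ([:8, 2:] + p + pcompose r ([:2, 2:] + p)) n \<le> (n + 2) ^ m"
    using poly_le_power by blast
  \<comment> \<open>The part \<open>m\<close> makes \<open>c\<close> large enough;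
    \<open>degree p\<close> ensures that the tokens of every monomial fit into \<open>a + 3\<close>
    digits.\<close>
  define a where "a = m + degree p"
  have "exact_cover (IS M (monomials p) a x) (ES M (monomials p) a x) (cov M a x) (nd (monomials p) a x) \<longleftrightarrow> x \<in> L" for x
  proof -
    let ?n = "length x"
    define T0 where "T0 = poly r (poly ([:2, 2:] + p) ?n)"
    have run: "\<exists>t\<le>T0. fst (config_at M (pair_str x y) t) = states M \<and> has_output (config_at M (pair_str x y) t) [pair_str x y \<in> R]"
      if "length y \<le> poly p ?n" for y
    proof -
      have "length (pair_str x y) \<le> poly ([:2, 2:] + p) ?n" using that by (simp add: pair_str_def)
      then have "poly r (length (pair_str x y)) \<le> T0" unfolding T0_def by (rule poly_nat_mono)
      then show ?thesis
        using M(2)[unfolded computes_in_time_def, rule_format, of "pair_str x y"]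
        unfolding config_at_def by (meson le_trans)
    qed
    have c: "2 * base x + poly p ?n + T0 + 4 \<le> base x ^ (a + 2)"
    proof -
      have "2 * base x + poly p ?n + T0 + 4 = poly ([:8, 2:] + p + pcompose r ([:2, 2:] + p)) ?n"
        by (simp add: poly_pcompose T0_def base_def)
      also have "\<dots> \<le> base x ^ m" using m[of ?n] by (simp add: base_def)
      also have "\<dots> \<le> base x ^ (a + 2)" by (rule power_increasing) (auto simp: a_def base_def)
      finally show ?thesis .
    qed
    have D: "2 * base x ^ (a + 2) \<le> base x ^ (a + 3)"
      using mult_le_mono1[of 2 "base x" "base x ^ (a + 2)"] by (simp add: base_def eval_nat_numeral)
    have ms: "i \<le> a + 3" if "i \<in> set (monomials p)" for i
      using set_monomials[OF that] by (simp add: a_def)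
    interpret tableau M x "poly p ?n" "base x ^ (a + 3)" "base x ^ (a + 2)" T0 "length (monomials p)" "mtok (monomials p) x"
    proof unfold_locales
      show "card {(\<mu>, j). \<mu> < length (monomials p) \<and> j < base x ^ (a + 3) \<and> mtok (monomials p) x \<mu> j} = poly p ?n"
        using card_mtok[where x = x, OF ms] sum_monomials by simp
      show "\<exists>t\<le>T0. fst (config_at M (pair_str x y) t) = states M" if "length y \<le> poly p ?n" for y
        using run[OF that] by blast
    qed (use M(1) c D in auto)
    have "accepts y \<longleftrightarrow> pair_str x y \<in> R" if y: "length y \<le> poly p ?n" for y
    proof -
      interpret verifier M "pair_str x y" using M(1) by unfold_locales
      obtain t where t: "t \<le> T0" "fst (config_at M (pair_str x y) t) = states M"
        "has_output (config_at M (pair_str x y) t) [pair_str x y \<in> R]"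
        using run[OF y] by blast
      \<comment> \<open>The verifier has halted by time \<open>c\<close>, so the answer can be
        inspected at this one fixed time for all certificates.\<close>
      have "config_at M (pair_str x y) (base x ^ (a + 2)) = config_at M (pair_str x y) t"
        by (rule halted[OF t(2)]) (use t(1) c in simp)
      then have "fst (tape_at M (pair_str x y) (base x ^ (a + 2)) (tapes M - 1)) 0 = sym_of_bit (pair_str x y \<in> R)"
        using t(3) last_tape_at[OF M(1), of "pair_str x y" "base x ^ (a + 2)"] by (simp add: has_output_def)
      then show ?thesis unfolding accepts_def by (simp only: sym_of_bit_simps)
    qed
    then show ?thesis unfolding exact_cover_iff R(2) by blast
  qed
  moreover have "degree p \<le> a" by (simp add: a_def)
  ultimately show ?thesis using that[of p a M] by blast
qed

lemma NP_hard_to_determineI: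
  assumes "\<And>L. L \<in> NP_class \<Longrightarrow> \<exists>g h. polytime_computable (\<lambda>x. pair_str (enc (g x)) (bits (h x))) \<and>
    (\<forall>x. g x \<in> I \<and> (val (g x) \<le> h x \<longleftrightarrow> x \<in> L))"
  shows "NP_hard_to_determine enc I val"
  unfolding NP_hard_to_determine_def NP_hard_promise_def
proof
  fix L assume "L \<in> NP_class"
  then obtain g h where p: "polytime_computable (\<lambda>x. pair_str (enc (g x)) (bits (h x)))"
    and gh: "\<And>x. g x \<in> I" "\<And>x. val (g x) \<le> h x \<longleftrightarrow> x \<in> L"
    using assms by blast
  have "(x \<in> L \<longrightarrow> pair_str (enc (g x)) (bits (h x)) \<in> {pair_str (enc i) (bits k) | i k. i \<in> I \<and> val i \<le> k}) \<and>
    (x \<notin> L \<longrightarrow> pair_str (enc (g x)) (bits (h x)) \<in> {pair_str (enc i) (bits k) | i k. i \<in> I \<and> \<not> val i \<le> k})" for x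
    using gh[of x] by blast
  with p show "\<exists>f. polytime_computable f \<and>
      (\<forall>x. (x \<in> L \<longrightarrow> f x \<in> {pair_str (enc i) (bits k) | i k. i \<in> I \<and> val i \<le> k}) \<and>
        (x \<notin> L \<longrightarrow> f x \<in> {pair_str (enc i) (bits k) | i k. i \<in> I \<and> \<not> val i \<le> k}))"
    by (intro exI[of _ "\<lambda>x. pair_str (enc (g x)) (bits (h x))"]) simp
qed

theorem theorem4:
  shows "NP_hard_to_determine enc_weighted_graph
    {(T, w). star (with_proj T) \<and> pverts T = {..<card (pverts T)} \<and>
      (\<forall>u \<in> pverts T. w u > 0) \<and>
      (\<exists>u' \<in> pverts T.
        1 / real (card (pverts T)) * real (weight w (with_proj T))
          \<le> 4 * real (Min {w u | u. u \<in> pverts T - {u'}}))}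
    (\<lambda>(T, w). cs (with_proj T) w)"
proof (rule NP_hard_to_determineI)
  fix L assume "L \<in> NP_class"
  then obtain M a p where a: "degree p \<le> a" and
    L: "\<And>x. exact_cover (IS M (monomials p) a x) (ES M (monomials p) a x) (cov M a x) (nd (monomials p) a x) \<longleftrightarrow> x \<in> L"
    by (rule NP_tableau) (rule that)
  have ms: "i \<le> a + 3" if "i \<in> set (monomials p)" for i
    using set_monomials[OF that] a by simp
  let ?Is = "IS M (monomials p) a" and ?Es = "ES M (monomials p) a"
    and ?cov = "cov M a" and ?nd = "nd (monomials p) a"
  have cs: "cover_star (?Is x)" for x
  proof
    show "distinct (?Is x)" by (rule distinct_grid) (simp add: items_def)
    have "(IEnd True, 0, 0) \<in> set (?Is x)" by (simp add: set_grid)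
    then show "?Is x \<noteq> []" by force
  qed
  define g where "g x = (star_graph (cover_star.n (?Is x)), cover_star.w (?Is x) (?Es x) (?cov x) (?nd x))" for x
  define h where "h x = cover_star.W (?Is x) (?Es x) (?nd x)" for x
  have "(\<lambda>x. pair_str (enc_weighted_graph (g x)) (bits (h x))) =
      (\<lambda>x. print_A M (monomials p) a x @ concat (map quad (bits (Suc (mm M (monomials p) a x)))) @
        print_B M (monomials p) a x @ bits (Suc (mm M (monomials p) a x)))"
    by (rule ext) (simp only: g_def h_def instance_eq[OF ms cs])
  then have p: "polytime_computable (\<lambda>x. pair_str (enc_weighted_graph (g x)) (bits (h x)))"
    using polytime_instance[OF ms] by simp
  let ?I = "{(T, w). star (with_proj T) \<and> pverts T = {..<card (pverts T)} \<and>
      (\<forall>u \<in> pverts T. w u > 0) \<and>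
      (\<exists>u' \<in> pverts T.
        1 / real (card (pverts T)) * real (weight w (with_proj T))
          \<le> 4 * real (Min {w u | u. u \<in> pverts T - {u'}}))} :: (nat pair_pre_digraph \<times> (nat \<Rightarrow> nat)) set"
  have "g x \<in> ?I \<and> ((case g x of (T, w) \<Rightarrow> cs (with_proj T) w) \<le> h x \<longleftrightarrow> x \<in> L)" for x
  proof -
    interpret cover_star "?Is x" "?Es x" "?cov x" "?nd x" by (rule cs)
    show ?thesis
      unfolding g_def h_def mem_Collect_eq prod.case using instance_promise cs_le_iff L[of x] by simp
  qed
  then show "\<exists>g h. polytime_computable (\<lambda>x. pair_str (enc_weighted_graph (g x)) (bits (h x))) \<and>
      (\<forall>x. g x \<in> ?I \<and> ((case g x of (T, w) \<Rightarrow> cs (with_proj T) w) \<le> h x \<longleftrightarrow> x \<in> L))"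
    using p by (intro exI[of _ g] exI[of _ h] conjI allI) simp_all
qed

end
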